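(* The Principal hierarchy of the Frobenius manifold $M_0$ coincides with the extended dispersionless 2D Toda hierarchy restricted to the loop space $\mathcal LM_0=C^\infty(S^1,M_0)$; that is, for every $\hat\alpha\in\hat{\mathbb Z}=\mathbb Z\cup\{u,v\}$ and $p\ge0$, the flow $\frac{\partial}{\partial t^{\hat\alpha,p}}$ of the one coincides with the flow $\frac{\partial}{\partial t^{\hat\alpha,p}}$ of the other on $\mathcal LM_0$.
   Context: **Manifold.** $D_0$ is the closed unit disc, $D_\infty$ the closure of its complement in $\mathbb C\cup\{\infty\}$, $\mathbb S^1$ the unit circle, $\mathcal H(K)$ the functions holomorphic near $K$. For $f=\sum f_kz^k\in\mathcal H(\mathbb S^1)$, $(f)_+=\sum_{k\ge0}f_kz^k$, $(f)_-=\sum_{k<0}f_kz^k$. $M_0$ is the set of pairs $(\lambda,\bar\lambda)\in z\mathcal H(D_\infty)\oplus\frac1z\mathcal H(D_0)$, $\lambda=z+O(1)$ at $\infty$, $\bar\lambda=\bar u_{-1}z^{-1}+\bar u_0+\cdots$ at $0$ ($\bar\lambda$ is not a complex conjugate), such that, with $w=\lambda+\bar\lambda$: (i) $\bar u_{-1}\neq0$ and $w'\ne0$ on $\mathbb S^1$; (ii) the closed curve parametrized by $w|_{\mathbb S^1}$ is positively oriented, non-selfintersecting and encircles $0$; (iii) $\lambda,\bar\lambda$ do not vanish on $D_\infty,D_0$ respectively. Coordinates on $M_0$: $(w(z),v,u)$, $v=\bar u_0$, $e^u=\bar u_{-1}$. Vectors are triples $(X(z),X_v,X_u)=(\partial_Xw(z),\partial_Xv,\partial_Xu)$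 and $1$-forms triples $(\alpha(z),\alpha_v,\alpha_u)$ in $\mathcal H(\mathbb S^1)\oplus\mathbb C^2$, with pairing $\frac1{2\pi i}\oint_{|z|=1}\alpha(z)X(z)\frac{dz}z+\alpha_vX_v+\alpha_uX_u$. $S^1=\mathbb R/2\pi\mathbb Z$ has coordinate $x$. **Special functions.** $\mathrm{Ein}(z)=-\sum_{n\ge1}\frac{(-z)^n}{n!\,n}$, $(2p)!!=2^pp!$, $c_p=1+\cdots+\frac1p$, $c_0=0$. $\log(1+\bar\lambda/\lambda):=\log\frac wz-\log\frac\lambda z$, $\log(\bar\lambda(\lambda+\bar\lambda)):=\log(z\bar\lambda)+\log\frac wz$; these are holomorphic near $\mathbb S^1$, with $\log\frac\lambda z\in\frac1z\mathcal H(D_\infty)$, $\log(z\bar\lambda)\in\mathcal H(D_0)$ equal to $u$ at $z=0$, and the branch of $\log\frac wz$ fixed continuously; the same branches are used in both hierarchies. **Extended dispersionless 2D Toda hierarchy.** With $\{f,g\}=zf_zg_x-zg_zf_x$, it is the set of flows ($\hat\alpha\in\hat{\mathbb Z}$, $p\ge0$) $$\frac{\partial\lambda}{\partial t^{\hat\alpha,p}}=\{-(Q_{\hat\alpha,p})_-,\lambda\},\qquad\frac{\partial\bar\lambda}{\partial t^{\hat\alpha,p}}=\{(Q_{\hat\alpha,p})_+,\bar\lambda\},$$ $Q_{\alpha,p}=-\frac{(\lambda+\bar\lambda)^{\alpha+1}(\bar\lambda-\lambda)^p}{(\alpha+1)(2p)!!}$ for $\alpha\in\mathbb Z\setminus\{-1\}$;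 $Q_{-1,p}=-\frac{(-\lambda)^p}{p!}\big(\log(1+\frac{\bar\lambda}\lambda)+c_p-1\big)-\frac{(\bar\lambda-\lambda)^p}{(2p)!!}$; $Q_{v,p}=-\frac{(-\lambda)^p}{p!}\big(\log(1+\frac{\bar\lambda}\lambda)+c_p-1\big)+\frac{\bar\lambda^p}{p!}\big(\log(\bar\lambda(\lambda+\bar\lambda))-c_p-1\big)$; $Q_{u,p}=\frac{\bar\lambda^{p+1}}{(p+1)!}$. (These flows are defined on $\mathcal LM_1$, where $M_1\supset M_0$ is the set of pairs, in the same affine space, for which $w,\lambda,\bar\lambda$ restricted to $\mathbb S^1$ are nonvanishing with winding numbers $1,1,-1$ around $0$.) **Principal hierarchy of $M_0$.** The flat metric on $M_0$ is $\eta(\alpha,\beta)=\frac1{2\pi i}\oint_{|z|=1}\alpha(z)\beta(z)w'(z)\,dz+\alpha_v\beta_u+\alpha_u\beta_v$, with associated map $\eta^*(\alpha)=(zw'\alpha(z),\alpha_u,\alpha_v)$. The associated Poisson bracket of hydrodynamic type $\{\,,\}_1$ on $\mathcal LM_0$ has Poisson operator $P(\omega)=\eta^*(\nabla_{\partial_x}\omega)$, with $\nabla$ the Levi-Civita connection of $\eta$; explicitly, for a $1$-form $\omega=(\omega(z,x),\omega_v(x),\omega_u(x))$, $P(\omega)=(zw_z\omega_x-z\omega_zw_x,\ \partial_x\omega_u,\ \partial_x\omega_v)$. The Principal hierarchy is the set of Hamiltonian flows $\frac{\partial}{\partial t^{\hat\alpha,p}}\cdot=\{\cdot,H_{\hat\alpha,p}\}_1$,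 i.e. the vector fields $P(dH_{\hat\alpha,p})$, with $H_{\hat\alpha,p}=\oint_{S^1}\theta_{\hat\alpha,p+1}\,dx$, where $\theta_{\hat\alpha}(\zeta)=\sum_{p\ge0}\theta_{\hat\alpha,p}\zeta^p$ are the expansions at $\zeta=0$ of the following functions on $M_0$ (the analytic parts of the Levelt basis of deformed flat coordinates $y_\alpha=\zeta^{\alpha+\frac12}\theta_\alpha$, $y_v=\zeta^{\frac12}(\zeta^{-1}\theta_v+2\log\zeta\,\theta_u)$, $y_u=\zeta^{\frac12}\theta_u$): $\theta_\alpha(\zeta)=-\frac1{2\pi i}\oint_{|z|=1}\frac{(\lambda+\bar\lambda)^{\alpha+1}}{\alpha+1}e^{\frac{\bar\lambda-\lambda}2\zeta}\frac{dz}z$ ($\alpha\neq-1$); $\theta_{-1}(\zeta)=-\frac1{2\pi i}\oint_{|z|=1}\big[e^{-\lambda\zeta}(\log(1+\frac{\bar\lambda}\lambda)+\mathrm{Ein}(-\lambda\zeta)-1)+e^{\frac{\bar\lambda-\lambda}2\zeta}\big]\frac{dz}z$; $\theta_v(\zeta)=\frac1{2\pi i}\oint_{|z|=1}\big[-e^{-\lambda\zeta}(\log(1+\frac{\bar\lambda}\lambda)+\mathrm{Ein}(-\lambda\zeta)-1)+e^{\bar\lambda\zeta}(\log(\bar\lambda(\lambda+\bar\lambda))-\mathrm{Ein}(\bar\lambda\zeta)-1)\big]\frac{dz}z$; $\theta_u(\zeta)=\frac1{2\pi i}\oint_{|z|=1}\frac{e^{\bar\lambda\zeta}-1}\zeta\frac{dz}z$.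 *)

theory Defs
  imports "HOL-Complex_Analysis.Complex_Analysis" "HOL-Library.Landau_Symbols"
begin

section \<open>Germs of holomorphic functions\<close>

abbreviation circle :: "complex set" where "circle \<equiv> sphere 0 1"

text \<open>\<^const>\<open>analytic_on\<close> means holomorphic on some open superset. The point at infinity and the
  possible pole at the origin are left out of the two domains below; the behaviour there is imposed
  by separate conditions. Functions are total, and only their values on these sets matter.\<close>

abbreviation Dinf :: "complex set" where "Dinf \<equiv> {z. 1 \<le> norm z}"

abbreviation D0p :: "complex set" where "D0p \<equiv> cball 0 1 - {0}"

text \<open>A function analytic for large \<open>z\<close> and \<open>O(1)\<close> there is holomorphic at infinity.\<close>

definition hol_Dinf :: "(complex \<Rightarrow> complex) \<Rightarrow> bool" where
  "hol_Dinf f \<longleftrightarrow> f analytic_on Dinf \<and> f \<in> O[at_infinity](\<lambda>_. 1)"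

definition hol_inv_D0 :: "(complex \<Rightarrow> complex) \<Rightarrow> bool" where  \<comment> \<open>the space \<open>z\<^sup>-\<^sup>1 H(D\<^sub>0)\<close>\<close>
  "hol_inv_D0 f \<longleftrightarrow> f analytic_on D0p \<and>
     (\<exists>h. h analytic_on cball 0 1 \<and> (\<forall>z\<in>D0p. f z = h z / z))"

definition cint :: "(complex \<Rightarrow> complex) \<Rightarrow> complex" where
  "cint f = contour_integral (circlepath 0 1) (\<lambda>z. f z / z) / (2 * of_real pi * \<i>)"

definition lcoeff :: "(complex \<Rightarrow> complex) \<Rightarrow> int \<Rightarrow> complex" where
  "lcoeff f k = cint (\<lambda>z. f z * z powi (- k))"

definition plus_part :: "(complex \<Rightarrow> complex) \<Rightarrow> complex \<Rightarrow> complex" where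
  "plus_part f z = (\<Sum>k. lcoeff f (int k) * z ^ k)"

definition minus_part :: "(complex \<Rightarrow> complex) \<Rightarrow> complex \<Rightarrow> complex" where
  "minus_part f z = (\<Sum>k. lcoeff f (- int (Suc k)) * z powi (- int (Suc k)))"


section \<open>The manifold\<close>

definition M0 :: "((complex \<Rightarrow> complex) \<times> (complex \<Rightarrow> complex)) set" where
  "M0 = {(l, lb).
     l analytic_on Dinf \<and> (\<lambda>z. l z - z) \<in> O[at_infinity](\<lambda>_. 1) \<and> hol_inv_D0 lb \<and>
     (let w = (\<lambda>z. l z + lb z); c = w \<circ> circlepath 0 1 in
        lcoeff lb (-1) \<noteq> 0 \<and> (\<forall>z\<in>circle. deriv w z \<noteq> 0) \<and>
        simple_path c \<and> (\<forall>a\<in>inside (path_image c). winding_number c a = 1) \<and>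
        0 \<in> inside (path_image c) \<and>
        (\<forall>z\<in>Dinf. l z \<noteq> 0) \<and> (\<forall>z\<in>D0p. lb z \<noteq> 0))}"

text \<open>A point of \<^const>\<open>M0\<close> together with the coordinate \<open>u\<close> and a branch of \<open>log (w / z)\<close> on the
  unit circle.\<close>

datatype point = Point
  (lam: "complex \<Rightarrow> complex") (lamb: "complex \<Rightarrow> complex")
  (ucoord: complex) (logwz: "complex \<Rightarrow> complex")

definition wfun :: "point \<Rightarrow> complex \<Rightarrow> complex" where
  "wfun m z = lam m z + lamb m z"

definition M0_branched :: "point set" where
  "M0_branched = {m. (lam m, lamb m) \<in> M0 \<and> exp (ucoord m) = lcoeff (lamb m) (-1) \<and>
     logwz m analytic_on circle \<and> (\<forall>z\<in>circle. exp (logwz m z) = wfun m z / z)}"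

text \<open>The values on \<^const>\<open>Dinf\<close> and on the closed disc, respectively, are uniquely determined.\<close>

definition log_lam :: "point \<Rightarrow> complex \<Rightarrow> complex" where
  "log_lam m = (SOME g. g analytic_on Dinf \<and> (g \<longlongrightarrow> 0) at_infinity \<and>
      (\<forall>z\<in>Dinf. exp (g z) = lam m z / z))"

definition log_lamb :: "point \<Rightarrow> complex \<Rightarrow> complex" where
  "log_lamb m = (SOME g. g analytic_on cball 0 1 \<and> g 0 = ucoord m \<and>
      (\<forall>z\<in>D0p. exp (g z) = z * lamb m z))"

definition log1p :: "point \<Rightarrow> complex \<Rightarrow> complex" where  \<comment> \<open>\<open>log (1 + lamb / lam)\<close>\<close>
  "log1p m z = logwz m z - log_lam m z"

definition log_lamb_w :: "point \<Rightarrow> complex \<Rightarrow> complex" where  \<comment> \<open>\<open>log (lamb (lam + lamb))\<close>\<close>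
  "log_lamb_w m z = log_lamb m z + logwz m z"


section \<open>Smooth loops\<close>

definition smooth_fun :: "(real \<Rightarrow> complex) \<Rightarrow> bool" where
  "smooth_fun f \<longleftrightarrow> (\<exists>F::nat \<Rightarrow> real \<Rightarrow> complex. F 0 = f \<and>
     (\<forall>n x. (F n has_vector_derivative F (Suc n) x) (at x)))"

text \<open>Smooth maps from the line to the functions holomorphic near \<open>K\<close>: all \<open>x\<close>-derivatives exist,
  are jointly continuous, and are holomorphic in \<open>z\<close> on one common neighbourhood of \<open>K\<close>. (For
  periodic maps the neighbourhood can be taken independent of \<open>x\<close> and of the order, since the
  circle is compact.) For \<^const>\<open>Dinf\<close> and \<^const>\<open>D0p\<close>, smoothness of the expansions at infinity and
  at the origin follows from the Cauchy formula on the unit circle.\<close>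

definition smooth_germ :: "complex set \<Rightarrow> (real \<Rightarrow> complex \<Rightarrow> complex) \<Rightarrow> bool" where
  "smooth_germ K f \<longleftrightarrow> (\<exists>U. \<exists>F::nat \<Rightarrow> real \<Rightarrow> complex \<Rightarrow> complex.
     open U \<and> K \<subseteq> U \<and> (\<forall>x. \<forall>z\<in>U. F 0 x z = f x z) \<and>
     (\<forall>n x. F n x holomorphic_on U) \<and>
     (\<forall>n. continuous_on (UNIV \<times> U) (\<lambda>(x, z). F n x z)) \<and>
     (\<forall>n x. \<forall>z\<in>U. ((\<lambda>y. F n y z) has_vector_derivative F (Suc n) x z) (at x)))"

definition smooth_loop :: "complex set \<Rightarrow> (real \<Rightarrow> complex \<Rightarrow> complex) \<Rightarrow> bool" where
  "smooth_loop K f \<longleftrightarrow> smooth_germ K f \<and> (\<forall>x. \<forall>z\<in>K. f (x + 2 * pi) z = f x z)"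

definition smooth_loop_fun :: "(real \<Rightarrow> complex) \<Rightarrow> bool" where
  "smooth_loop_fun f \<longleftrightarrow> smooth_fun f \<and> (\<forall>x. f (x + 2 * pi) = f x)"

text \<open>Loops in \<^const>\<open>M0\<close> with branches varying continuously (hence smoothly). Along a loop, a
  continuous branch of \<open>log (w / z)\<close> always closes up, so its periodicity excludes no loop of
  \<^const>\<open>M0\<close>. The coordinate \<open>u\<close> is only a smooth lift of \<open>log\<close> of the coefficient of
  \<open>z\<^sup>-\<^sup>1\<close> in \<^const>\<open>lamb\<close>, which may wind around the origin; periodicity of \<open>u\<close> is therefore not
  required here.\<close>

definition LM0 :: "(real \<Rightarrow> point) set" where
  "LM0 = {\<gamma>. (\<forall>x. \<gamma> x \<in> M0_branched) \<and>
     smooth_loop Dinf (\<lambda>x. lam (\<gamma> x)) \<and> smooth_loop D0p (\<lambda>x. lamb (\<gamma> x)) \<and>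
     smooth_loop circle (\<lambda>x. logwz (\<gamma> x)) \<and> smooth_fun (\<lambda>x. ucoord (\<gamma> x))}"

text \<open>Tangent vectors to \<^const>\<open>M0\<close>, an open subset of an affine space, are variations of the pair
  \<open>(lam, lamb)\<close>, i.e. elements of the direct sum of the functions holomorphic near the closed
  exterior disc and \<open>z\<^sup>-\<^sup>1\<close> times those holomorphic near the closed disc.\<close>

type_synonym tangent_loop = "(real \<Rightarrow> complex \<Rightarrow> complex) \<times> (real \<Rightarrow> complex \<Rightarrow> complex)"

definition LTM0 :: "tangent_loop set" where
  "LTM0 = {(X, Xb). smooth_loop Dinf X \<and> smooth_loop D0p Xb \<and>
     (\<forall>x. hol_Dinf (X x) \<and> hol_inv_D0 (Xb x))}"

text \<open>Triples \<open>(a(z), a\<^sub>v, a\<^sub>u)\<close>, used both for vectors in the coordinates \<open>(w, v, u)\<close> and for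
  1-forms.\<close>

type_synonym triple = "(complex \<Rightarrow> complex) \<times> complex \<times> complex"

text \<open>Since \<open>exp u\<close> is the coefficient of \<open>z\<^sup>-\<^sup>1\<close> in \<^const>\<open>lamb\<close>, the derivative of \<open>u\<close> is the
  logarithmic derivative of that coefficient.\<close>

definition coords :: "(real \<Rightarrow> point) \<Rightarrow> tangent_loop \<Rightarrow> real \<Rightarrow> triple" where
  "coords \<gamma> X x = (\<lambda>z. fst X x z + snd X x z,
     lcoeff (snd X x) 0, lcoeff (snd X x) (-1) / lcoeff (lamb (\<gamma> x)) (-1))"

definition triple_eq :: "triple \<Rightarrow> triple \<Rightarrow> bool" where
  "triple_eq a b \<longleftrightarrow> (\<forall>z\<in>circle. fst a z = fst b z) \<and> snd a = snd b"

definition pairing :: "triple \<Rightarrow> triple \<Rightarrow> complex" where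
  "pairing a X = cint (\<lambda>z. fst a z * fst X z) + fst (snd a) * fst (snd X) + snd (snd a) * snd (snd X)"

definition smooth_form :: "(real \<Rightarrow> triple) \<Rightarrow> bool" where
  "smooth_form \<omega> \<longleftrightarrow> smooth_loop circle (\<lambda>x. fst (\<omega> x)) \<and>
     smooth_loop_fun (\<lambda>x. fst (snd (\<omega> x))) \<and> smooth_loop_fun (\<lambda>x. snd (snd (\<omega> x)))"

definition bracket ::
  "(real \<Rightarrow> complex \<Rightarrow> complex) \<Rightarrow> (real \<Rightarrow> complex \<Rightarrow> complex) \<Rightarrow> real \<Rightarrow> complex \<Rightarrow> complex" where
  "bracket f g x z = z * deriv (f x) z * vector_derivative (\<lambda>y. g y z) (at x)
     - z * deriv (g x) z * vector_derivative (\<lambda>y. f y z) (at x)"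


section \<open>The two hierarchies\<close>

datatype idx = Z int | V | U

fun Q :: "idx \<Rightarrow> nat \<Rightarrow> point \<Rightarrow> complex \<Rightarrow> complex" where
  "Q (Z a) p m z =
     (if a = -1
      then - ((- lam m z) ^ p / fact p) * (log1p m z + harm p - 1)
           - (lamb m z - lam m z) ^ p / (2 ^ p * fact p)
      else - ((wfun m z powi (a + 1) * (lamb m z - lam m z) ^ p)
              / (of_int (a + 1) * (2 ^ p * fact p))))"
| "Q V p m z = - ((- lam m z) ^ p / fact p) * (log1p m z + harm p - 1)
     + lamb m z ^ p / fact p * (log_lamb_w m z - harm p - 1)"
| "Q U p m z = lamb m z ^ (p + 1) / fact (p + 1)"

definition toda_flow :: "idx \<Rightarrow> nat \<Rightarrow> (real \<Rightarrow> point) \<Rightarrow> tangent_loop \<Rightarrow> bool" where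
  "toda_flow a p \<gamma> X \<longleftrightarrow> (\<forall>x.
     (\<forall>z\<in>Dinf. fst X x z =
        bracket (\<lambda>y \<zeta>. - minus_part (Q a p (\<gamma> y)) \<zeta>) (\<lambda>y. lam (\<gamma> y)) x z) \<and>
     (\<forall>z\<in>D0p. snd X x z =
        bracket (\<lambda>y. plus_part (Q a p (\<gamma> y))) (\<lambda>y. lamb (\<gamma> y)) x z))"

definition Ein :: "complex \<Rightarrow> complex" where
  "Ein z = - (\<Sum>n. (- z) ^ Suc n / (fact (Suc n) * of_nat (Suc n)))"

text \<open>In the last clause the removable singularity at \<open>\<zeta> = 0\<close> is filled in.\<close>

fun theta :: "idx \<Rightarrow> point \<Rightarrow> complex \<Rightarrow> complex" where
  "theta (Z a) m \<zeta> =
     (if a = -1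
      then - cint (\<lambda>z. exp (- lam m z * \<zeta>) * (log1p m z + Ein (- lam m z * \<zeta>) - 1)
                       + exp ((lamb m z - lam m z) / 2 * \<zeta>))
      else - cint (\<lambda>z. wfun m z powi (a + 1) / of_int (a + 1)
                       * exp ((lamb m z - lam m z) / 2 * \<zeta>)))"
| "theta V m \<zeta> = cint (\<lambda>z.
     - exp (- lam m z * \<zeta>) * (log1p m z + Ein (- lam m z * \<zeta>) - 1)
     + exp (lamb m z * \<zeta>) * (log_lamb_w m z - Ein (lamb m z * \<zeta>) - 1))"
| "theta U m \<zeta> = cint (\<lambda>z. if \<zeta> = 0 then lamb m z else (exp (lamb m z * \<zeta>) - 1) / \<zeta>)"

definition theta_coeff :: "idx \<Rightarrow> nat \<Rightarrow> point \<Rightarrow> complex" where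
  "theta_coeff a p m = fps_nth (fps_expansion (theta a m) 0) p"

definition Ham :: "idx \<Rightarrow> nat \<Rightarrow> (real \<Rightarrow> point) \<Rightarrow> complex" where
  "Ham a p \<gamma> = integral {0..2 * pi} (\<lambda>x. theta_coeff a (p + 1) (\<gamma> x))"

text \<open>The straight line through \<open>\<gamma>\<close> in direction \<open>X\<close>, within \<^const>\<open>LM0\<close>, with the branches
  continued continuously.\<close>

definition variation ::
  "(real \<Rightarrow> point) \<Rightarrow> tangent_loop \<Rightarrow> real \<Rightarrow> (real \<Rightarrow> real \<Rightarrow> point) \<Rightarrow> bool" where
  "variation \<gamma> X \<delta> \<Gamma> \<longleftrightarrow> 0 < \<delta> \<and> \<Gamma> 0 = \<gamma> \<and>
     (\<forall>\<epsilon>\<in>{-\<delta><..<\<delta>}. \<Gamma> \<epsilon> \<in> LM0 \<and> (\<forall>x.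
        (\<forall>z\<in>Dinf. lam (\<Gamma> \<epsilon> x) z = lam (\<gamma> x) z + of_real \<epsilon> * fst X x z) \<and>
        (\<forall>z\<in>D0p. lamb (\<Gamma> \<epsilon> x) z = lamb (\<gamma> x) z + of_real \<epsilon> * snd X x z))) \<and>
     (\<forall>x. continuous_on {-\<delta><..<\<delta>} (\<lambda>\<epsilon>. ucoord (\<Gamma> \<epsilon> x)) \<and>
        (\<forall>z\<in>circle. continuous_on {-\<delta><..<\<delta>} (\<lambda>\<epsilon>. logwz (\<Gamma> \<epsilon> x) z)))"

definition is_differential ::
  "((real \<Rightarrow> point) \<Rightarrow> complex) \<Rightarrow> (real \<Rightarrow> point) \<Rightarrow> (real \<Rightarrow> triple) \<Rightarrow> bool" where
  "is_differential F \<gamma> \<omega> \<longleftrightarrow> smooth_form \<omega> \<and>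
     (\<forall>X\<in>LTM0. \<forall>\<delta> \<Gamma>. variation \<gamma> X \<delta> \<Gamma> \<longrightarrow>
        ((\<lambda>\<epsilon>. F (\<Gamma> \<epsilon>)) has_vector_derivative
           integral {0..2 * pi} (\<lambda>x. pairing (\<omega> x) (coords \<gamma> X x))) (at 0))"

text \<open>The first component is \<open>z w\<^sub>z \<omega>\<^sub>x - z \<omega>\<^sub>z w\<^sub>x\<close>.\<close>

definition poisson_op :: "(real \<Rightarrow> point) \<Rightarrow> (real \<Rightarrow> triple) \<Rightarrow> real \<Rightarrow> triple" where
  "poisson_op \<gamma> \<omega> x = (bracket (\<lambda>y. wfun (\<gamma> y)) (\<lambda>y. fst (\<omega> y)) x,
     vector_derivative (\<lambda>y. snd (snd (\<omega> y))) (at x),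
     vector_derivative (\<lambda>y. fst (snd (\<omega> y))) (at x))"

definition principal_flow :: "idx \<Rightarrow> nat \<Rightarrow> (real \<Rightarrow> point) \<Rightarrow> tangent_loop \<Rightarrow> bool" where
  "principal_flow a p \<gamma> X \<longleftrightarrow>
     (\<exists>\<omega>. is_differential (Ham a p) \<gamma> \<omega> \<and> (\<forall>x. triple_eq (coords \<gamma> X x) (poisson_op \<gamma> \<omega> x)))"

text \<open>Only the data with index \<^const>\<open>V\<close> depend on \<open>u\<close> itself rather than on \<open>exp u\<close>. They are
  single-valued along a loop, so that the Hamiltonian and both flows are defined, only if \<open>u\<close>
  closes up.\<close>

definition flow_defined :: "idx \<Rightarrow> (real \<Rightarrow> point) \<Rightarrow> bool" where
  "flow_defined a \<gamma> \<longleftrightarrow> (a = V \<longrightarrow> (\<forall>x. ucoord (\<gamma> (x + 2 * pi)) = ucoord (\<gamma> x)))"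

end

theory Submission
  imports Defs
begin

text \<open>Write each Hamiltonian density as the circle mean of a potential \<open>T\<close> in \<open>\<lambda>\<close>, \<open>\<lambda>bar\<close> and the
  logarithms, and put \<open>A = \<partial>T/\<partial>\<lambda>\<close>, \<open>B = \<partial>T/\<partial>\<lambda>bar\<close>. In all four cases \<open>B - A = Q\<close>, and splitting a
  variation of \<open>w\<close> into its parts in \<open>\<lambda>\<close> and \<open>\<lambda>bar\<close> gives the differential
  \<open>\<omega> = (A + Q\<^sub>-, Q\<^sub>0, e\<^sup>u Q\<^sub>1)\<close>, where also \<open>A + Q\<^sub>- = B - Q\<^sub>+\<close>. Equality of the mixed partial
  derivatives of \<open>T\<close> means \<open>{\<lambda>, A} + {\<lambda>bar, B} = 0\<close>, so that
  \<open>{w, A + Q\<^sub>-} = {\<lambda>, Q\<^sub>-} - {\<lambda>bar, Q\<^sub>+}\<close>, which is the Toda flow of \<open>w\<close>. The differential is unique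
  because the conditions defining the manifold are open: every tangent vector field along the loop
  is realised by a variation, and monomials in \<open>z\<close> with conjugated coefficients of the difference
  of two differentials as factors show that this difference vanishes.\<close>

section \<open>Smooth families of holomorphic functions\<close>

text \<open>The given data are germs: values matter only near the circle or on one of the two
  domains, and the conditions at infinity and at the origin are stated for each x separately.
  Everything is therefore moved to discs of one radius R > 1 by \<open>lam = z h(1/z)\<close> and
  \<open>lamb = k(z)/z\<close>. Both conditions then become holomorphy at 0, and powers of z are
  compared through Taylor coefficients. Smoothness in x has to survive Laurent parts, z-derivatives
  and removal of singularities; all of these are circle means against a kernel holomorphic in z, so
  one lemma on such means covers them. The main obstacle is the logarithms. They are chosen point by
  point on the manifold, whereas differentiating a Hamiltonian under two integrals needs joint
  continuity in the deformation parameter, x and z. Since a continuous logarithm on a connected set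
  is fixed by one value, joint branches are built over contractible parameter spaces and then
  identified with the chosen ones. The operator
  \<open>\<partial>/\<partial>lamb - \<partial>/\<partial>lam\<close> lowers the degree by one; this
  matches the index shift between a Hamiltonian and its density and makes the double factorials and
  harmonic numbers fit.\<close>

definition sm :: "complex set \<Rightarrow> (real \<Rightarrow> complex \<Rightarrow> complex) \<Rightarrow> bool" where
  "sm D f \<longleftrightarrow> (\<exists>F::nat \<Rightarrow> real \<Rightarrow> complex \<Rightarrow> complex.
     (\<forall>x. \<forall>z\<in>D. F 0 x z = f x z) \<and>
     (\<forall>n x. F n x holomorphic_on D) \<and>
     (\<forall>n. continuous_on (UNIV \<times> D) (\<lambda>(x, z). F n x z)) \<and>
     (\<forall>n x. \<forall>z\<in>D. ((\<lambda>y. F n y z) has_vector_derivative F (Suc n) x z) (at x)))"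

lemma smooth_germ_iff_sm: "smooth_germ K f \<longleftrightarrow> (\<exists>D. open D \<and> K \<subseteq> D \<and> sm D f)"
  unfolding smooth_germ_def sm_def by blast

text \<open>A class of families closed under one x-derivative consists of smooth families, because
  iterating a choice of derivative produces the whole sequence F that \<open>sm\<close> asks for.
  Most closure lemmas below differ only in the class P that they supply.\<close>

lemma sm_coinduct:
  assumes "P f"
    and step: "\<And>g. P g \<Longrightarrow> (\<forall>x. g x holomorphic_on D) \<and> continuous_on (UNIV \<times> D) (\<lambda>(x, z). g x z) \<and>
       (\<exists>g'. P g' \<and> (\<forall>x. \<forall>z\<in>D. ((\<lambda>y. g y z) has_vector_derivative g' x z) (at x)))"
  shows "sm D f"
proof -
  define nx where "nx g = (SOME g'. P g' \<and> (\<forall>x. \<forall>z\<in>D. ((\<lambda>y. g y z) has_vector_derivative g' x z) (at x)))" for g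
  have nx: "P (nx g) \<and> (\<forall>x. \<forall>z\<in>D. ((\<lambda>y. g y z) has_vector_derivative nx g x z) (at x))" if "P g" for g
  proof -
    have "\<exists>g'. P g' \<and> (\<forall>x. \<forall>z\<in>D. ((\<lambda>y. g y z) has_vector_derivative g' x z) (at x))"
      using step[OF that] by blast
    then show ?thesis unfolding nx_def by (rule someI_ex)
  qed
  define F where "F n = (nx ^^ n) f" for n
  have P: "P (F n)" for n
    by (induction n) (auto simp: F_def assms(1) nx)
  show ?thesis unfolding sm_def
  proof (intro exI[of _ F] conjI allI ballI)
    show "((\<lambda>y. F n y z) has_vector_derivative F (Suc n) x z) (at x)" if "z \<in> D" for n x z
      using nx[OF P[of n]] that by (auto simp: F_def)
  qed (use step[OF P] in \<open>auto simp: F_def\<close>)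
qed

lemma sm_holo:
  assumes "sm D f" shows "f x holomorphic_on D"
proof -
  from assms obtain F where F: "\<forall>x. \<forall>z\<in>D. (F::nat \<Rightarrow> real \<Rightarrow> complex \<Rightarrow> complex) 0 x z = f x z"
     "\<forall>n x. F n x holomorphic_on D"
    unfolding sm_def by blast
  have "F 0 x holomorphic_on D" using F by blast
  then show ?thesis by (rule holomorphic_transform) (use F in auto)
qed

lemma sm_cont:
  assumes "sm D f" shows "continuous_on (UNIV \<times> D) (\<lambda>(x, z). f x z)"
proof -
  from assms obtain F where F: "\<forall>x. \<forall>z\<in>D. (F::nat \<Rightarrow> real \<Rightarrow> complex \<Rightarrow> complex) 0 x z = f x z"
     "\<forall>n. continuous_on (UNIV \<times> D) (\<lambda>(x, z). F n x z)"
    unfolding sm_def by blast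
  then have "continuous_on (UNIV \<times> D) (\<lambda>(x, z). F 0 x z)" by blast
  then show ?thesis by (rule continuous_on_eq) (use F in auto)
qed

lemma sm_cont2:
  assumes "sm D f" "continuous_on S p" "continuous_on S q" "\<And>s. s \<in> S \<Longrightarrow> q s \<in> D"
  shows "continuous_on S (\<lambda>s. f (p s) (q s))"
proof -
  have "continuous_on S (\<lambda>s. (\<lambda>(x,z). f x z) (p s, q s))"
    by (rule continuous_on_compose2[OF sm_cont[OF assms(1)]]) (use assms in \<open>auto intro!: continuous_intros\<close>)
  then show ?thesis by simp
qed

lemma sm_contx:
  assumes "sm D f" "z \<in> D" shows "continuous_on S (\<lambda>x. f x z)"
  by (rule sm_cont2[OF assms(1)]) (use assms in auto)

definition dx :: "(real \<Rightarrow> complex \<Rightarrow> complex) \<Rightarrow> real \<Rightarrow> complex \<Rightarrow> complex" where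
  "dx f x z = vector_derivative (\<lambda>y. f y z) (at x)"

lemma sm_cong_on:
  assumes "sm D f" "\<And>x z. z \<in> D \<Longrightarrow> f x z = g x z"
  shows "sm D g"
proof -
  have "\<And>x z. z \<in> D \<Longrightarrow> g x z = f x z" using assms(2) by simp
  with assms(1) show ?thesis unfolding sm_def by auto
qed

lemma sm_dx:
  assumes "sm D f"
  shows "sm D (dx f)" and "z \<in> D \<Longrightarrow> ((\<lambda>y. f y z) has_vector_derivative dx f x z) (at x)"
proof -
  from assms obtain F where F: "\<forall>x. \<forall>z\<in>D. (F::nat \<Rightarrow> real \<Rightarrow> complex \<Rightarrow> complex) 0 x z = f x z"
     "\<forall>n x. F n x holomorphic_on D"
     "\<forall>n. continuous_on (UNIV \<times> D) (\<lambda>(x, z). F n x z)"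
     "\<forall>n x. \<forall>z\<in>D. ((\<lambda>y. F n y z) has_vector_derivative F (Suc n) x z) (at x)"
    unfolding sm_def by metis
  have d: "((\<lambda>y. f y z) has_vector_derivative F 1 x z) (at x)" if "z \<in> D" for x z
  proof -
    have "((\<lambda>y. F 0 y z) has_vector_derivative F 1 x z) (at x)" using F(4) that by auto
    then show ?thesis
      by (rule has_vector_derivative_transform_within_open[where S = UNIV]) (use F that in auto)
  qed
  have e: "dx f x z = F 1 x z" if "z \<in> D" for x z
    unfolding dx_def using d[OF that] by (rule vector_derivative_at)
  have "sm D (F 1)" unfolding sm_def
    by (rule exI[of _ "\<lambda>n. F (Suc n)"]) (use F in auto)
  then show "sm D (dx f)" by (rule sm_cong_on) (use e in auto)
  show "((\<lambda>y. f y z) has_vector_derivative dx f x z) (at x)" if "z \<in> D"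
    using d e that by metis
qed

lemma dx_eqI: "((\<lambda>y. f y z) has_vector_derivative c) (at x) \<Longrightarrow> dx f x z = c"
  unfolding dx_def by (rule vector_derivative_at)

lemma sm_subset:
  assumes "sm D f" "E \<subseteq> D" shows "sm E f"
proof (rule sm_coinduct[where P = "sm D"])
  fix g assume "sm D g"
  moreover from this have "continuous_on (UNIV \<times> E) (\<lambda>(x, z). g x z)"
    by (intro continuous_on_subset[OF sm_cont]) (use assms(2) in auto)
  moreover have "\<forall>x. g x holomorphic_on E"
    using sm_holo[OF \<open>sm D g\<close>] holomorphic_on_subset assms(2) by blast
  ultimately show "(\<forall>x. g x holomorphic_on E) \<and> continuous_on (UNIV \<times> E) (\<lambda>(x, z). g x z) \<and>
    (\<exists>g'. sm D g' \<and> (\<forall>x. \<forall>z\<in>E. ((\<lambda>y. g y z) has_vector_derivative g' x z) (at x)))"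
    using sm_dx[of D g] assms(2) by blast
qed fact

text \<open>For families whose x-derivative is already known to be smooth, such as logarithms: only
  order zero is checked by hand.\<close>

lemma sm_coinduct1:
  assumes "\<And>x. g x holomorphic_on D" "continuous_on (UNIV \<times> D) (\<lambda>(x, z). g x z)"
    "\<And>x z. z \<in> D \<Longrightarrow> ((\<lambda>y. g y z) has_vector_derivative g' x z) (at x)" "sm D g'"
  shows "sm D g"
proof (rule sm_coinduct[where P = "\<lambda>f. f = g \<or> sm D f"])
  fix f assume "f = g \<or> sm D f"
  then show "(\<forall>x. f x holomorphic_on D) \<and> continuous_on (UNIV \<times> D) (\<lambda>(x, z). f x z) \<and>
    (\<exists>g'. (g' = g \<or> sm D g') \<and> (\<forall>x. \<forall>z\<in>D. ((\<lambda>y. f y z) has_vector_derivative g' x z) (at x)))"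
  proof
    assume "sm D f"
    then show ?thesis using sm_holo[of D f] sm_cont[of D f] sm_dx[of D f] by blast
  next
    assume "f = g"
    then show ?thesis using assms by blast
  qed
qed simp

text \<open>The witness sequences on different neighbourhoods need no gluing, since all of them
  consist of the iterated derivatives \<open>dx\<close>, which are defined globally. This admits
  Cauchy formulas on small discs, as in \<open>sm_deriv\<close>.\<close>

lemma sm_local:
  assumes "open D" "\<And>z. z \<in> D \<Longrightarrow> \<exists>E. open E \<and> z \<in> E \<and> sm E f"
  shows "sm D f"
proof (rule sm_coinduct[where P = "\<lambda>f. \<forall>z\<in>D. \<exists>E. open E \<and> z \<in> E \<and> sm E f"])
  fix g assume g: "\<forall>z\<in>D. \<exists>E. open E \<and> z \<in> E \<and> sm E g"
  have "g x holomorphic_on D" for x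
    unfolding holomorphic_on_def
  proof
    fix z assume "z \<in> D"
    with g obtain E where "open E" "z \<in> E" "sm E g" by blast
    then have "g x field_differentiable at z"
      using sm_holo holomorphic_on_imp_differentiable_at by metis
    then show "g x field_differentiable at z within D"
      by (rule field_differentiable_at_within)
  qed
  moreover have "continuous_on (UNIV \<times> D) (\<lambda>(x, z). g x z)"
    unfolding continuous_on_eq_continuous_within
  proof
    fix s :: "real \<times> complex" assume "s \<in> UNIV \<times> D"
    then obtain x z where s: "s = (x,z)" "z \<in> D" by auto
    with g obtain E where E: "open E" "z \<in> E" "sm E g" by blast
    then have "continuous_on (UNIV \<times> E) (\<lambda>(x, z). g x z)" using sm_cont by blast
    then have "isCont (\<lambda>(x, z). g x z) s"
      using E s continuous_on_eq_continuous_at[OF open_Times[OF open_UNIV E(1)]] by auto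
    then show "continuous (at s within UNIV \<times> D) (\<lambda>(x, z). g x z)"
      using continuous_at_imp_continuous_at_within by blast
  qed
  moreover have "\<forall>z\<in>D. \<exists>E. open E \<and> z \<in> E \<and> sm E (dx g)" using g sm_dx(1) by blast
  moreover have "\<forall>x. \<forall>z\<in>D. ((\<lambda>y. g y z) has_vector_derivative dx g x z) (at x)"
    using g sm_dx(2) by blast
  ultimately show "(\<forall>x. g x holomorphic_on D) \<and> continuous_on (UNIV \<times> D) (\<lambda>(x, z). g x z) \<and>
    (\<exists>g'. (\<forall>z\<in>D. \<exists>E. open E \<and> z \<in> E \<and> sm E g') \<and> (\<forall>x. \<forall>z\<in>D. ((\<lambda>y. g y z) has_vector_derivative g' x z) (at x)))"
    by blast
qed (use assms in blast)

text \<open>The algebra generated by smooth families is closed under \<open>\<partial>\<^sub>x\<close>, so all its elements are smooth.\<close>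

inductive alg :: "complex set \<Rightarrow> (real \<Rightarrow> complex \<Rightarrow> complex) \<Rightarrow> bool" for D where
  base: "sm D f \<Longrightarrow> alg D f"
| add: "alg D f \<Longrightarrow> alg D g \<Longrightarrow> alg D (\<lambda>x z. f x z + g x z)"
| mult: "alg D f \<Longrightarrow> alg D g \<Longrightarrow> alg D (\<lambda>x z. f x z * g x z)"
| inv: "alg D f \<Longrightarrow> (\<And>x z. z \<in> D \<Longrightarrow> f x z \<noteq> 0) \<Longrightarrow> alg D (\<lambda>x z. inverse (f x z))"
| hol: "g holomorphic_on D \<Longrightarrow> alg D (\<lambda>x z. g z)"

lemma alg_props:
  assumes "alg D g"
  shows "(\<forall>x. g x holomorphic_on D) \<and> continuous_on (UNIV \<times> D) (\<lambda>(x, z). g x z) \<and>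
       (\<exists>g'. alg D g' \<and> (\<forall>x. \<forall>z\<in>D. ((\<lambda>y. g y z) has_vector_derivative g' x z) (at x)))"
  using assms
proof induction
  case (base f)
  then show ?case using sm_holo[of D f] sm_cont[of D f] sm_dx[of D f] alg.base[of D "dx f"] by blast
next
  case (add f g)
  then obtain f' g' where "alg D f'" "\<forall>x. \<forall>z\<in>D. ((\<lambda>y. f y z) has_vector_derivative f' x z) (at x)"
     "alg D g'" "\<forall>x. \<forall>z\<in>D. ((\<lambda>y. g y z) has_vector_derivative g' x z) (at x)" by blast
  with add show ?case
    by (auto simp: case_prod_unfold intro!: holomorphic_intros continuous_intros has_vector_derivative_add
       exI[of _ "\<lambda>x z. f' x z + g' x z"] alg.add)
next
  case (mult f g)
  then obtain f' g' where "alg D f'" "\<forall>x. \<forall>z\<in>D. ((\<lambda>y. f y z) has_vector_derivative f' x z) (at x)"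
     "alg D g'" "\<forall>x. \<forall>z\<in>D. ((\<lambda>y. g y z) has_vector_derivative g' x z) (at x)" by blast
  with mult show ?case
    by (auto simp: case_prod_unfold intro!: holomorphic_intros continuous_intros has_vector_derivative_mult
       exI[of _ "\<lambda>x z. f x z * g' x z + f' x z * g x z"] alg.add alg.mult)
next
  case (inv f)
  then obtain f' where f': "alg D f'" "\<forall>x. \<forall>z\<in>D. ((\<lambda>y. f y z) has_vector_derivative f' x z) (at x)" by blast
  let ?g = "\<lambda>x z. (-1) * (f' x z * (inverse (f x z) * inverse (f x z)))"
  have "alg D ?g" by (intro alg.mult alg.hol alg.inv inv f') auto
  moreover have "((\<lambda>y. inverse (f y z)) has_vector_derivative ?g x z) (at x)" if "z \<in> D" for x z
  proof -
    have "((\<lambda>y. f y z) has_vector_derivative f' x z) (at x)" using f' that by blast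
    moreover have "(inverse has_field_derivative - (inverse (f x z) ^ Suc (Suc 0))) (at (f x z))"
      by (rule DERIV_inverse) (use inv that in blast)
    ultimately have "(inverse \<circ> (\<lambda>y. f y z) has_vector_derivative f' x z * - (inverse (f x z) ^ Suc (Suc 0))) (at x)"
      by (rule field_vector_diff_chain_at)
    then show ?thesis by (simp add: o_def)
  qed
  ultimately show ?case using inv
    by (auto simp: case_prod_unfold intro!: holomorphic_intros continuous_intros exI[of _ "?g"])
next
  case (hol g)
  show ?case
    by (auto simp: hol case_prod_unfold has_vector_derivative_const intro!: exI[of _ "\<lambda>x z. 0"] alg.hol
       continuous_on_compose2[OF holomorphic_on_imp_continuous_on[OF hol]] continuous_intros)
qed

lemma alg_sm: "alg D f \<Longrightarrow> sm D f"
  by (rule sm_coinduct[where P = "alg D"]) (assumption, rule alg_props)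

lemma sm_add: "sm D f \<Longrightarrow> sm D g \<Longrightarrow> sm D (\<lambda>x z. f x z + g x z)"
  and sm_mult: "sm D f \<Longrightarrow> sm D g \<Longrightarrow> sm D (\<lambda>x z. f x z * g x z)"
  and sm_inverse: "sm D f \<Longrightarrow> (\<And>x z. z \<in> D \<Longrightarrow> f x z \<noteq> 0) \<Longrightarrow> sm D (\<lambda>x z. inverse (f x z))"
  and sm_hol: "k holomorphic_on D \<Longrightarrow> sm D (\<lambda>x z. k z)"
  by (blast intro: alg_sm alg.base alg.add, blast intro: alg_sm alg.base alg.mult,
      blast intro: alg_sm alg.base alg.inv, blast intro: alg_sm alg.hol)

lemma sm_const: "sm D (\<lambda>x z. c)"
  by (rule sm_hol) auto

lemma sm_divide: "sm D f \<Longrightarrow> sm D g \<Longrightarrow> (\<And>x z. z \<in> D \<Longrightarrow> g x z \<noteq> 0) \<Longrightarrow> sm D (\<lambda>x z. f x z / g x z)"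
  unfolding divide_inverse by (intro sm_mult sm_inverse)

lemma sm_uminus: "sm D f \<Longrightarrow> sm D (\<lambda>x z. - f x z)"
  using sm_mult[OF sm_const[of D "-1"]] by simp

lemma sm_diff: "sm D f \<Longrightarrow> sm D g \<Longrightarrow> sm D (\<lambda>x z. f x z - g x z)"
  using sm_add[OF _ sm_uminus] by simp

lemma sm_compose:
  assumes "sm E f" "g holomorphic_on D" "g ` D \<subseteq> E"
  shows "sm D (\<lambda>x z. f x (g z))"
proof (rule sm_coinduct[where P = "\<lambda>F. \<exists>f. sm E f \<and> F = (\<lambda>x z. f x (g z))"])
  fix F assume "\<exists>f. sm E f \<and> F = (\<lambda>x z. f x (g z))"
  then obtain f where f: "sm E f" "F = (\<lambda>x z. f x (g z))" by blast
  have "F x holomorphic_on D" for x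
    using holomorphic_on_compose_gen[OF assms(2) sm_holo[OF f(1)] assms(3)] by (simp add: f o_def)
  moreover have "continuous_on (UNIV \<times> D) (\<lambda>(x, z). F x z)"
    unfolding f case_prod_unfold
    by (rule sm_cont2[OF f(1)])
      (use assms in \<open>auto intro!: continuous_intros continuous_on_compose2[OF holomorphic_on_imp_continuous_on[OF assms(2)]]\<close>)
  moreover have "\<forall>x. \<forall>z\<in>D. ((\<lambda>y. F y z) has_vector_derivative (\<lambda>x z. dx f x (g z)) x z) (at x)"
    using sm_dx(2)[OF f(1)] assms(3) by (auto simp: f)
  ultimately show "(\<forall>x. F x holomorphic_on D) \<and> continuous_on (UNIV \<times> D) (\<lambda>(x, z). F x z) \<and>
    (\<exists>g'. (\<exists>f. sm E f \<and> g' = (\<lambda>x z. f x (g z))) \<and> (\<forall>x. \<forall>z\<in>D. ((\<lambda>y. F y z) has_vector_derivative g' x z) (at x)))"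
    using sm_dx(1)[OF f(1)] by blast
qed (use assms in blast)

section \<open>Continuous branches of the logarithm\<close>

lemma continuous_log_local:
  fixes g :: "'a::t2_space \<Rightarrow> complex"
  assumes "open S" "x \<in> S" "continuous_on S g" "\<And>y. y \<in> S \<Longrightarrow> exp (g y) = f y"
  obtains W where "open W" "x \<in> W" "W \<subseteq> S" "\<And>y. y \<in> W \<Longrightarrow> Ln (f y / f x) + g x = g y"
proof -
  have cg: "isCont g x" using assms continuous_on_eq_continuous_at by blast
  then have "\<forall>\<^sub>F y in nhds x. g y \<in> ball (g x) pi"
    unfolding isCont_def tendsto_at_iff_tendsto_nhds
    by (rule topological_tendstoD) auto
  moreover have "\<forall>\<^sub>F y in nhds x. y \<in> S" using assms eventually_nhds by blast
  ultimately have "\<forall>\<^sub>F y in nhds x. g y \<in> ball (g x) pi \<and> y \<in> S" by (rule eventually_conj)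
  then obtain W where W: "open W" "x \<in> W" "\<And>y. y \<in> W \<Longrightarrow> g y \<in> ball (g x) pi \<and> y \<in> S"
    unfolding eventually_nhds by blast
  \<comment> \<open>Within distance pi of \<open>g x\<close>, the difference
    \<open>g y - g x\<close> lies in the strip on which the principal \<open>Ln\<close> inverts
    \<open>exp\<close>; so every continuous branch is locally a shifted \<open>Ln\<close>, and
    differentiability follows.\<close>
  have eq: "Ln (f y / f x) + g x = g y" if "y \<in> W" for y
  proof -
    have "\<bar>Im (g y - g x)\<bar> < pi"
      using W(3)[OF that] abs_Im_le_cmod[of "g y - g x"] by (simp add: dist_norm norm_minus_commute)
    then have "Ln (exp (g y - g x)) = g y - g x" by (intro Ln_exp) auto
    then show ?thesis using W(3)[OF that] assms(2,4) by (simp add: exp_diff)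
  qed
  show thesis by (rule that[OF W(1,2)]) (use W(3) eq in auto)
qed

lemma has_vector_derivative_continuous_log:
  fixes f g :: "real \<Rightarrow> complex"
  assumes "(f has_vector_derivative f') (at x)" "open S" "x \<in> S" "continuous_on S g" "\<And>y. y \<in> S \<Longrightarrow> exp (g y) = f y"
  shows "(g has_vector_derivative f' / f x) (at x)"
proof -
  obtain W where W: "open W" "x \<in> W" "W \<subseteq> S" "\<And>y. y \<in> W \<Longrightarrow> Ln (f y / f x) + g x = g y"
    using continuous_log_local[OF assms(2-5)] by metis
  have nz: "f x \<noteq> 0" using assms(3,5) by (metis exp_not_eq_zero)
  have "((\<lambda>y. f y / f x) has_vector_derivative f' / f x) (at x)"
    by (rule has_vector_derivative_divide) (use assms in auto)
  moreover have "(Ln has_field_derivative inverse (f x / f x)) (at (f x / f x))"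
    by (rule has_field_derivative_Ln) (use nz assms in auto)
  ultimately have "(Ln \<circ> (\<lambda>y. f y / f x) has_vector_derivative f' / f x * inverse (f x / f x)) (at x)"
    by (rule field_vector_diff_chain_at)
  then have "((\<lambda>y. Ln (f y / f x) + g x) has_vector_derivative f' / f x) (at x)"
    using nz assms by (auto simp: o_def has_vector_derivative_add_const)
  then show ?thesis by (rule has_vector_derivative_transform_within_open[OF _ W(1,2)]) (use W(4) in auto)
qed

lemma has_field_derivative_continuous_log:
  fixes f g :: "complex \<Rightarrow> complex"
  assumes "(f has_field_derivative f') (at x)" "open S" "x \<in> S" "continuous_on S g" "\<And>y. y \<in> S \<Longrightarrow> exp (g y) = f y"
  shows "(g has_field_derivative f' / f x) (at x)"
proof -
  obtain W where W: "open W" "x \<in> W" "W \<subseteq> S" "\<And>y. y \<in> W \<Longrightarrow> Ln (f y / f x) + g x = g y"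
    using continuous_log_local[OF assms(2-5)] by metis
  have nz: "f x \<noteq> 0" using assms(3,5) by (metis exp_not_eq_zero)
  have "((\<lambda>y. Ln (f y / f x) + g x) has_field_derivative f' / f x) (at x)"
    by (rule derivative_eq_intros assms(1) refl | use nz in force)+
  then show ?thesis by (rule has_field_derivative_transform_within_open[OF _ W(1,2)]) (use W(4) in auto)
qed

lemma holomorphic_on_continuous_log:
  assumes "open S" "f holomorphic_on S" "continuous_on S g" "\<And>z. z \<in> S \<Longrightarrow> exp (g z) = f z"
  shows "g holomorphic_on S"
  unfolding holomorphic_on_open[OF assms(1)]
  using has_field_derivative_continuous_log[OF _ assms(1) _ assms(3,4)] holomorphic_derivI[OF assms(2,1)]
  by blast

text \<open>Continuity is all that has to be known of the branch: its x-derivative is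
  \<open>dx f / f\<close>, a quotient of smooth families.\<close>

lemma sm_log:
  assumes "open D" "sm D f" "continuous_on (UNIV \<times> D) (\<lambda>(x, z). g x z)" "\<And>x z. z \<in> D \<Longrightarrow> exp (g x z) = f x z"
  shows "sm D g"
proof (rule sm_coinduct1)
  show "sm D (\<lambda>x z. dx f x z / f x z)"
    by (intro sm_divide sm_dx assms) (metis assms(4) exp_not_eq_zero)
  show "continuous_on (UNIV \<times> D) (\<lambda>(x, z). g x z)" by fact
  have "continuous_on D (g x)" for x
  proof -
    have "continuous_on D (\<lambda>z. (\<lambda>(x,z). g x z) (x, z))"
      by (rule continuous_on_compose2[OF assms(3)]) (auto intro!: continuous_intros)
    then show ?thesis by simp
  qed
  then show "g x holomorphic_on D" for x
    using assms holomorphic_on_continuous_log sm_holo by metis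
  show "((\<lambda>y. g y z) has_vector_derivative dx f x z / f x z) (at x)" if "z \<in> D" for x z
  proof (rule has_vector_derivative_continuous_log[where S = UNIV])
    have "continuous_on UNIV (\<lambda>x. (\<lambda>(x,z). g x z) (x, z))"
      by (rule continuous_on_compose2[OF assms(3)]) (use that in \<open>auto intro!: continuous_intros\<close>)
    then show "continuous_on UNIV (\<lambda>y. g y z)" by simp
  qed (use assms sm_dx that in auto)
qed

section \<open>Circle means depending on parameters\<close>

lemma circlepath_in_circle: "circlepath 0 1 t \<in> circle"
  using norm_exp_i_times[of "2 * pi * t"] by (simp add: circlepath mult_ac)

lemma contour_integral_circlepath_cint:
  assumes "r > 0"
  shows "contour_integral (circlepath 0 r) g = 2 * of_real pi * \<i> * integral {0..1} (\<lambda>t. g (of_real r * circlepath 0 1 t) * (of_real r * circlepath 0 1 t))"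
proof -
  have "contour_integral (circlepath 0 r) g
     = integral {0..1} (\<lambda>t. (2 * of_real pi * \<i>) * (g (of_real r * circlepath 0 1 t) * (of_real r * circlepath 0 1 t)))"
    unfolding contour_integral_integral vector_derivative_circlepath
    by (simp add: circlepath mult_ac)
  then show ?thesis by simp
qed

text \<open>On the unit circle \<open>dz / z\<close> is \<open>2 pi i dt\<close>, so
  \<open>cint\<close> is the plain average over the parameter. Limits and derivatives are exchanged
  with the integral in this form.\<close>

lemma cint_integral: "cint f = integral {0..1} (\<lambda>t. f (circlepath 0 1 t))"
proof -
  have nz: "circlepath 0 1 t \<noteq> 0" for t by (simp add: circlepath)
  show ?thesis unfolding cint_def by (simp add: contour_integral_circlepath_cint nz del: circlepath_def)
qed

lemma contour_integral_circlepath_eq_cint: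
  "r > 0 \<Longrightarrow> contour_integral (circlepath 0 r) g = 2 * of_real pi * \<i> * cint (\<lambda>z. g (of_real r * z) * (of_real r * z))"
  by (simp add: contour_integral_circlepath_cint cint_integral)

lemma cint_cong: "(\<And>z. z \<in> circle \<Longrightarrow> f z = g z) \<Longrightarrow> cint f = cint g"
  unfolding cint_integral using circlepath_in_circle by metis

lemma continuous_on_circlepath: "continuous_on S (circlepath 0 1)"
  unfolding circlepath by (intro continuous_intros)

lemma continuous_on_circle_path:
  "continuous_on circle f \<Longrightarrow> continuous_on S (\<lambda>t. f (circlepath 0 1 t))"
  by (rule continuous_on_compose2[OF _ continuous_on_circlepath]) (use circlepath_in_circle in auto)

lemma cint_integrable:
  fixes f :: "complex \<Rightarrow> complex"
  shows "continuous_on circle f \<Longrightarrow> (\<lambda>t. f (circlepath 0 1 t)) integrable_on {0..1}"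
  by (intro integrable_continuous_real continuous_on_circle_path)

lemma cint_add:
  assumes "continuous_on circle f" "continuous_on circle g"
  shows "cint (\<lambda>z. f z + g z) = cint f + cint g"
  unfolding cint_integral using assms cint_integrable by (intro integral_add) auto

lemma cint_diff:
  assumes "continuous_on circle f" "continuous_on circle g"
  shows "cint (\<lambda>z. f z - g z) = cint f - cint g"
  unfolding cint_integral using assms cint_integrable by (intro integral_diff) auto

lemma cint_mult_left: "cint (\<lambda>z. c * f z) = c * cint f"
  and cint_mult_right: "cint (\<lambda>z. f z * c) = cint f * c"
  and cint_uminus: "cint (\<lambda>z. - f z) = - cint f"
  and cint_zero: "cint (\<lambda>z. 0) = 0"
  by (simp_all add: cint_integral)

text \<open>Inversion maps the circle to itself by \<open>t \<mapsto> 1 - t\<close>, which preserves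
  the mean. Statements about negative powers thereby reduce to Taylor expansions at 0.\<close>

lemma cint_inverse_arg:
  assumes "continuous_on circle f"
  shows "cint (\<lambda>z. f (1 / z)) = cint f"
proof -
  let ?g = "\<lambda>t. f (circlepath 0 1 t)"
  have "(?g has_integral cint f) (cbox 0 1)"
    unfolding cint_integral using cint_integrable[OF assms] by (simp add: integrable_integral)
  from has_integral_affinity[OF this, of "-1" 1]
  have "((\<lambda>t. ?g (1 - t)) has_integral cint f) ((\<lambda>x. 1 - x) ` {0..1})" by (simp add: algebra_simps)
  moreover have "(\<lambda>x::real. 1 - x) ` {0..1} = {0..1}" by (auto simp: image_def intro: bexI[of _ "1 - _"])
  moreover have "circlepath 0 1 (1 - t) = 1 / circlepath 0 1 t" for t
    by (simp add: circlepath exp_diff algebra_simps exp_eq_1[of "2 * of_real pi * \<i>"] divide_simps flip: exp_minus)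
  ultimately show ?thesis unfolding cint_integral by (simp add: integral_unique)
qed

lemma continuous_on_slice:
  assumes "continuous_on (S \<times> T) (\<lambda>(s, t). F s t)" "s \<in> S"
  shows "continuous_on T (F s)"
proof -
  have "continuous_on T (\<lambda>t. (\<lambda>(s,t). F s t) (s, t))"
    by (rule continuous_on_compose2[OF assms(1)]) (use assms(2) in \<open>auto intro!: continuous_intros\<close>)
  then show ?thesis by simp
qed

lemma continuous_on_circlepath_param:
  assumes "continuous_on (S \<times> circle) (\<lambda>(s, z). F s z)"
  shows "continuous_on (S \<times> cbox 0 1) (\<lambda>(s, t). F s (circlepath 0 1 t))"
proof -
  have "continuous_on (S \<times> cbox 0 1) (\<lambda>p. (\<lambda>(s,z). F s z) (fst p, circlepath 0 1 (snd p)))"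
    by (rule continuous_on_compose2[OF assms])
      (use circlepath_in_circle in \<open>auto intro!: continuous_intros continuous_on_compose2[OF continuous_on_circlepath[of UNIV]]\<close>)
  then show ?thesis by (simp add: case_prod_unfold)
qed

lemma cint_continuous_param:
  assumes "continuous_on (S \<times> circle) (\<lambda>(s, z). F s z)"
  shows "continuous_on S (\<lambda>s. cint (F s))"
  using integral_continuous_on_param[OF continuous_on_circlepath_param[OF assms]] by (simp add: cint_integral)

lemma cint_has_vector_derivative:
  assumes "\<And>x z. x \<in> T \<Longrightarrow> z \<in> circle \<Longrightarrow> ((\<lambda>x. F x z) has_vector_derivative F' x z) (at x)"
    and "\<And>x. x \<in> T \<Longrightarrow> continuous_on circle (F x)"
    and "continuous_on (T \<times> circle) (\<lambda>(x, z). F' x z)" "open T" "convex T" "x \<in> T"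
  shows "((\<lambda>x. cint (F x)) has_vector_derivative cint (F' x)) (at x)"
proof -
  have "((\<lambda>x. integral (cbox 0 1) (\<lambda>t. F x (circlepath 0 1 t))) has_vector_derivative
      integral (cbox 0 1) (\<lambda>t. F' x (circlepath 0 1 t))) (at x within T)"
  proof (rule leibniz_rule_vector_derivative)
    show "((\<lambda>x. F x (circlepath 0 1 t)) has_vector_derivative F' x (circlepath 0 1 t)) (at x within T)" if "x \<in> T" for x t
      using assms(1)[OF that circlepath_in_circle] by (rule has_vector_derivative_at_within)
    show "(\<lambda>t. F x (circlepath 0 1 t)) integrable_on cbox 0 1" if "x \<in> T" for x
      using cint_integrable[OF assms(2)[OF that]] by simp
  qed (rule continuous_on_circlepath_param[OF assms(3)], fact assms(6), fact assms(5))
  then show ?thesis unfolding at_within_open[OF assms(6,4)] cint_integral cbox_interval .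
qed

lemma cint_holomorphic:
  assumes "\<And>x z. x \<in> T \<Longrightarrow> z \<in> circle \<Longrightarrow> ((\<lambda>x. F x z) has_field_derivative F' x z) (at x)"
    and "\<And>x. x \<in> T \<Longrightarrow> continuous_on circle (F x)"
    and "continuous_on (T \<times> circle) (\<lambda>(x, z). F' x z)" "convex T"
  shows "(\<lambda>x. cint (F x)) holomorphic_on T"
proof -
  have "(\<lambda>x. integral (cbox 0 1) (\<lambda>t. F x (circlepath 0 1 t))) holomorphic_on T"
  proof (rule leibniz_rule_holomorphic)
    show "((\<lambda>x. F x (circlepath 0 1 t)) has_field_derivative F' x (circlepath 0 1 t)) (at x within T)" if "x \<in> T" for x t
      using assms(1)[OF that circlepath_in_circle] by (rule has_field_derivative_at_within)
    show "(\<lambda>t. F x (circlepath 0 1 t)) integrable_on cbox 0 1" if "x \<in> T" for x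
      using cint_integrable[OF assms(2)[OF that]] by simp
  qed (rule continuous_on_circlepath_param[OF assms(3)], fact assms(4))
  then show ?thesis unfolding cint_integral cbox_interval .
qed

lemma continuous_on_projections:
  "continuous_on S fst" "continuous_on S snd" "continuous_on T (\<lambda>s. fst (fst s))" "continuous_on T (\<lambda>s. snd (fst s))"
  by (auto intro!: continuous_intros)

text \<open>The variable x enters only through f and z only through the kernel. Differentiating in x
  replaces f by \<open>dx f\<close>, so the class of these means is closed under \<open>dx\<close>.
  Cauchy integrals for z-derivatives, Laurent parts, removable singularities and Laurent
  coefficients are all instances.\<close>

lemma sm_cint_kernel:
  assumes f: "sm E f" and s: "continuous_on circle \<sigma>" "\<And>\<eta>. \<eta> \<in> circle \<Longrightarrow> \<sigma> \<eta> \<in> E"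
    and k: "\<And>\<eta> z. \<eta> \<in> circle \<Longrightarrow> z \<in> B \<Longrightarrow> ((\<lambda>z. \<kappa> \<eta> z) has_field_derivative \<kappa>' \<eta> z) (at z)"
    and ck: "continuous_on (circle \<times> B) (\<lambda>(\<eta>, z). \<kappa> \<eta> z)" "continuous_on (circle \<times> B) (\<lambda>(\<eta>, z). \<kappa>' \<eta> z)"
    and B: "convex B"
  shows "sm B (\<lambda>x z. cint (\<lambda>\<eta>. f x (\<sigma> \<eta>) * \<kappa> \<eta> z))"
proof (rule sm_coinduct[where P = "\<lambda>F. \<exists>f. sm E f \<and> F = (\<lambda>x z. cint (\<lambda>\<eta>. f x (\<sigma> \<eta>) * \<kappa> \<eta> z))"])
  fix F assume "\<exists>f. sm E f \<and> F = (\<lambda>x z. cint (\<lambda>\<eta>. f x (\<sigma> \<eta>) * \<kappa> \<eta> z))"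
  then obtain f where f: "sm E f" "F = (\<lambda>x z. cint (\<lambda>\<eta>. f x (\<sigma> \<eta>) * \<kappa> \<eta> z))" by blast
  have cf: "continuous_on S (\<lambda>s. g (p s) (\<sigma> (q s)))"
    if "continuous_on S p" "continuous_on S q" "\<And>s. s \<in> S \<Longrightarrow> q s \<in> circle" "sm E g" for S :: "'x::t2_space set" and p q g
    by (rule sm_cont2[OF that(4,1)]) (use that s in \<open>auto intro!: continuous_on_compose2[OF s(1)]\<close>)
  have cf0: "continuous_on circle (\<lambda>\<eta>. g x (\<sigma> \<eta>))" if "sm E g" for g x
    by (rule sm_cont2[OF that]) (use s in \<open>auto intro!: continuous_intros\<close>)
  have cg: "continuous_on S (\<lambda>s. (\<lambda>(\<eta>, z). K \<eta> z) (p s, q s))" if "continuous_on S p" "continuous_on S q" "\<And>s. s \<in> S \<Longrightarrow> p s \<in> circle \<and> q s \<in> B"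
     "continuous_on (circle \<times> B) (\<lambda>(\<eta>, z). K \<eta> z)"
     for S :: "'x::t2_space set" and p q and K :: "complex \<Rightarrow> complex \<Rightarrow> complex"
    by (rule continuous_on_compose2[OF that(4)]) (use that in \<open>auto intro!: continuous_intros\<close>)
  have "F x holomorphic_on B" for x
    unfolding f(2)
  proof (rule cint_holomorphic[where F' = "\<lambda>z \<eta>. f x (\<sigma> \<eta>) * \<kappa>' \<eta> z"])
    show "((\<lambda>z. f x (\<sigma> \<eta>) * \<kappa> \<eta> z) has_field_derivative f x (\<sigma> \<eta>) * \<kappa>' \<eta> z) (at z)" if "z \<in> B" "\<eta> \<in> circle" for z \<eta>
      by (rule DERIV_cmult) (use k that in blast)
    show "continuous_on circle (\<lambda>\<eta>. f x (\<sigma> \<eta>) * \<kappa> \<eta> z)" if "z \<in> B" for z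
      using cg[of circle "\<lambda>s. s" "\<lambda>s. z" \<kappa>] cf0[OF f(1), of x] ck that by (auto intro!: continuous_intros)
    show "continuous_on (B \<times> circle) (\<lambda>(z, \<eta>). f x (\<sigma> \<eta>) * \<kappa>' \<eta> z)"
      using cg[of "B \<times> circle" snd fst \<kappa>'] cf[of "B \<times> circle" "\<lambda>_. x" snd f] ck f
      by (auto intro!: continuous_on_mult simp: case_prod_unfold continuous_on_projections)
  qed fact
  moreover have "continuous_on (UNIV \<times> B) (\<lambda>(x, z). F x z)"
    unfolding f(2) case_prod_unfold
    by (rule cint_continuous_param)
      (use cg[of "(UNIV \<times> B) \<times> circle" snd "\<lambda>s. snd (fst s)" \<kappa>] cf[of "((UNIV::real set) \<times> B) \<times> circle" "\<lambda>s. fst (fst s)" snd f] ck f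
        in \<open>auto intro!: continuous_on_mult simp: case_prod_unfold continuous_on_projections\<close>)
  moreover have "((\<lambda>y. F y z) has_vector_derivative cint (\<lambda>\<eta>. dx f x (\<sigma> \<eta>) * \<kappa> \<eta> z)) (at x)" if "z \<in> B" for x z
    unfolding f(2)
  proof (rule cint_has_vector_derivative[where T = UNIV])
    show "((\<lambda>x. f x (\<sigma> \<eta>) * \<kappa> \<eta> z) has_vector_derivative dx f x (\<sigma> \<eta>) * \<kappa> \<eta> z) (at x)" if "\<eta> \<in> circle" for x \<eta>
      by (rule has_vector_derivative_mult_left) (use sm_dx(2)[OF f(1)] s that in blast)
    show "continuous_on circle (\<lambda>\<eta>. f x (\<sigma> \<eta>) * \<kappa> \<eta> z)" for x
      using cg[of circle "\<lambda>s. s" "\<lambda>s. z" \<kappa>] cf0[OF f(1), of x] ck that by (auto intro!: continuous_intros)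
    show "continuous_on (UNIV \<times> circle) (\<lambda>(x, \<eta>). dx f x (\<sigma> \<eta>) * \<kappa> \<eta> z)"
      using cg[of "(UNIV::real set) \<times> circle" snd "\<lambda>_. z" \<kappa>] cf[of "(UNIV::real set) \<times> circle" fst snd "dx f"] ck sm_dx(1)[OF f(1)] that
      by (auto intro!: continuous_on_mult simp: case_prod_unfold continuous_on_projections)
  qed auto
  ultimately show "(\<forall>x. F x holomorphic_on B) \<and> continuous_on (UNIV \<times> B) (\<lambda>(x, z). F x z) \<and>
    (\<exists>g'. (\<exists>f. sm E f \<and> g' = (\<lambda>x z. cint (\<lambda>\<eta>. f x (\<sigma> \<eta>) * \<kappa> \<eta> z))) \<and> (\<forall>x. \<forall>z\<in>B. ((\<lambda>y. F y z) has_vector_derivative g' x z) (at x)))"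
    using sm_dx(1)[OF f(1)] by blast
qed (use f in blast)

lemma Cauchy_deriv_cint:
  assumes "f holomorphic_on D" "cball a r \<subseteq> D" "r > 0" "z \<in> ball a r"
  shows "deriv f z = cint (\<lambda>\<eta>. f (a + of_real r * \<eta>) * (of_real r * \<eta> / (of_real r * \<eta> + a - z)^2))"
proof -
  let ?h = "\<lambda>u. f (a + u)"
  have h: "?h holomorphic_on cball 0 r"
    by (rule holomorphic_on_compose_gen[of "\<lambda>u. a + u" _ f D, unfolded o_def])
      (use assms in \<open>auto intro!: holomorphic_intros simp: dist_norm subset_iff\<close>)
  have z: "z - a \<in> ball 0 r" using assms(4) by (simp add: dist_norm norm_minus_commute)
  have "(?h has_field_derivative (1 / (2 * of_real pi * \<i>) * contour_integral(circlepath 0 r) (\<lambda>u. ?h u / (u-(z - a))^2))) (at (z - a))"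
    by (rule Cauchy_derivative_integral_circlepath(2))
      (use h z in \<open>auto intro: holomorphic_on_imp_continuous_on holomorphic_on_subset\<close>)
  then have "(f has_field_derivative (1 / (2 * of_real pi * \<i>) * contour_integral(circlepath 0 r) (\<lambda>u. ?h u / (u-(z - a))^2))) (at z)"
    using DERIV_at_within_shift[of f _ a "z - a" UNIV] by simp
  then show ?thesis
    by (simp add: DERIV_imp_deriv contour_integral_circlepath_eq_cint assms(3) algebra_simps)
qed

lemma has_field_derivative_inverse_square:
  fixes b z c :: complex
  assumes "b - z \<noteq> 0"
  shows "((\<lambda>z. c / (b - z)^2) has_field_derivative 2 * c / (b - z)^3) (at z)"
proof -
  have "((\<lambda>z. c / (b - z)^2) has_field_derivative (0 * (b - z)^2 - c * (2 * (b - z) * (- 1))) / ((b - z)^2 * (b - z)^2)) (at z)"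
    by (rule DERIV_divide) (use assms in \<open>auto intro!: derivative_eq_intros\<close>)
  moreover have "(0 * w^2 - c * (2 * w * (- 1))) / (w^2 * w^2) = 2 * c / w^3" for w :: complex
    by (cases "w = 0") (simp_all add: power2_eq_square power3_eq_cube field_simps)
  ultimately show ?thesis by metis
qed

text \<open>On a small disc the z-derivative is a Cauchy integral over the bounding circle, hence an
  instance of \<open>sm_cint_kernel\<close>; \<open>sm_local\<close> assembles the discs.\<close>

lemma sm_deriv:
  assumes "open D" "sm D f"
  shows "sm D (\<lambda>x z. deriv (f x) z)"
proof (rule sm_local[OF assms(1)])
  fix a assume "a \<in> D"
  then obtain r where r: "r > 0" "cball a r \<subseteq> D" using assms(1) open_contains_cball by blast
  let ?K = "\<lambda>\<eta> z. of_real r * \<eta> / (of_real r * \<eta> + a - z)^2"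
  have nz: "of_real r * \<eta> + a - z \<noteq> 0" if "\<eta> \<in> circle" "z \<in> ball a r" for \<eta> z
  proof
    assume "of_real r * \<eta> + a - z = 0"
    then have "z - a = of_real r * \<eta>" by (simp add: algebra_simps)
    then have "norm (z - a) = r" using that r by (simp add: norm_mult)
    then show False using that by (simp add: dist_norm norm_minus_commute)
  qed
  have "sm (ball a r) (\<lambda>x z. cint (\<lambda>\<eta>. f x (a + of_real r * \<eta>) * ?K \<eta> z))"
  proof (rule sm_cint_kernel[where \<kappa>' = "\<lambda>\<eta> z. 2 * of_real r * \<eta> / (of_real r * \<eta> + a - z)^3", OF assms(2)])
    show "((\<lambda>z. ?K \<eta> z) has_field_derivative 2 * of_real r * \<eta> / (of_real r * \<eta> + a - z)^3) (at z)"
      if "\<eta> \<in> circle" "z \<in> ball a r" for \<eta> z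
      using has_field_derivative_inverse_square[of "of_real r * \<eta> + a" z "of_real r * \<eta>"] nz[OF that] by (simp add: mult.assoc)
    show "a + of_real r * \<eta> \<in> D" if "\<eta> \<in> circle" for \<eta>
      using r that by (auto simp: subset_iff dist_norm norm_mult)
  qed (use nz in \<open>auto intro!: continuous_intros simp: case_prod_unfold\<close>)
  then have "sm (ball a r) (\<lambda>x z. deriv (f x) z)"
    by (rule sm_cong_on) (rule sym, rule Cauchy_deriv_cint[OF sm_holo[OF assms(2)] r(2,1)])
  then show "\<exists>E. open E \<and> a \<in> E \<and> sm E (\<lambda>x z. deriv (f x) z)" using r(1) by force
qed

text \<open>Both sides are the Cauchy integral of \<open>dx f\<close>, by differentiation under the
  mean. It is needed for the v-component of the flow, which contains the x-derivative of a Taylor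
  coefficient of the nonnegative part of Q.\<close>

lemma sm_dx_deriv:
  assumes "open D" "sm D f" "z \<in> D"
  shows "dx (\<lambda>x z. deriv (f x) z) x z = deriv (dx f x) z"
proof -
  obtain r where r: "r > 0" "cball z r \<subseteq> D" using assms open_contains_cball by blast
  let ?K = "\<lambda>\<eta>. of_real r * \<eta> / (of_real r * \<eta>)^2"
  have in_D: "z + of_real r * \<eta> \<in> D" if "\<eta> \<in> circle" for \<eta>
    using r that by (auto simp: subset_iff dist_norm norm_mult)
  have eq: "deriv (g x) z = cint (\<lambda>\<eta>. g x (z + of_real r * \<eta>) * ?K \<eta>)" if "sm D g" for g x
    using Cauchy_deriv_cint[OF sm_holo[OF that] r(2,1), of z x] r by simp
  have cs: "continuous_on S (\<lambda>s. g (p s) (z + of_real r * q s) * ?K (q s))"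
    if "sm D g" "continuous_on S p" "continuous_on S q" "\<And>s. s \<in> S \<Longrightarrow> q s \<in> circle"
      for g and S :: "'x::t2_space set" and p q
  proof -
    have "q s \<noteq> 0" if "s \<in> S" for s using \<open>\<And>s. s \<in> S \<Longrightarrow> q s \<in> circle\<close>[OF that] by auto
    with that in_D r show ?thesis
      by (intro continuous_intros sm_cont2[OF that(1)]) auto
  qed
  have "((\<lambda>x. cint (\<lambda>\<eta>. f x (z + of_real r * \<eta>) * ?K \<eta>)) has_vector_derivative
     cint (\<lambda>\<eta>. dx f x (z + of_real r * \<eta>) * ?K \<eta>)) (at x)"
  proof (rule cint_has_vector_derivative[where T = UNIV])
    show "((\<lambda>x. f x (z + of_real r * \<eta>) * ?K \<eta>) has_vector_derivative dx f x (z + of_real r * \<eta>) * ?K \<eta>) (at x)"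
      if "\<eta> \<in> circle" for x \<eta>
      by (rule has_vector_derivative_mult_left) (use sm_dx(2)[OF assms(2)] in_D that in blast)
    show "continuous_on circle (\<lambda>\<eta>. f x (z + of_real r * \<eta>) * ?K \<eta>)" for x
      using cs[OF assms(2), of circle "\<lambda>_. x" "\<lambda>s. s"] by (simp add: continuous_on_id)
    show "continuous_on (UNIV \<times> circle) (\<lambda>(x, \<eta>). dx f x (z + of_real r * \<eta>) * ?K \<eta>)"
      using cs[OF sm_dx(1)[OF assms(2)], of "UNIV \<times> circle" fst snd] by (auto simp: case_prod_unfold continuous_on_projections)
  qed auto
  then show ?thesis
    by (intro dx_eqI) (simp add: eq[OF assms(2)] eq[OF sm_dx(1)[OF assms(2)]])
qed

section \<open>Laurent splitting on annuli\<close>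

text \<open>The radii are reciprocal, so that inversion preserves the annulus and one parameter
  controls the Cauchy circles on both sides of the unit circle.\<close>

definition Ann :: "real \<Rightarrow> complex set" where
  "Ann R = {z. 1 / R < norm z \<and> norm z < R}"

lemma open_Ann: "open (Ann R)"
  unfolding Ann_def by (intro open_Collect_conj open_Collect_less continuous_intros)

lemma Ann_mono: "1 < r \<Longrightarrow> r \<le> R \<Longrightarrow> Ann r \<subseteq> Ann R"
  using frac_le[of 1 1 r R] unfolding Ann_def by auto

lemma circle_Ann: "1 < R \<Longrightarrow> circle \<subseteq> Ann R"
  unfolding Ann_def by auto

lemma connected_Ann: "connected (Ann R)"
  using connected_annulus(1)[where a = "0::complex" and ?r1.0 = "1 / R" and ?r2.0 = R] by (simp add: Ann_def)

lemma Ann_nonzero: "1 < R \<Longrightarrow> z \<in> Ann R \<Longrightarrow> z \<noteq> 0"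
  unfolding Ann_def by auto

lemma Ann_inverse: "1 < R \<Longrightarrow> z \<in> Ann R \<Longrightarrow> 1 / z \<in> Ann R"
  unfolding Ann_def by (cases "z = 0") (auto simp: norm_divide divide_simps mult.commute)

lemma Ann_ball: "Ann R \<subseteq> ball 0 R"
  unfolding Ann_def by auto

lemma scaled_circle_Ann:
  assumes "1 < r" "r < R" "\<eta> \<in> circle"
  shows "of_real r * \<eta> \<in> Ann R" "of_real (1 / r) * \<eta> \<in> Ann R"
proof -
  have "1 / R < 1" "1 / R < 1 / r" "1 / r < 1" using assms by (auto simp: field_simps)
  then have "1 / R < r" "1 / r < R" using assms by linarith+
  with \<open>1 / R < 1 / r\<close> show "of_real r * \<eta> \<in> Ann R" "of_real (1 / r) * \<eta> \<in> Ann R"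
    using assms by (auto simp: Ann_def norm_mult norm_divide)
qed

lemma circle_islimpt: "1 islimpt circle"
proof -
  have "connected circle" by (rule connected_sphere) simp
  moreover have "circle \<noteq> {x}" for x
  proof
    assume "circle = {x}"
    moreover have "- 1 \<in> circle" "1 \<in> circle" by simp_all
    ultimately have "- 1 = x" "1 = x" by blast+
    then show False by simp
  qed
  ultimately show ?thesis using connected_imp_perfect[of circle 1] by simp
qed

text \<open>Many identities are given on the circle only. The identity theorem, with 1 as a limit
  point of the circle, carries logarithm identities, periodicity and equality of forms to a
  neighbourhood, where z-derivatives can use them.\<close>

lemma holomorphic_eq_on_Ann:
  assumes "f holomorphic_on Ann R" "g holomorphic_on Ann R" "1 < R" "\<And>z. z \<in> circle \<Longrightarrow> f z = g z" "z \<in> Ann R"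
  shows "f z = g z"
proof -
  have "(\<lambda>z. f z - g z) z = 0"
    by (rule analytic_continuation[where f = "\<lambda>z. f z - g z" and S = "Ann R" and U = circle and \<xi> = 1])
      (use assms circle_Ann[OF assms(3)] circle_islimpt open_Ann connected_Ann in \<open>auto intro!: holomorphic_intros\<close>)
  then show ?thesis by simp
qed

text \<open>The two Cauchy integrals that project a function on an annulus to its non-negative powers
  and, in the variable \<open>1 / z\<close> and after division by \<open>1 / z\<close>, to its negative powers.\<close>

definition qpart :: "real \<Rightarrow> (complex \<Rightarrow> complex) \<Rightarrow> complex \<Rightarrow> complex" where
  "qpart r f z = cint (\<lambda>\<eta>. f (of_real r * \<eta>) * (of_real r * \<eta> / (of_real r * \<eta> - z)))"

definition ppart :: "real \<Rightarrow> (complex \<Rightarrow> complex) \<Rightarrow> complex \<Rightarrow> complex" where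
  "ppart r f z = cint (\<lambda>\<eta>. f (of_real (1 / r) * \<eta>) * (of_real (1 / r) * \<eta> / (1 - of_real (1 / r) * \<eta> * z)))"

lemma has_field_derivative_inverse_linear:
  fixes b c d z :: complex
  assumes "b - d * z \<noteq> 0"
  shows "((\<lambda>z. c / (b - d * z)) has_field_derivative c * d / (b - d * z)^2) (at z)"
proof -
  have "((\<lambda>z. c / (b - d * z)) has_field_derivative (0 * (b - d * z) - c * (- d)) / ((b - d * z) * (b - d * z))) (at z)"
    by (rule DERIV_divide) (use assms in \<open>auto intro!: derivative_eq_intros\<close>)
  then show ?thesis by (simp add: power2_eq_square)
qed

lemma sm_qpart:
  assumes "sm (Ann R) f" "1 < r" "r < R"
  shows "sm (ball 0 r) (\<lambda>x. qpart r (f x))"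
  unfolding qpart_def
proof (rule sm_cint_kernel[where \<kappa>' = "\<lambda>\<eta> z. of_real r * \<eta> / (of_real r * \<eta> - z)^2", OF assms(1)])
  have nz: "of_real r * \<eta> - z \<noteq> 0" if "\<eta> \<in> circle" "z \<in> ball 0 r" for \<eta> z
    using that assms by (auto simp: norm_mult)
  show "((\<lambda>z. of_real r * \<eta> / (of_real r * \<eta> - z)) has_field_derivative of_real r * \<eta> / (of_real r * \<eta> - z)^2) (at z)"
    if "\<eta> \<in> circle" "z \<in> ball 0 r" for \<eta> z
    using has_field_derivative_inverse_linear[of "of_real r * \<eta>" 1 z "of_real r * \<eta>"] nz[OF that] by simp
  show "of_real r * \<eta> \<in> Ann R" if "\<eta> \<in> circle" for \<eta>
    using scaled_circle_Ann[OF assms(2,3) that] by simp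
  show "continuous_on (circle \<times> ball 0 r) (\<lambda>(\<eta>, z). of_real r * \<eta> / (of_real r * \<eta> - z))"
    "continuous_on (circle \<times> ball 0 r) (\<lambda>(\<eta>, z). of_real r * \<eta> / (of_real r * \<eta> - z)\<^sup>2)"
    using nz by (auto intro!: continuous_intros simp: case_prod_unfold)
qed (auto intro!: continuous_intros)

lemma sm_ppart:
  assumes "sm (Ann R) f" "1 < r" "r < R"
  shows "sm (ball 0 r) (\<lambda>x. ppart r (f x))"
  unfolding ppart_def
proof (rule sm_cint_kernel[where \<kappa>' = "\<lambda>\<eta> z. (of_real (1 / r) * \<eta>)^2 / (1 - of_real (1 / r) * \<eta> * z)^2", OF assms(1)])
  have nz: "1 - of_real (1 / r) * \<eta> * z \<noteq> 0" if "\<eta> \<in> circle" "z \<in> ball 0 r" for \<eta> z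
  proof
    assume "1 - of_real (1 / r) * \<eta> * z = 0"
    then have "norm (of_real (1 / r) * \<eta> * z) = 1" by simp
    then show False using that assms by (simp add: norm_mult norm_divide)
  qed
  show "((\<lambda>z. of_real (1 / r) * \<eta> / (1 - of_real (1 / r) * \<eta> * z)) has_field_derivative
     (of_real (1 / r) * \<eta>)^2 / (1 - of_real (1 / r) * \<eta> * z)^2) (at z)"
    if "\<eta> \<in> circle" "z \<in> ball 0 r" for \<eta> z
    using has_field_derivative_inverse_linear[of 1 "of_real (1 / r) * \<eta>" z "of_real (1 / r) * \<eta>"] nz[OF that]
    by (simp add: power2_eq_square)
  show "of_real (1 / r) * \<eta> \<in> Ann R" if "\<eta> \<in> circle" for \<eta>
    using scaled_circle_Ann[OF assms(2,3) that] by simp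
  show "continuous_on (circle \<times> ball 0 r) (\<lambda>(\<eta>, z). of_real (1 / r) * \<eta> / (1 - of_real (1 / r) * \<eta> * z))"
    "continuous_on (circle \<times> ball 0 r) (\<lambda>(\<eta>, z). (of_real (1 / r) * \<eta>)\<^sup>2 / (1 - of_real (1 / r) * \<eta> * z)\<^sup>2)"
    using nz by (auto intro!: continuous_intros simp: case_prod_unfold)
qed (use assms in \<open>auto intro!: continuous_intros\<close>)

lemma qpart_holomorphic: "f holomorphic_on Ann R \<Longrightarrow> 1 < r \<Longrightarrow> r < R \<Longrightarrow> qpart r f holomorphic_on ball 0 r"
  using sm_holo[OF sm_qpart[OF sm_hol]] by blast

lemma ppart_holomorphic: "f holomorphic_on Ann R \<Longrightarrow> 1 < r \<Longrightarrow> r < R \<Longrightarrow> ppart r f holomorphic_on ball 0 r"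
  using sm_holo[OF sm_ppart[OF sm_hol]] by blast

lemma contour_integral_Ann_radius:
  assumes "f holomorphic_on Ann R" "1 < r" "r < R"
  shows "contour_integral (circlepath 0 r) f = contour_integral (circlepath 0 (1 / r)) f"
proof (rule Cauchy_theorem_homotopic_loops)
  show "homotopic_loops (Ann R) (circlepath 0 r) (circlepath 0 (1 / r))"
  proof (rule homotopic_loops_linear)
    fix t :: real assume "t \<in> {0..1}"
    let ?e = "exp (2 * of_real pi * \<i> * of_real t) :: complex"
    have e: "norm ?e = 1" by (simp add: norm_exp_eq_Re)
    show "closed_segment (circlepath 0 r t) (circlepath 0 (1 / r) t) \<subseteq> Ann R"
    proof
      fix w assume "w \<in> closed_segment (circlepath 0 r t) (circlepath 0 (1 / r) t)"
      then obtain u where u: "0 \<le> u" "u \<le> 1" "w = (1 - u) *\<^sub>R (of_real r * ?e) + u *\<^sub>R (of_real (1 / r) * ?e)"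
        by (auto simp: closed_segment_def circlepath)
      then have "w = of_real ((1 - u) * r + u * (1 / r)) * ?e"
        by (simp add: scaleR_conv_of_real algebra_simps)
      then have nw: "norm w = (1 - u) * r + u * (1 / r)"
        using u assms by (simp add: norm_mult e del: of_real_add of_real_mult of_real_divide)
      have "1 / r < 1" using assms by (auto simp: field_simps)
      then have r: "1 / R < 1 / r" "1 / r < r"
        using assms(2,3) less_trans[of "1 / r" 1 r] by (auto intro!: frac_less2)
      have "(1 - u) * (1 / r) + u * (1 / r) \<le> norm w" "norm w \<le> (1 - u) * r + u * r"
        unfolding nw using u r by (auto intro!: add_mono mult_left_mono simp del: times_divide_eq_right)
      then have "1 / r \<le> norm w" "norm w \<le> r" by (simp_all add: algebra_simps flip: add_divide_distrib)
      then show "w \<in> Ann R" using r assms by (simp add: Ann_def)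
    qed
  qed auto
qed (use assms in \<open>auto intro: open_Ann\<close>)

text \<open>The difference quotient of f at z has a removable singularity, so its integrals over the
  two circles agree. The constant \<open>f z\<close> contributes \<open>f z\<close> on the outer
  circle, which surrounds z, and 0 on the inner one, which does not.\<close>

lemma Ann_Cauchy_formula:
  assumes f: "f holomorphic_on Ann R" and r: "1 < r" "r < R" and z: "z \<in> Ann r"
  shows "f z = cint (\<lambda>\<eta>. f (of_real r * \<eta>) * (of_real r * \<eta> / (of_real r * \<eta> - z)))
     - cint (\<lambda>\<eta>. f (of_real (1 / r) * \<eta>) * (of_real (1 / r) * \<eta> / (of_real (1 / r) * \<eta> - z)))"
proof -
  let ?G = "\<lambda>\<zeta>. if \<zeta> = z then deriv f z else (f \<zeta> - f z) / (\<zeta> - z)"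
  have zR: "z \<in> Ann R" using Ann_mono[of r R] r z by auto
  have rpos: "r > 0" "1 / r > 0" using r by auto
  have G: "?G holomorphic_on Ann R"
    by (rule pole_lemma_open[OF f open_Ann])
  have nz1: "of_real r * \<eta> \<noteq> z" if "\<eta> \<in> circle" for \<eta>
    using z that r by (auto simp: Ann_def norm_mult)
  have nz2: "of_real (1 / r) * \<eta> \<noteq> z" if "\<eta> \<in> circle" for \<eta>
    using z that r by (auto simp: Ann_def norm_mult norm_divide)
  have in1: "of_real r * \<eta> \<in> Ann R" if "\<eta> \<in> circle" for \<eta>
    using scaled_circle_Ann[OF r that] by simp
  have in2: "of_real (1 / r) * \<eta> \<in> Ann R" if "\<eta> \<in> circle" for \<eta>
    using scaled_circle_Ann[OF r that] by simp
  have split: "cint (\<lambda>\<eta>. ?G (of_real s * \<eta>) * (of_real s * \<eta>)) = cint (\<lambda>\<eta>. f (of_real s * \<eta>) * (of_real s * \<eta> / (of_real s * \<eta> - z)))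
      - f z * cint (\<lambda>\<eta>. of_real s * \<eta> / (of_real s * \<eta> - z))"
    if "\<And>\<eta>. \<eta> \<in> circle \<Longrightarrow> of_real s * \<eta> \<noteq> z" "\<And>\<eta>. \<eta> \<in> circle \<Longrightarrow> of_real s * \<eta> \<in> Ann R" for s
  proof -
    have c: "continuous_on circle (\<lambda>\<eta>. f (of_real s * \<eta>))"
      by (rule continuous_on_compose2[OF holomorphic_on_imp_continuous_on[OF f]])
        (use that in \<open>auto intro!: continuous_intros\<close>)
    have "cint (\<lambda>\<eta>. ?G (of_real s * \<eta>) * (of_real s * \<eta>)) = cint (\<lambda>\<eta>. f (of_real s * \<eta>) * (of_real s * \<eta> / (of_real s * \<eta> - z))
       - f z * (of_real s * \<eta> / (of_real s * \<eta> - z)))"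
    proof (rule cint_cong)
      fix \<eta> :: complex assume e: "\<eta> \<in> circle"
      have "(F - G) / d * c = F * (c / d) - G * (c / d)" for F G c d :: complex
        by (simp add: diff_divide_distrib left_diff_distrib)
      then show "?G (of_real s * \<eta>) * (of_real s * \<eta>) = f (of_real s * \<eta>) * (of_real s * \<eta> / (of_real s * \<eta> - z))
       - f z * (of_real s * \<eta> / (of_real s * \<eta> - z))"
        using that(1)[OF e] by simp
    qed
    also have "\<dots> = cint (\<lambda>\<eta>. f (of_real s * \<eta>) * (of_real s * \<eta> / (of_real s * \<eta> - z)))
       - cint (\<lambda>\<eta>. f z * (of_real s * \<eta> / (of_real s * \<eta> - z)))"
      by (rule cint_diff) (use that(1) in \<open>auto intro!: continuous_intros c\<close>)
    finally show ?thesis by (simp only: cint_mult_left)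
  qed
  have "contour_integral (circlepath 0 r) (\<lambda>\<zeta>. 1 / (\<zeta> - z)) = 2 * of_real pi * \<i> * 1"
    by (rule contour_integral_unique, rule Cauchy_integral_circlepath_simple)
      (use z in \<open>auto simp: Ann_def\<close>)
  then have one: "cint (\<lambda>\<eta>. of_real r * \<eta> / (of_real r * \<eta> - z)) = 1"
    by (simp add: contour_integral_circlepath_eq_cint rpos)
  have "contour_integral (circlepath 0 (1 / r)) (\<lambda>\<zeta>. 1 / (\<zeta> - z)) = 0"
  proof (rule contour_integral_unique, rule Cauchy_theorem_disc_simple[where a = 0 and e = "norm z"])
    show "(\<lambda>\<zeta>. 1 / (\<zeta> - z)) holomorphic_on ball 0 (norm z)" by (auto intro!: holomorphic_intros)
    show "path_image (circlepath 0 (1 / r)) \<subseteq> ball 0 (norm z)"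
      using z r by (auto simp: Ann_def path_image_circlepath_minus)
  qed auto
  then have zero: "cint (\<lambda>\<eta>. of_real (1 / r) * \<eta> / (of_real (1 / r) * \<eta> - z)) = 0"
    unfolding contour_integral_circlepath_eq_cint[OF rpos(2)] by (simp add: mult.commute)
  have "cint (\<lambda>\<eta>. ?G (of_real r * \<eta>) * (of_real r * \<eta>)) = cint (\<lambda>\<eta>. ?G (of_real (1 / r) * \<eta>) * (of_real (1 / r) * \<eta>))"
    using contour_integral_Ann_radius[OF G r] unfolding contour_integral_circlepath_eq_cint[OF rpos(1)] contour_integral_circlepath_eq_cint[OF rpos(2)]
    by simp
  moreover have "cint (\<lambda>\<eta>. ?G (of_real r * \<eta>) * (of_real r * \<eta>)) = cint (\<lambda>\<eta>. f (of_real r * \<eta>) * (of_real r * \<eta> / (of_real r * \<eta> - z))) - f z"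
    using split[of r] nz1 in1 unfolding one by simp
  moreover have "cint (\<lambda>\<eta>. ?G (of_real (1 / r) * \<eta>) * (of_real (1 / r) * \<eta>)) = cint (\<lambda>\<eta>. f (of_real (1 / r) * \<eta>) * (of_real (1 / r) * \<eta> / (of_real (1 / r) * \<eta> - z)))"
    using split[of "1 / r"] nz2 in2 unfolding zero by simp
  ultimately show ?thesis by (metis (no_types, lifting) add_diff_cancel_left' diff_add_cancel diff_diff_eq2)
qed

lemma Laurent_split:
  assumes f: "f holomorphic_on Ann R" and r: "1 < r" "r < R" and z: "z \<in> Ann r"
  shows "f z = qpart r f z + ppart r f (1 / z) / z"
proof -
  have z0: "z \<noteq> 0" using Ann_nonzero r z by blast
  have nz2: "of_real (1 / r) * \<eta> - z \<noteq> 0" if "\<eta> \<in> circle" for \<eta>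
    using z that r by (auto simp: Ann_def norm_mult norm_divide)
  have "cint (\<lambda>\<eta>. f (of_real (1 / r) * \<eta>) * (of_real (1 / r) * \<eta> / (of_real (1 / r) * \<eta> - z)))
     = cint (\<lambda>\<eta>. f (of_real (1 / r) * \<eta>) * (of_real (1 / r) * \<eta> / (1 - of_real (1 / r) * \<eta> * (1 / z))) * (- 1 / z))"
  proof (rule cint_cong)
    fix \<eta> :: complex assume "\<eta> \<in> circle"
    have *: "c / (c - z) = c / (1 - c * (1 / z)) * (- 1 / z)" if "c - z \<noteq> 0" for c
    proof -
      have "1 - c * (1 / z) = - (c - z) / z" using z0 by (simp add: field_simps)
      then have "c / (1 - c * (1 / z)) * (- 1 / z) = c / (- (c - z) / z) * (- 1 / z)" by (simp only:)
      also have "\<dots> = c / (c - z)" using z0 that by (simp add: field_simps)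
      finally show ?thesis by simp
    qed
    show "f (of_real (1 / r) * \<eta>) * (of_real (1 / r) * \<eta> / (of_real (1 / r) * \<eta> - z)) =
      f (of_real (1 / r) * \<eta>) * (of_real (1 / r) * \<eta> / (1 - of_real (1 / r) * \<eta> * (1 / z))) * (- 1 / z)"
      unfolding *[OF nz2[OF \<open>\<eta> \<in> circle\<close>]] by simp
  qed
  also have "\<dots> = ppart r f (1 / z) * (- 1 / z)"
    unfolding ppart_def by (rule cint_mult_right)
  finally show ?thesis
    using Ann_Cauchy_formula[OF assms] by (simp add: qpart_def)
qed

text \<open>The divided difference \<open>(f a - f b) / (a - b)\<close>, written through Cauchy
  integrals so that it is continuous across the diagonal, where it equals the derivative.
  Injectivity of w on the circle and \<open>w' \<noteq> 0\<close> then become one condition,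
  nonvanishing on a compact set, which is stable under small changes.\<close>

definition divdiff :: "real \<Rightarrow> (complex \<Rightarrow> complex) \<Rightarrow> complex \<Rightarrow> complex \<Rightarrow> complex" where
  "divdiff r f a b = cint (\<lambda>\<eta>. f (of_real r * \<eta>) * (of_real r * \<eta> / ((of_real r * \<eta> - a) * (of_real r * \<eta> - b))))
     - cint (\<lambda>\<eta>. f (of_real (1 / r) * \<eta>) * (of_real (1 / r) * \<eta> / ((of_real (1 / r) * \<eta> - a) * (of_real (1 / r) * \<eta> - b))))"

lemma divdiff:
  assumes f: "f holomorphic_on Ann R" and r: "1 < r" "r < R" and a: "a \<in> Ann r" and b: "b \<in> Ann r"
  shows "f a - f b = (a - b) * divdiff r f a b"
proof -
  have nz1: "of_real r * \<eta> \<noteq> z" if "\<eta> \<in> circle" "z \<in> Ann r" for \<eta> z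
    using that r by (auto simp: Ann_def norm_mult)
  have nz2: "of_real (1 / r) * \<eta> \<noteq> z" if "\<eta> \<in> circle" "z \<in> Ann r" for \<eta> z
    using that r by (auto simp: Ann_def norm_mult norm_divide)
  have in1: "of_real r * \<eta> \<in> Ann R" if "\<eta> \<in> circle" for \<eta>
    using scaled_circle_Ann[OF r that] by simp
  have in2: "of_real (1 / r) * \<eta> \<in> Ann R" if "\<eta> \<in> circle" for \<eta>
    using scaled_circle_Ann[OF r that] by simp
  \<comment> \<open>Partial fractions of the Cauchy kernels at a and b, for either of the two
    circles.\<close>
  have *: "cint (\<lambda>\<eta>. f (of_real s * \<eta>) * (of_real s * \<eta> / (of_real s * \<eta> - a))) - cint (\<lambda>\<eta>. f (of_real s * \<eta>) * (of_real s * \<eta> / (of_real s * \<eta> - b)))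
     = (a - b) * cint (\<lambda>\<eta>. f (of_real s * \<eta>) * (of_real s * \<eta> / ((of_real s * \<eta> - a) * (of_real s * \<eta> - b))))"
    if "\<And>\<eta> z. \<eta> \<in> circle \<Longrightarrow> z \<in> Ann r \<Longrightarrow> of_real s * \<eta> \<noteq> z" "\<And>\<eta>. \<eta> \<in> circle \<Longrightarrow> of_real s * \<eta> \<in> Ann R" for s
  proof -
    have c: "continuous_on circle (\<lambda>\<eta>. f (of_real s * \<eta>))"
      by (rule continuous_on_compose2[OF holomorphic_on_imp_continuous_on[OF f]])
        (use that in \<open>auto intro!: continuous_intros\<close>)
    have "?thesis \<longleftrightarrow> cint (\<lambda>\<eta>. f (of_real s * \<eta>) * (of_real s * \<eta> / (of_real s * \<eta> - a)) - f (of_real s * \<eta>) * (of_real s * \<eta> / (of_real s * \<eta> - b)))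
      = cint (\<lambda>\<eta>. (a - b) * (f (of_real s * \<eta>) * (of_real s * \<eta> / ((of_real s * \<eta> - a) * (of_real s * \<eta> - b)))))"
      unfolding cint_mult_left
      by (subst cint_diff) (use that(1) a b in \<open>auto intro!: continuous_intros c\<close>)
    also have "\<dots>"
    proof (rule cint_cong)
      fix \<eta> :: complex assume e: "\<eta> \<in> circle"
      have **: "F * (c / (c - a)) - F * (c / (c - b)) = (a - b) * (F * (c / ((c - a) * (c - b))))" if "c - a \<noteq> 0" "c - b \<noteq> 0" for c F :: complex
        using that by (simp add: divide_simps) (simp add: algebra_simps)
      show "f (of_real s * \<eta>) * (of_real s * \<eta> / (of_real s * \<eta> - a)) - f (of_real s * \<eta>) * (of_real s * \<eta> / (of_real s * \<eta> - b)) =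
         (a - b) * (f (of_real s * \<eta>) * (of_real s * \<eta> / ((of_real s * \<eta> - a) * (of_real s * \<eta> - b))))"
        by (rule **) (use that(1)[OF e] a b in auto)
    qed
    finally show ?thesis by blast
  qed
  have s1: "cint (\<lambda>\<eta>. f (of_real r * \<eta>) * (of_real r * \<eta> / (of_real r * \<eta> - a))) - cint (\<lambda>\<eta>. f (of_real r * \<eta>) * (of_real r * \<eta> / (of_real r * \<eta> - b)))
     = (a - b) * cint (\<lambda>\<eta>. f (of_real r * \<eta>) * (of_real r * \<eta> / ((of_real r * \<eta> - a) * (of_real r * \<eta> - b))))"
    by (rule *[OF nz1 in1])
  have s2: "cint (\<lambda>\<eta>. f (of_real (1 / r) * \<eta>) * (of_real (1 / r) * \<eta> / (of_real (1 / r) * \<eta> - a))) - cint (\<lambda>\<eta>. f (of_real (1 / r) * \<eta>) * (of_real (1 / r) * \<eta> / (of_real (1 / r) * \<eta> - b)))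
     = (a - b) * cint (\<lambda>\<eta>. f (of_real (1 / r) * \<eta>) * (of_real (1 / r) * \<eta> / ((of_real (1 / r) * \<eta> - a) * (of_real (1 / r) * \<eta> - b))))"
    by (rule *[OF nz2 in2])
  show ?thesis
    unfolding divdiff_def right_diff_distrib[of "a - b"] s1[symmetric] s2[symmetric]
      Ann_Cauchy_formula[OF f r a] Ann_Cauchy_formula[OF f r b]
    by simp
qed

section \<open>Laurent coefficients and uniqueness of the splitting\<close>

lemma cint_higher_deriv:
  assumes "q holomorphic_on ball 0 r" "1 < r"
  shows "cint (\<lambda>z. q z / z ^ m) = (deriv ^^ m) q 0 / fact m"
proof -
  have "((\<lambda>u. q u / (u - 0) ^ Suc m) has_contour_integral (2 * pi * \<i>) / fact m * (deriv ^^ m) q 0) (circlepath 0 1)"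
    by (rule Cauchy_has_contour_integral_higher_derivative_circlepath)
      (use assms in \<open>auto intro!: holomorphic_on_imp_continuous_on intro: holomorphic_on_subset\<close>)
  from contour_integral_unique[OF this] show ?thesis
    by (simp add: cint_def mult.commute flip: power_Suc)
qed

lemma cint_mult_power:
  assumes "q holomorphic_on ball 0 r" "1 < r" "m > 0"
  shows "cint (\<lambda>z. q z * z ^ m) = 0"
proof -
  have "(\<lambda>z. q z * z ^ m) holomorphic_on ball 0 r" using assms by (intro holomorphic_intros)
  from cint_higher_deriv[OF this assms(2), of 0] show ?thesis using assms(3) by simp
qed

text \<open>Multiplication by the power of z leaves one of the two summands with strictly positive
  powers only, of z or of \<open>1 / z\<close>, so that its mean vanishes; the mean of the other is
  a Taylor coefficient at 0.\<close>

lemma lcoeff_Laurent: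
  assumes q: "q holomorphic_on ball 0 r" and p: "p holomorphic_on ball 0 r" and r: "1 < r"
    and f: "\<And>z. z \<in> circle \<Longrightarrow> f z = q z + p (1 / z) / z"
  shows "lcoeff f (int k) = (deriv ^^ k) q 0 / fact k"
    and "lcoeff f (- int (Suc k)) = (deriv ^^ k) p 0 / fact k"
proof -
  have c: "continuous_on circle q" "continuous_on circle p"
    using assms by (auto intro!: holomorphic_on_imp_continuous_on intro: holomorphic_on_subset)
  have ci: "continuous_on circle (\<lambda>z. p (1 / z))"
    by (rule continuous_on_compose2[OF c(2)]) (auto intro!: continuous_intros simp: norm_divide)
  have "lcoeff f (int k) = cint (\<lambda>z. q z / z ^ k + p (1 / z) * (1 / z) ^ Suc k)"
    unfolding lcoeff_def
  proof (rule cint_cong)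
    fix z :: complex assume "z \<in> circle"
    then have "z \<noteq> 0" by auto
    then show "f z * z powi - int k = q z / z ^ k + p (1 / z) * (1 / z) ^ Suc k"
      using f[OF \<open>z \<in> circle\<close>] by (simp add: power_int_minus field_simps)
  qed
  also have "\<dots> = cint (\<lambda>z. q z / z ^ k) + cint (\<lambda>z. p (1 / z) * (1 / z) ^ Suc k)"
    by (rule cint_add) (auto intro!: continuous_intros c ci)
  also have "cint (\<lambda>z. p (1 / z) * (1 / z) ^ Suc k) = cint (\<lambda>z. p z * z ^ Suc k)"
    by (rule cint_inverse_arg) (auto intro!: continuous_intros c)
  finally show "lcoeff f (int k) = (deriv ^^ k) q 0 / fact k"
    using cint_mult_power[OF p r, of "Suc k"] cint_higher_deriv[OF q r] by simp
  have "lcoeff f (- int (Suc k)) = cint (\<lambda>z. q z * z ^ Suc k + p (1 / z) / (1 / z) ^ k)"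
    unfolding lcoeff_def minus_minus power_int_of_nat
  proof (rule cint_cong)
    fix z :: complex assume "z \<in> circle"
    then have "z \<noteq> 0" by auto
    then show "f z * z ^ Suc k = q z * z ^ Suc k + p (1 / z) / (1 / z) ^ k"
      unfolding f[OF \<open>z \<in> circle\<close>] by (simp add: field_simps)
  qed
  also have "\<dots> = cint (\<lambda>z. q z * z ^ Suc k) + cint (\<lambda>z. p (1 / z) / (1 / z) ^ k)"
    by (rule cint_add) (auto intro!: continuous_intros c ci)
  also have "cint (\<lambda>z. p (1 / z) / (1 / z) ^ k) = cint (\<lambda>z. p z / z ^ k)"
    by (rule cint_inverse_arg) (auto intro!: continuous_intros c)
  finally show "lcoeff f (- int (Suc k)) = (deriv ^^ k) p 0 / fact k"
    using cint_mult_power[OF q r, of "Suc k"] cint_higher_deriv[OF p r] by simp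
qed

text \<open>The decomposition is required on the circle, but the series, formed from coefficients
  that the circle determines, represents q on the whole larger disc. This makes the brackets of the
  Toda flow meaningful at boundary points, where z-derivatives are taken.\<close>

lemma plus_part_Laurent:
  assumes "q holomorphic_on ball 0 r" "p holomorphic_on ball 0 r" "1 < r"
    "\<And>z. z \<in> circle \<Longrightarrow> f z = q z + p (1 / z) / z" "z \<in> ball 0 r"
  shows "plus_part f z = q z"
proof -
  have "lcoeff f (int k) = (deriv ^^ k) q 0 / fact k" for k
    by (rule lcoeff_Laurent(1)[where q = q and p = p]) (use assms in auto)
  then show ?thesis
    using holomorphic_power_series[OF assms(1,5)] unfolding plus_part_def by (simp add: sums_iff)
qed

lemma minus_part_Laurent:
  assumes "q holomorphic_on ball 0 r" "p holomorphic_on ball 0 r" "1 < r"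
    "\<And>z. z \<in> circle \<Longrightarrow> f z = q z + p (1 / z) / z" "1 / z \<in> ball 0 r" "z \<noteq> 0"
  shows "minus_part f z = p (1 / z) / z"
proof -
  have "(\<lambda>k. (deriv ^^ k) p 0 / fact k * (1 / z) ^ k / z) sums (p (1 / z) / z)"
    using sums_divide[OF holomorphic_power_series[OF assms(2,5)], of z] by simp
  moreover have "(deriv ^^ k) p 0 / fact k * (1 / z) ^ k / z = lcoeff f (- int (Suc k)) * z powi (- int (Suc k))" for k
  proof -
    have "lcoeff f (- int (Suc k)) = (deriv ^^ k) p 0 / fact k"
      by (rule lcoeff_Laurent(2)[where q = q and p = p]) (use assms in auto)
    then show ?thesis
      unfolding power_int_minus power_int_of_nat using assms(6) by (simp add: field_simps del: of_nat_Suc)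
  qed
  ultimately show ?thesis
    unfolding minus_part_def by (simp only: sums_iff)
qed

lemma Laurent_unique:
  assumes "q holomorphic_on ball 0 r" "p holomorphic_on ball 0 r" "1 < r"
    "\<And>z. z \<in> circle \<Longrightarrow> q z + p (1 / z) / z = 0" "z \<in> ball 0 r"
  shows "q z = 0" "p z = 0"
proof -
  have 0: "(0::complex) = q z + p (1 / z) / z" if "z \<in> circle" for z
    using assms(4)[OF that] by simp
  have l: "lcoeff (\<lambda>z. 0) k = 0" for k by (simp add: lcoeff_def cint_zero)
  show "q z = 0" using holomorphic_power_series[OF assms(1,5)] lcoeff_Laurent(1)[OF assms(1-3), of "\<lambda>z. 0", OF 0] l
    by (simp add: sums_iff)
  show "p z = 0" using holomorphic_power_series[OF assms(2,5)] lcoeff_Laurent(2)[OF assms(1-3), of "\<lambda>z. 0", OF 0] l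
    by (simp add: sums_iff)
qed

section \<open>Formal calculus of the densities\<close>

text \<open>Expressions in \<open>\<lambda>\<close>, \<open>\<lambda>bar\<close>, their inverses, \<open>1 / w\<close>, \<open>log (1 + \<lambda>bar / \<lambda>)\<close> and
  \<open>log (\<lambda>bar w)\<close>. They are closed under the formal partial derivatives by \<open>\<lambda>\<close> and \<open>\<lambda>bar\<close>, which
  compute the derivative along any curve.\<close>

datatype expr = ELam | ELamb | EInvLam | EInvLamb | EInvW | ELogP | ELogR | EConst complex
  | EAdd expr expr | EMul expr expr

primrec ev :: "expr \<Rightarrow> complex \<Rightarrow> complex \<Rightarrow> complex \<Rightarrow> complex \<Rightarrow> complex" where
  "ev ELam l b P R = l"
| "ev ELamb l b P R = b"
| "ev EInvLam l b P R = inverse l"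
| "ev EInvLamb l b P R = inverse b"
| "ev EInvW l b P R = inverse (l + b)"
| "ev ELogP l b P R = P"
| "ev ELogR l b P R = R"
| "ev (EConst c) l b P R = c"
| "ev (EAdd e f) l b P R = ev e l b P R + ev f l b P R"
| "ev (EMul e f) l b P R = ev e l b P R * ev f l b P R"

abbreviation ENeg :: "expr \<Rightarrow> expr" where "ENeg e \<equiv> EMul (EConst (- 1)) e"

primrec d1 :: "expr \<Rightarrow> expr" where
  "d1 ELam = EConst 1"
| "d1 ELamb = EConst 0"
| "d1 EInvLam = ENeg (EMul EInvLam EInvLam)"
| "d1 EInvLamb = EConst 0"
| "d1 EInvW = ENeg (EMul EInvW EInvW)"
| "d1 ELogP = EAdd EInvW (ENeg EInvLam)"
| "d1 ELogR = EInvW"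
| "d1 (EConst c) = EConst 0"
| "d1 (EAdd e f) = EAdd (d1 e) (d1 f)"
| "d1 (EMul e f) = EAdd (EMul (d1 e) f) (EMul e (d1 f))"

primrec d2 :: "expr \<Rightarrow> expr" where
  "d2 ELam = EConst 0"
| "d2 ELamb = EConst 1"
| "d2 EInvLam = EConst 0"
| "d2 EInvLamb = ENeg (EMul EInvLamb EInvLamb)"
| "d2 EInvW = ENeg (EMul EInvW EInvW)"
| "d2 ELogP = EInvW"
| "d2 ELogR = EAdd EInvLamb EInvW"
| "d2 (EConst c) = EConst 0"
| "d2 (EAdd e f) = EAdd (d2 e) (d2 f)"
| "d2 (EMul e f) = EAdd (EMul (d2 e) f) (EMul e (d2 f))"

text \<open>Closedness of the form \<open>A dlam + B dlamb\<close>. It is checked on the atoms,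
  whose formal derivatives are those of genuine functions of two variables, and the product rule
  preserves it. The cancellation in \<open>bracket_evA\<close> rests on it.\<close>

lemma ev_d1_d2: "ev (d1 (d2 e)) l b P R = ev (d2 (d1 e)) l b P R"
  by (induction e) (simp_all add: algebra_simps)

primrec epow :: "expr \<Rightarrow> nat \<Rightarrow> expr" where
  "epow e 0 = EConst 1"
| "epow e (Suc n) = EMul e (epow e n)"

lemma ev_epow: "ev (epow e n) l b P R = ev e l b P R ^ n"
  by (induction n) auto

lemma ev_d1_epow: "ev (d1 (epow e n)) l b P R = of_nat n * ev e l b P R ^ (n - 1) * ev (d1 e) l b P R"
proof (induction n)
  case (Suc n)
  then show ?case by (cases n) (simp_all add: ev_epow algebra_simps)
qed simp

lemma ev_d2_epow: "ev (d2 (epow e n)) l b P R = of_nat n * ev e l b P R ^ (n - 1) * ev (d2 e) l b P R"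
proof (induction n)
  case (Suc n)
  then show ?case by (cases n) (simp_all add: ev_epow algebra_simps)
qed simp

lemma ev_has_vector_derivative:
  fixes l b P R :: "real \<Rightarrow> complex"
  assumes l: "(l has_vector_derivative l') (at t)" and b: "(b has_vector_derivative b') (at t)"
    and P: "(P has_vector_derivative (l' + b') / (l t + b t) - l' / l t) (at t)"
    and R: "(R has_vector_derivative b' / b t + (l' + b') / (l t + b t)) (at t)"
    and nz: "l t \<noteq> 0" "b t \<noteq> 0" "l t + b t \<noteq> 0"
  shows "((\<lambda>t. ev e (l t) (b t) (P t) (R t)) has_vector_derivative
     ev (d1 e) (l t) (b t) (P t) (R t) * l' + ev (d2 e) (l t) (b t) (P t) (R t) * b') (at t)"
proof -
  have inv: "((\<lambda>t. inverse (f t)) has_vector_derivative - (inverse (f t) * inverse (f t) * f')) (at t)"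
    if "(f has_vector_derivative f') (at t)" "f t \<noteq> 0" for f :: "real \<Rightarrow> complex" and f'
    using field_vector_diff_chain_at[OF that(1) DERIV_inverse[OF that(2)]]
    by (simp add: o_def mult_ac)
  show ?thesis
  proof (induction e)
    case EInvW
    show ?case using inv[OF has_vector_derivative_add[OF l b]] nz by (simp add: algebra_simps)
  next
    case ELogP
    show ?case using P by (simp add: divide_inverse algebra_simps)
  next
    case ELogR
    show ?case using R by (simp add: divide_inverse algebra_simps)
  next
    case (EAdd e f)
    from has_vector_derivative_add[OF EAdd] show ?case by (simp add: algebra_simps)
  next
    case (EMul e f)
    from has_vector_derivative_mult[OF EMul] show ?case by (simp add: algebra_simps)
  qed (use l b inv[OF l] inv[OF b] nz in \<open>simp_all add: has_vector_derivative_const\<close>)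
qed

lemma ev_has_field_derivative:
  fixes l b P R :: "complex \<Rightarrow> complex"
  assumes l: "(l has_field_derivative l') (at t)" and b: "(b has_field_derivative b') (at t)"
    and P: "(P has_field_derivative (l' + b') / (l t + b t) - l' / l t) (at t)"
    and R: "(R has_field_derivative b' / b t + (l' + b') / (l t + b t)) (at t)"
    and nz: "l t \<noteq> 0" "b t \<noteq> 0" "l t + b t \<noteq> 0"
  shows "((\<lambda>t. ev e (l t) (b t) (P t) (R t)) has_field_derivative
     ev (d1 e) (l t) (b t) (P t) (R t) * l' + ev (d2 e) (l t) (b t) (P t) (R t) * b') (at t)"
proof -
  have inv: "((\<lambda>t. inverse (f t)) has_field_derivative - (inverse (f t) * inverse (f t) * f')) (at t)"
    if "(f has_field_derivative f') (at t)" "f t \<noteq> 0" for f :: "complex \<Rightarrow> complex" and f'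
    using DERIV_inverse'[OF that] by (simp add: mult_ac)
  show ?thesis
  proof (induction e)
    case EInvW
    show ?case using inv[OF DERIV_add[OF l b]] nz by (simp add: algebra_simps)
  next
    case ELogP
    show ?case using P by (simp add: divide_inverse algebra_simps)
  next
    case ELogR
    show ?case using R by (simp add: divide_inverse algebra_simps)
  next
    case (EAdd e f)
    from DERIV_add[OF EAdd] show ?case by (simp add: algebra_simps)
  next
    case (EMul e f)
    from DERIV_mult[OF EMul] show ?case by (simp add: algebra_simps)
  qed (use l b inv[OF l] inv[OF b] nz in \<open>simp_all\<close>)
qed

lemma continuous_on_ev:
  assumes "continuous_on S l" "continuous_on S b" "continuous_on S P" "continuous_on S R"
    "\<And>s. s \<in> S \<Longrightarrow> l s \<noteq> 0" "\<And>s. s \<in> S \<Longrightarrow> b s \<noteq> 0" "\<And>s. s \<in> S \<Longrightarrow> l s + b s \<noteq> 0"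
  shows "continuous_on S (\<lambda>s. ev e (l s) (b s) (P s) (R s))"
  by (induction e) (use assms in \<open>auto intro!: continuous_intros\<close>)

lemma sm_ev:
  assumes "sm D l" "sm D b" "sm D P" "sm D R"
    "\<And>x z. z \<in> D \<Longrightarrow> l x z \<noteq> 0" "\<And>x z. z \<in> D \<Longrightarrow> b x z \<noteq> 0" "\<And>x z. z \<in> D \<Longrightarrow> l x z + b x z \<noteq> 0"
  shows "sm D (\<lambda>x z. ev e (l x z) (b x z) (P x z) (R x z))"
  by (induction e) (simp_all add: assms sm_add sm_mult sm_inverse sm_const)

definition ewpow :: "int \<Rightarrow> expr" where
  "ewpow k = (if k \<ge> 0 then epow (EAdd ELam ELamb) (nat k) else epow EInvW (nat (- k)))"

lemma ev_ewpow: "ev (ewpow k) l b P R = (l + b) powi k"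
  by (simp add: ewpow_def ev_epow power_int_def power_inverse)

text \<open>A function of w alone is annihilated by \<open>d2 - d1\<close>; in the densities with
  power of w, only the factor in \<open>lamb - lam\<close> contributes to Q.\<close>

lemma ev_ewpow_d: "ev (d1 (ewpow k)) l b P R = ev (d2 (ewpow k)) l b P R"
  by (simp add: ewpow_def ev_d1_epow ev_d2_epow)

text \<open>The potential \<open>texp a q\<close> has circle mean \<open>theta_coeff a q\<close>.\<close>

abbreviation es :: expr where "es \<equiv> EAdd ELamb (ENeg ELam)"

fun texp :: "idx \<Rightarrow> nat \<Rightarrow> expr" where
  "texp (Z a) q = (if a = -1
     then EAdd (EMul (EMul (EConst (- 1 / fact q)) (epow (ENeg ELam) q)) (EAdd ELogP (EConst (harm q - 1))))
            (EMul (EConst (- 1 / (2 ^ q * fact q))) (epow es q))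
     else EMul (EConst (- 1 / (of_int (a + 1) * (2 ^ q * fact q)))) (EMul (ewpow (a + 1)) (epow es q)))"
| "texp V q = EAdd (EMul (EMul (EConst (- 1 / fact q)) (epow (ENeg ELam) q)) (EAdd ELogP (EConst (harm q - 1))))
            (EMul (EMul (EConst (1 / fact q)) (epow ELamb q)) (EAdd ELogR (EConst (- harm q - 1))))"
| "texp U q = EMul (EConst (1 / fact (q + 1))) (epow ELamb (q + 1))"

text \<open>The index is \<open>Suc p\<close> because the Hamiltonian numbered p has the density of
  order \<open>p + 1\<close>; \<open>d2 - d1\<close> lowers the degree by one and so returns to
  \<open>Q a p\<close>, see \<open>ev_qexp\<close>.\<close>

definition qexp :: "idx \<Rightarrow> nat \<Rightarrow> expr" where
  "qexp a p = EAdd (d2 (texp a (Suc p))) (ENeg (d1 (texp a (Suc p))))"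

text \<open>\<open>d2 - d1\<close> takes \<open>lamb - lam\<close> to 2. This factor is absorbed by
  the step from \<open>2 ^ Suc p\<close> to \<open>2 ^ p\<close> in the double factorial.\<close>

lemma ev_es_part:
  "ev (d2 (EMul (EConst c) (epow es (Suc p)))) l b P R - ev (d1 (EMul (EConst c) (epow es (Suc p)))) l b P R
     = 2 * c * of_nat (Suc p) * (b - l) ^ p"
  by (simp add: ev_epow ev_d1_epow ev_d2_epow algebra_simps del: epow.simps(2))

lemma ev_power_part:
  "ev (d2 (EMul (EMul (EConst c) (epow e (Suc p))) g)) l b P R - ev (d1 (EMul (EMul (EConst c) (epow e (Suc p))) g)) l b P R
     = c * (of_nat (Suc p) * ev e l b P R ^ p * (ev (d2 e) l b P R - ev (d1 e) l b P R) * ev g l b P R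
        + ev e l b P R ^ Suc p * (ev (d2 g) l b P R - ev (d1 g) l b P R))"
  by (simp add: ev_epow ev_d1_epow ev_d2_epow algebra_simps del: epow.simps(2) power_Suc of_nat_Suc)

text \<open>Under \<open>d2 - d1\<close> the logarithm yields \<open>1 / lam\<close>, and the
  resulting term cancels exactly the summand \<open>1 / (p + 1)\<close> by which
  \<open>harm (Suc p)\<close> exceeds \<open>harm p\<close>.\<close>

lemma ev_logP_part:
  assumes "l \<noteq> 0"
  shows "ev (d2 (EMul (EMul (EConst (- 1 / fact (Suc p))) (epow (ENeg ELam) (Suc p))) (EAdd ELogP (EConst (harm (Suc p) - 1))))) l b P R
    - ev (d1 (EMul (EMul (EConst (- 1 / fact (Suc p))) (epow (ENeg ELam) (Suc p))) (EAdd ELogP (EConst (harm (Suc p) - 1))))) l b P R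
    = - ((- l) ^ p / fact p) * (P + harm p - 1)"
proof -
  define n :: complex where "n = of_nat (Suc p)"
  have n: "n \<noteq> 0" "fact (Suc p) = n * fact p" "harm (Suc p) = harm p + inverse n"
    unfolding n_def using of_nat_neq_0 by (auto simp: harm_Suc)
  define X where "X = (- l) ^ p"
  define F :: complex where "F = fact p"
  define H :: complex where "H = harm p"
  have F: "F \<noteq> 0" by (simp add: F_def)
  have 1: "(- l) ^ Suc p = - l * X" by (simp add: X_def)
  have "ev (d2 (EMul (EMul (EConst (- 1 / fact (Suc p))) (epow (ENeg ELam) (Suc p))) (EAdd ELogP (EConst (harm (Suc p) - 1))))) l b P R
    - ev (d1 (EMul (EMul (EConst (- 1 / fact (Suc p))) (epow (ENeg ELam) (Suc p))) (EAdd ELogP (EConst (harm (Suc p) - 1))))) l b P R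
    = (- 1 / fact (Suc p)) * (of_nat (Suc p) * (- l) ^ p * (P + (harm (Suc p) - 1)) + (- l) ^ Suc p * inverse l)"
    unfolding ev_power_part by (simp del: fact_Suc power_Suc of_nat_Suc)
  also have "\<dots> = (- 1 / (n * F)) * (n * X * (P + (H + inverse n - 1)) + (- l * X) * inverse l)"
    unfolding 1 n(2,3) X_def F_def H_def by (simp add: n_def)
  also have "\<dots> = - (X / F) * (P + H - 1)"
    using n F assms by (simp add: field_simps)
  finally show ?thesis by (simp add: X_def F_def H_def)
qed

text \<open>The same cancellation, now with \<open>1 / lamb\<close>; its sign is the reason why the
  harmonic number enters negatively here.\<close>

lemma ev_logR_part:
  assumes "b \<noteq> 0"
  shows "ev (d2 (EMul (EMul (EConst (1 / fact (Suc p))) (epow ELamb (Suc p))) (EAdd ELogR (EConst (- harm (Suc p) - 1))))) l b P R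
    - ev (d1 (EMul (EMul (EConst (1 / fact (Suc p))) (epow ELamb (Suc p))) (EAdd ELogR (EConst (- harm (Suc p) - 1))))) l b P R
    = b ^ p / fact p * (R - harm p - 1)"
proof -
  define n :: complex where "n = of_nat (Suc p)"
  have n: "n \<noteq> 0" "fact (Suc p) = n * fact p" "harm (Suc p) = harm p + inverse n"
    unfolding n_def using of_nat_neq_0 by (auto simp: harm_Suc)
  define X where "X = b ^ p"
  define F :: complex where "F = fact p"
  define H :: complex where "H = harm p"
  have F: "F \<noteq> 0" by (simp add: F_def)
  have 1: "b ^ Suc p = b * X" by (simp add: X_def)
  have "ev (d2 (EMul (EMul (EConst (1 / fact (Suc p))) (epow ELamb (Suc p))) (EAdd ELogR (EConst (- harm (Suc p) - 1))))) l b P R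
    - ev (d1 (EMul (EMul (EConst (1 / fact (Suc p))) (epow ELamb (Suc p))) (EAdd ELogR (EConst (- harm (Suc p) - 1))))) l b P R
    = (1 / fact (Suc p)) * (of_nat (Suc p) * b ^ p * (R + (- harm (Suc p) - 1)) + b ^ Suc p * inverse b)"
    unfolding ev_power_part by (simp del: fact_Suc power_Suc of_nat_Suc)
  also have "\<dots> = (1 / (n * F)) * (n * X * (R + (- (H + inverse n) - 1)) + (b * X) * inverse b)"
    unfolding 1 n(2,3) X_def F_def H_def by (simp add: n_def)
  also have "\<dots> = X / F * (R - H - 1)"
    using n F assms by (simp add: field_simps)
  finally show ?thesis by (simp add: X_def F_def H_def)
qed

lemma ev_qexp:
  assumes "lam m z \<noteq> 0" "lamb m z \<noteq> 0"
  shows "ev (qexp a p) (lam m z) (lamb m z) (log1p m z) (log_lamb_w m z) = Q a p m z"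
proof -
  have n: "(of_nat (Suc p) :: complex) \<noteq> 0" "(fact (Suc p) :: complex) = of_nat (Suc p) * fact p"
    using of_nat_neq_0 by auto
  have c: "2 * (- 1 / (2 ^ Suc p * fact (Suc p))) * of_nat (Suc p) * x = - x / (2 ^ p * fact p)" for x :: complex
    unfolding n(2) using n(1) by (simp add: field_simps del: of_nat_Suc)
  have q: "ev (qexp a p) l b P R = ev (d2 (texp a (Suc p))) l b P R - ev (d1 (texp a (Suc p))) l b P R" for l b P R
    by (simp add: qexp_def)
  have dadd: "ev (d2 (EAdd e f)) l b P R - ev (d1 (EAdd e f)) l b P R =
     (ev (d2 e) l b P R - ev (d1 e) l b P R) + (ev (d2 f) l b P R - ev (d1 f) l b P R)" for e f l b P R
    by simp
  show ?thesis
  proof (cases a)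
    case (Z i)
    show ?thesis
    proof (cases "i = -1")
      case True
      then show ?thesis unfolding q unfolding Z
        by (simp only: texp.simps if_True simp_thms dadd ev_logP_part[OF assms(1)] ev_es_part c Q.simps)
           (simp add: divide_inverse)
    next
      case False
      then have i: "(of_int (i + 1) :: complex) \<noteq> 0" by (metis add.commute add_eq_0_iff of_int_eq_0_iff)
      have "ev (d2 (texp (Z i) (Suc p))) l b P R - ev (d1 (texp (Z i) (Suc p))) l b P R
        = (l + b) powi (i + 1) / of_int (i + 1) * (2 * (- 1 / (2 ^ Suc p * fact (Suc p))) * of_nat (Suc p) * (b - l) ^ p)" for l b P R
        using False
        by (simp add: ev_epow ev_d1_epow ev_d2_epow ev_ewpow ev_ewpow_d algebra_simps del: epow.simps(2) fact_Suc power_Suc of_nat_Suc of_int_add)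
      then show ?thesis unfolding q unfolding Z c using False
        by (simp add: wfun_def)
    qed
  next
    case V
    then show ?thesis unfolding q unfolding V
      by (simp only: texp.simps dadd ev_logP_part[OF assms(1)] ev_logR_part[OF assms(2)] Q.simps)
  next
    case U
    have "ev (d2 (texp U (Suc p))) l b P R - ev (d1 (texp U (Suc p))) l b P R
      = 1 / fact (Suc (Suc p)) * (of_nat (Suc (Suc p)) * b ^ Suc p)" for l b P R
      by (simp add: ev_epow ev_d1_epow ev_d2_epow del: epow.simps(2) fact_Suc power_Suc of_nat_Suc)
    also have "\<dots> b = b ^ (p + 1) / fact (p + 1)" for b :: complex
      unfolding fact_Suc[of "Suc p"] using of_nat_neq_0[of "Suc p", where 'a = complex]
      by (simp del: fact_Suc power_Suc of_nat_Suc)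
    finally show ?thesis unfolding q unfolding U by simp
  qed
qed

section \<open>Generating series of the densities\<close>

lemma exp_sums: "(\<lambda>n. y ^ n / fact n) sums exp (y::complex)"
  using exp_converges[of y] by (simp add: scaleR_conv_of_real divide_inverse mult.commute)

lemma power_over_fact_le_exp: "(x::real) \<ge> 0 \<Longrightarrow> x ^ n / fact n \<le> exp x"
  using sum_le_suminf[OF summable_exp[of x], of "{n}"]
  by (simp add: exp_def divide_inverse mult.commute)

text \<open>The bound C is uniform in the order q, so for \<open>|\<zeta>| < 1\<close> the series is
  dominated by a geometric one and may be averaged term by term. Uniqueness of power series then
  identifies the coefficients.\<close>

lemma theta_coeff_cint:
  assumes c: "\<And>q. continuous_on circle (c q)" and bd: "\<And>q z. z \<in> circle \<Longrightarrow> norm (c q z) \<le> C"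
    and s: "\<And>\<zeta> z. norm \<zeta> < 1 \<Longrightarrow> z \<in> circle \<Longrightarrow> (\<lambda>q. c q z * \<zeta> ^ q) sums \<Phi> \<zeta> z"
    and th: "\<And>\<zeta>. \<theta> \<zeta> = cint (\<Phi> \<zeta>)"
  shows "fps_nth (fps_expansion \<theta> 0) n = cint (c n)"
proof -
  have "(\<lambda>q. cint (c q) * \<zeta> ^ q) sums \<theta> \<zeta>" if "norm \<zeta> < 1" for \<zeta>
  proof -
    let ?f = "\<lambda>n t. \<Sum>q<n. c q (circlepath 0 1 t) * \<zeta> ^ q"
    have u: "uniform_limit {0..1} ?f (\<lambda>t. \<Sum>q. c q (circlepath 0 1 t) * \<zeta> ^ q) sequentially"
    proof (rule Weierstrass_m_test)
      show "norm (c q (circlepath 0 1 t) * \<zeta> ^ q) \<le> C * norm \<zeta> ^ q" for q t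
        unfolding norm_mult norm_power by (intro mult_right_mono bd circlepath_in_circle) auto
      show "summable (\<lambda>q. C * norm \<zeta> ^ q)" using that by (intro summable_mult summable_geometric) auto
    qed
    have cc: "continuous_on {0..1} (?f n)" for n
      by (intro continuous_intros continuous_on_circle_path c)
    obtain I J where IJ: "\<And>n. (?f n has_integral I n) {0..1}"
      "((\<lambda>t. \<Sum>q. c q (circlepath 0 1 t) * \<zeta> ^ q) has_integral J) {0..1}" "I \<longlonglongrightarrow> J"
      using uniform_limit_integral[OF u cc] by auto
    have "(?f n has_integral (\<Sum>q<n. cint (c q) * \<zeta> ^ q)) {0..1}" for n
      unfolding cint_integral
      by (intro has_integral_sum has_integral_mult_left integrable_integral cint_integrable c) auto
    then have "I = (\<lambda>n. \<Sum>q<n. cint (c q) * \<zeta> ^ q)"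
      using has_integral_unique[OF IJ(1)] by blast
    moreover have "(\<Sum>q. c q (circlepath 0 1 t) * \<zeta> ^ q) = \<Phi> \<zeta> (circlepath 0 1 t)" for t
      using s[OF that circlepath_in_circle] by (simp add: sums_iff)
    then have "J = \<theta> \<zeta>" using IJ(2) by (simp add: th cint_integral integral_unique)
    ultimately show ?thesis using IJ(3) by (simp add: sums_def)
  qed
  then have "\<theta> has_fps_expansion Abs_fps (\<lambda>q. cint (c q))"
    by (intro has_fps_expansionI eventually_nhds_in_nhd[THEN eventually_mono, of 0 "ball 0 1"]) auto
  then have "fps_expansion \<theta> 0 = Abs_fps (\<lambda>q. cint (c q))"
    by (intro fps_expansion_eqI)
  then show ?thesis by simp
qed

text \<open>Origin of the harmonic numbers. The series E of Ein satisfies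
  \<open>y E' = 1 - exp (- y)\<close>, so \<open>G = exp y E\<close> satisfies
  \<open>y G' = y G + exp y - 1\<close>. Comparing coefficients gives
  \<open>(n+1) g_(n+1) = g_n + 1 / (n+1)!\<close>, which is the recursion of
  \<open>harm n / fact n\<close>.\<close>

lemma fps_exp_Ein:
  "fps_nth (fps_exp (1::complex) * Abs_fps (\<lambda>k. if k = 0 then 0 else - ((- 1) ^ k / (fact k * of_nat k)))) n = harm n / fact n"
proof -
  define E where "E = Abs_fps (\<lambda>k. if k = 0 then 0 else - ((- 1) ^ k / (fact k * of_nat k)) :: complex)"
  define G where "G = fps_exp 1 * E"
  have "fps_X * fps_deriv E = 1 - fps_exp (- 1)"
  proof (rule fps_ext)
    fix n show "fps_nth (fps_X * fps_deriv E) n = fps_nth (1 - fps_exp (- 1)) n"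
      by (cases n) (auto simp: E_def fps_X_mult_nth simp del: fact_Suc of_nat_Suc)
  qed
  then have "fps_exp 1 * (fps_X * fps_deriv E) = fps_exp 1 - (1 :: complex fps)"
    by (simp add: right_diff_distrib flip: fps_exp_add_mult)
  moreover have "fps_deriv G = G + fps_exp 1 * fps_deriv E" by (simp add: G_def)
  ultimately have d: "fps_X * fps_deriv G = fps_X * G + fps_exp 1 - 1" by (simp add: algebra_simps)
  have "fps_nth G n = harm n / fact n"
  proof (induction n)
    case 0
    then show ?case by (simp add: G_def E_def harm_def)
  next
    case (Suc n)
    have "fps_nth (fps_X * fps_deriv G) (Suc n) = fps_nth (fps_X * G + fps_exp 1 - 1) (Suc n)" by (simp add: d)
    then have "of_nat (Suc n) * fps_nth G (Suc n) = fps_nth G n + 1 / fact (Suc n)"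
      by (simp add: fps_X_mult_nth del: fact_Suc of_nat_Suc)
    moreover have "a = (h + inverse n) / (n * F)" if "n * a = h / F + 1 / (n * F)" "n \<noteq> 0" "F \<noteq> 0" for a h n F :: complex
      using that by (simp add: field_simps)
    ultimately show ?case
      unfolding harm_Suc Suc.IH fact_Suc using of_nat_neq_0[of n, where 'a = complex] by (simp del: of_nat_Suc)
  qed
  then show ?thesis by (simp add: G_def E_def)
qed

lemma Ein_summable: "summable (\<lambda>k. norm (if k = 0 then 0 else - ((- y) ^ k / (fact k * of_nat k)) :: complex))"
proof (rule summable_comparison_test')
  show "summable (\<lambda>k. norm y ^ k / fact k)"
    using summable_exp[of "norm y"] by (simp add: divide_inverse mult.commute)
  show "norm (norm (if k = 0 then 0 else - ((- y) ^ k / (fact k * of_nat k)))) \<le> norm y ^ k / fact k" if "k \<ge> 0" for k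
    by (auto simp: norm_divide norm_mult norm_power intro!: divide_left_mono)
qed

lemma exp_Ein_sums: "(\<lambda>q. harm q * y ^ q / fact q) sums (exp y * Ein y)"
proof -
  let ?a = "\<lambda>k. y ^ k / fact k :: complex" and ?b = "\<lambda>k. if k = 0 then 0 else - ((- y) ^ k / (fact k * of_nat k)) :: complex"
  have sb: "summable ?b" by (rule summable_norm_cancel[OF Ein_summable])
  have "suminf ?b = (\<Sum>n. ?b (Suc n))"
    using suminf_split_head[OF sb] by simp
  also have "\<dots> = (\<Sum>n. - ((- y) ^ Suc n / (fact (Suc n) * of_nat (Suc n))))" by simp
  also have "\<dots> = Ein y"
    unfolding Ein_def
  proof (rule suminf_minus)
    have "summable (\<lambda>n. ?b (Suc n))" using sb by (subst summable_Suc_iff)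
    then have "summable (\<lambda>n. - ?b (Suc n))" by (rule summable_minus)
    then show "summable (\<lambda>n. (- y) ^ Suc n / (fact (Suc n) * of_nat (Suc n)))" by simp
  qed
  finally have b: "suminf ?b = Ein y" .
  have "(\<lambda>k. \<Sum>i\<le>k. ?a i * ?b (k - i)) sums ((\<Sum>k. ?a k) * (\<Sum>k. ?b k))"
  proof (rule Cauchy_product_sums[OF _ Ein_summable])
    show "summable (\<lambda>k. norm (?a k))"
      using summable_exp[of "norm y"] by (simp add: norm_divide norm_power) (simp add: divide_inverse mult.commute)
  qed
  \<comment> \<open>The inner sum of the Cauchy product is homogeneous of degree k in y, so its
    coefficient is the formal one of \<open>fps_exp_Ein\<close>.\<close>
  moreover have "(\<Sum>i\<le>k. ?a i * ?b (k - i)) = harm k * y ^ k / fact k" for k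
  proof -
    have "(\<Sum>i\<le>k. ?a i * ?b (k - i)) = y ^ k * (\<Sum>i=0..k. (1 / fact i) * (if k - i = 0 then 0 else - ((- 1) ^ (k - i) / (fact (k - i) * of_nat (k - i)))))"
      unfolding sum_distrib_left atMost_atLeast0
    proof (rule sum.cong)
      fix i assume "i \<in> {0..k}"
      then have "y ^ k = y ^ i * y ^ (k - i)" by (simp flip: power_add)
      moreover have "(- y) ^ (k - i) = (- 1) ^ (k - i) * y ^ (k - i)" by (rule power_minus)
      ultimately show "?a i * ?b (k - i) = y ^ k * ((1 / fact i) * (if k - i = 0 then 0 else - ((- 1) ^ (k - i) / (fact (k - i) * of_nat (k - i)))))"
        by simp
    qed simp
    also have "\<dots> = y ^ k * (harm k / fact k)"
      using fps_exp_Ein[of k] by (simp add: fps_mult_nth)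
    finally show ?thesis by simp
  qed
  ultimately show ?thesis using exp_sums[of y] b by (simp add: sums_iff)
qed

lemma log_series:
  "(\<lambda>q. (x ^ q / fact q * (g + harm q)) * \<zeta> ^ q) sums (exp (x * \<zeta>) * (g + Ein (x * \<zeta>)))"
  "(\<lambda>q. (x ^ q / fact q * (g - harm q)) * \<zeta> ^ q) sums (exp (x * \<zeta>) * (g - Ein (x * \<zeta>)))"
  using sums_add[OF sums_mult[OF exp_sums[of "x * \<zeta>"], of g] exp_Ein_sums[of "x * \<zeta>"]]
    sums_diff[OF sums_mult[OF exp_sums[of "x * \<zeta>"], of g] exp_Ein_sums[of "x * \<zeta>"]]
  by (simp_all add: algebra_simps add_divide_distrib diff_divide_distrib power_mult_distrib)

lemma norm_power_fact_le:
  assumes "norm x \<le> M"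
  shows "norm (x ^ q / fact q :: complex) \<le> exp M"
proof -
  have "0 \<le> M" using assms norm_ge_zero order_trans by blast
  have "norm (x ^ q / fact q) \<le> M ^ q / fact q"
    using assms by (auto simp: norm_divide norm_power intro!: divide_right_mono power_mono)
  also have "\<dots> \<le> exp M" using \<open>0 \<le> M\<close> by (rule power_over_fact_le_exp)
  finally show ?thesis .
qed

text \<open>The harmonic number is at most \<open>2 ^ q\<close>, which turns
  \<open>M ^ q / fact q\<close> into a term of \<open>exp (2 * M)\<close>; the bound is therefore
  independent of q, as \<open>theta_coeff_cint\<close> demands. The unimodular s stands for the sign
  with which the harmonic number enters each logarithmic term.\<close>

lemma norm_log_part_le:
  fixes x g s :: complex
  assumes "norm x \<le> M" "norm g \<le> M" "norm s = 1"
  shows "norm (x ^ q / fact q * (g + s * harm q - 1)) \<le> exp M * (M + 1) + exp (2 * M)"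
proof -
  have M: "0 \<le> M" using assms(1) norm_ge_zero order_trans by blast
  have "norm (harm q :: complex) \<le> of_nat q"
  proof (induction q)
    case (Suc q)
    have "norm (harm (Suc q) :: complex) \<le> norm (harm q :: complex) + norm (inverse (of_nat (Suc q)) :: complex)"
      unfolding harm_Suc by (rule norm_triangle_ineq)
    also have "norm (inverse (of_nat (Suc q)) :: complex) = inverse (real (Suc q))"
      by (simp only: norm_inverse norm_of_nat)
    also have "\<dots> \<le> 1" by (simp add: field_simps)
    finally show ?case using Suc by simp
  qed (simp add: harm_def)
  also have "of_nat q \<le> (2 ^ q :: real)" by (metis less_exp less_imp_le of_nat_le_iff of_nat_numeral of_nat_power)
  finally have h: "norm (harm q :: complex) \<le> 2 ^ q" .
  have "norm (x ^ q / fact q * (g + s * harm q - 1)) \<le> norm (x ^ q / fact q * (g - 1)) + norm (x ^ q / fact q * (s * harm q))"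
  proof -
    have "c * (g + h - 1) = c * (g - 1) + c * h" for c h by (simp add: algebra_simps)
    then show ?thesis by (metis norm_triangle_ineq)
  qed
  also have "norm (x ^ q / fact q * (g - 1)) \<le> exp M * (M + 1)"
    unfolding norm_mult by (intro mult_mono norm_power_fact_le assms order_trans[OF norm_triangle_ineq4])
      (use assms M in auto)
  also have "norm (x ^ q / fact q * (s * harm q)) \<le> M ^ q / fact q * 2 ^ q"
    unfolding norm_mult using assms h M by (intro mult_mono) (auto simp: norm_divide norm_power intro!: divide_right_mono power_mono)
  also have "\<dots> = (2 * M) ^ q / fact q" by (simp add: power_mult_distrib mult.commute)
  also have "\<dots> \<le> exp (2 * M)" using M by (intro power_over_fact_le_exp) auto
  finally show ?thesis by simp
qed

lemma theta_coeff_texp: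
  assumes cont: "continuous_on circle (lam m)" "continuous_on circle (lamb m)"
      "continuous_on circle (log1p m)" "continuous_on circle (log_lamb_w m)"
    and nz: "\<And>z. z \<in> circle \<Longrightarrow> lam m z \<noteq> 0" "\<And>z. z \<in> circle \<Longrightarrow> lamb m z \<noteq> 0" "\<And>z. z \<in> circle \<Longrightarrow> wfun m z \<noteq> 0"
  shows "theta_coeff a q m = cint (\<lambda>z. ev (texp a q) (lam m z) (lamb m z) (log1p m z) (log_lamb_w m z))"
proof -
  have bex: "\<exists>M. \<forall>z\<in>circle. norm (f z) \<le> M" if "continuous_on circle f" for f :: "complex \<Rightarrow> complex"
    using compact_imp_bounded[OF compact_continuous_image[OF that]] unfolding bounded_iff by auto
  have cp: "continuous_on circle (\<lambda>z. wfun m z powi k)" for k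
    using nz(3) unfolding wfun_def by (intro continuous_intros cont) auto
  obtain M1 M2 M3 M4 where M': "\<And>z. z \<in> circle \<Longrightarrow> norm (lam m z) \<le> M1" "\<And>z. z \<in> circle \<Longrightarrow> norm (lamb m z) \<le> M2"
     "\<And>z. z \<in> circle \<Longrightarrow> norm (log1p m z) \<le> M3" "\<And>z. z \<in> circle \<Longrightarrow> norm (log_lamb_w m z) \<le> M4"
    using bex[OF cont(1)] bex[OF cont(2)] bex[OF cont(3)] bex[OF cont(4)] by metis
  obtain Wp where Wp: "\<And>k z. z \<in> circle \<Longrightarrow> norm (wfun m z powi k) \<le> Wp k"
    using bex[OF cp] by metis
  define M where "M = \<bar>M1\<bar> + \<bar>M2\<bar> + \<bar>M3\<bar> + \<bar>M4\<bar>"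
  have M: "norm (lam m z) \<le> M" "norm (lamb m z) \<le> M" "norm (log1p m z) \<le> M" "norm (log_lamb_w m z) \<le> M"
     "norm ((lamb m z - lam m z) / 2) \<le> M" if "z \<in> circle" for z
  proof -
    show "norm (lam m z) \<le> M" "norm (lamb m z) \<le> M" "norm (log1p m z) \<le> M" "norm (log_lamb_w m z) \<le> M"
      using M'[OF that] unfolding M_def by linarith+
    then show "norm ((lamb m z - lam m z) / 2) \<le> M"
      using norm_triangle_ineq4[of "lamb m z" "lam m z"] by (simp add: norm_divide)
  qed
  let ?K = "exp M * (M + 1) + exp (2 * M)"
  \<comment> \<open>The factor \<open>2 ^ q * fact q\<close> is the double factorial; it arises from
    expanding the exponential of one half of \<open>(lamb - lam) \<zeta>\<close>.\<close>
  have sp: "ev (epow es q) l b P R / (2 ^ q * fact q) = ((b - l) / 2) ^ q / fact q" for q l b P R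
    by (simp add: ev_epow power_divide)
  have cev: "continuous_on circle (\<lambda>z. ev e (lam m z) (lamb m z) (log1p m z) (log_lamb_w m z))" for e
    by (rule continuous_on_ev) (use cont nz wfun_def in auto)
  have es0: "(\<lambda>q. c ^ q / fact q * \<zeta> ^ q) sums exp (c * \<zeta>)" for c \<zeta> :: complex
    using exp_sums[of "c * \<zeta>"] by (simp add: power_mult_distrib)
  have es: "(\<lambda>q. ((b - l) / 2) ^ q / fact q * \<zeta> ^ q) sums exp ((b - l) / 2 * \<zeta>)" for b l \<zeta> :: complex
    by (rule es0)
  show ?thesis
  proof (cases a)
    case (Z i)
    show ?thesis
    proof (cases "i = -1")
      case True
      have e: "ev (texp a q) l b P R = - ((- l) ^ q / fact q * (P - 1 + harm q)) - ((b - l) / 2) ^ q / fact q" for q l b P R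
        unfolding Z True using sp[of q l b P R] by (simp add: ev_epow algebra_simps)
      show ?thesis unfolding theta_coeff_def
      proof (rule theta_coeff_cint[OF cev])
        show "norm (ev (texp a q) (lam m z) (lamb m z) (log1p m z) (log_lamb_w m z)) \<le> ?K + exp M" if "z \<in> circle" for q z
          unfolding e using norm_log_part_le[of "- lam m z" M "log1p m z" 1 q] norm_power_fact_le[OF M(5)[OF that], of q] M[OF that]
          by (intro order_trans[OF norm_triangle_ineq4] add_mono) (auto simp: algebra_simps)
        show "theta a m \<zeta> = cint (\<lambda>z. - (exp (- lam m z * \<zeta>) * (log1p m z - 1 + Ein (- lam m z * \<zeta>))) - exp ((lamb m z - lam m z) / 2 * \<zeta>))" for \<zeta>
          unfolding Z True by (simp add: algebra_simps flip: cint_uminus)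
        show "(\<lambda>q. ev (texp a q) (lam m z) (lamb m z) (log1p m z) (log_lamb_w m z) * \<zeta> ^ q) sums
          (- (exp (- lam m z * \<zeta>) * (log1p m z - 1 + Ein (- lam m z * \<zeta>))) - exp ((lamb m z - lam m z) / 2 * \<zeta>))" for \<zeta> z
          unfolding e left_diff_distrib minus_mult_left[symmetric] 
          by (intro sums_diff sums_minus es) (use log_series(1)[of "- lam m z" "log1p m z - 1" \<zeta>] in simp)
      qed
    next
      case False
      have e: "ev (texp a q) l b P R = - ((l + b) powi (i + 1) / of_int (i + 1)) * (((b - l) / 2) ^ q / fact q)" for q l b P R
        unfolding Z using False sp[of q l b P R] by (simp add: ev_ewpow field_simps del: of_int_add)
      show ?thesis unfolding theta_coeff_def
      proof (rule theta_coeff_cint[OF cev])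
        show "norm (ev (texp a q) (lam m z) (lamb m z) (log1p m z) (log_lamb_w m z)) \<le> Wp (i + 1) / norm (of_int (i + 1) :: complex) * exp M" if "z \<in> circle" for q z
          unfolding e norm_mult norm_minus_cancel
          using norm_power_fact_le[OF M(5)[OF that], of q] Wp[OF that, of "i + 1"] order_trans[OF norm_ge_zero Wp[OF that, of "i + 1"]]
          by (intro mult_mono) (auto simp: norm_divide wfun_def simp del: of_int_add intro!: divide_right_mono)
        show "theta a m \<zeta> = cint (\<lambda>z. - (wfun m z powi (i + 1) / of_int (i + 1)) * exp ((lamb m z - lam m z) / 2 * \<zeta>))" for \<zeta>
          unfolding Z using False by (simp flip: cint_uminus)
        show "(\<lambda>q. ev (texp a q) (lam m z) (lamb m z) (log1p m z) (log_lamb_w m z) * \<zeta> ^ q) sums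
          (- (wfun m z powi (i + 1) / of_int (i + 1)) * exp ((lamb m z - lam m z) / 2 * \<zeta>))" for \<zeta> z
          unfolding e wfun_def mult.assoc by (intro sums_mult es)
      qed
    qed
  next
    case V
    have e: "ev (texp a q) l b P R = - ((- l) ^ q / fact q * (P - 1 + harm q)) + b ^ q / fact q * (R - 1 - harm q)" for q l b P R
      unfolding V by (simp add: ev_epow algebra_simps)
    show ?thesis unfolding theta_coeff_def
    proof (rule theta_coeff_cint[OF cev])
      show "norm (ev (texp a q) (lam m z) (lamb m z) (log1p m z) (log_lamb_w m z)) \<le> ?K + ?K" if "z \<in> circle" for q z
        unfolding e using norm_log_part_le[of "- lam m z" M "log1p m z" 1 q] norm_log_part_le[of "lamb m z" M "log_lamb_w m z" "- 1" q] M[OF that]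
        by (intro order_trans[OF norm_triangle_ineq] add_mono) (auto simp: algebra_simps)
      show "theta a m \<zeta> = cint (\<lambda>z. - (exp (- lam m z * \<zeta>) * (log1p m z - 1 + Ein (- lam m z * \<zeta>)))
          + exp (lamb m z * \<zeta>) * (log_lamb_w m z - 1 - Ein (lamb m z * \<zeta>)))" for \<zeta>
        unfolding V by (simp add: algebra_simps)
      show "(\<lambda>q. ev (texp a q) (lam m z) (lamb m z) (log1p m z) (log_lamb_w m z) * \<zeta> ^ q) sums
        (- (exp (- lam m z * \<zeta>) * (log1p m z - 1 + Ein (- lam m z * \<zeta>)))
          + exp (lamb m z * \<zeta>) * (log_lamb_w m z - 1 - Ein (lamb m z * \<zeta>)))" for \<zeta> z
        unfolding e distrib_right minus_mult_left[symmetric] 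
        by (intro sums_add sums_minus log_series(2)) (use log_series(1)[of "- lam m z" "log1p m z - 1" \<zeta>] in simp)
    qed
  next
    case U
    have e: "ev (texp a q) l b P R = b * (b ^ q / fact (Suc q))" for q l b P R
      unfolding U by (simp add: ev_epow del: fact_Suc)
    show ?thesis unfolding theta_coeff_def
    proof (rule theta_coeff_cint[OF cev])
      show "norm (ev (texp a q) (lam m z) (lamb m z) (log1p m z) (log_lamb_w m z)) \<le> M * exp M" if "z \<in> circle" for q z
      proof -
        have "norm (lamb m z ^ q / fact (Suc q)) \<le> norm (lamb m z ^ q / fact q)"
          unfolding norm_divide norm_fact by (intro divide_left_mono fact_mono mult_pos_pos fact_gt_zero) auto
        also have "\<dots> \<le> exp M" by (rule norm_power_fact_le[OF M(2)[OF that]])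
        finally show ?thesis unfolding e norm_mult
          using M(2)[OF that] order_trans[OF norm_ge_zero M(2)[OF that]] by (intro mult_mono) auto
      qed
      show "theta a m \<zeta> = cint (\<lambda>z. if \<zeta> = 0 then lamb m z else (exp (lamb m z * \<zeta>) - 1) / \<zeta>)" for \<zeta>
        unfolding U by simp
      show "(\<lambda>q. ev (texp a q) (lam m z) (lamb m z) (log1p m z) (log_lamb_w m z) * \<zeta> ^ q) sums
        (if \<zeta> = 0 then lamb m z else (exp (lamb m z * \<zeta>) - 1) / \<zeta>)" for \<zeta> z
      proof (cases "\<zeta> = 0")
        case True
        then show ?thesis using powser_sums_zero[of "\<lambda>q. lamb m z * (lamb m z ^ q / fact (Suc q))"] unfolding e by simp
      next
        case False
        \<comment> \<open>Dropping the constant term of the exponential series shifts the index,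
          which accounts for \<open>fact (Suc q)\<close> in this potential.\<close>
        have "(\<lambda>q. (lamb m z * \<zeta>) ^ Suc q / fact (Suc q)) sums (exp (lamb m z * \<zeta>) - 1)"
          using exp_sums[of "lamb m z * \<zeta>"] by (subst sums_Suc_iff) simp
        from sums_divide[OF this, of \<zeta>] show ?thesis
          unfolding e using False by (simp add: power_mult_distrib mult_ac del: fact_Suc)
      qed
    qed
  qed
qed

section \<open>Loops of the manifold in disc coordinates\<close>

lemma annulus_in_open:
  assumes "open D" "circle \<subseteq> D"
  obtains R where "1 < R" "Ann R \<subseteq> D" "R \<le> 2"
proof -
  obtain e where e: "e > 0" "(\<Union>x\<in>circle. ball x e) \<subseteq> D"
    using compact_subset_open_imp_ball_epsilon_subset[OF _ assms] compact_sphere by metis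
  define d where "d = min e 1"
  define R where "R = 1 + d"
  have d: "0 < d" "d \<le> e" "d \<le> 1" using e by (auto simp: d_def)
  have "z \<in> D" if "z \<in> Ann R" for z
  proof -
    have z: "z \<noteq> 0" "1 / R < norm z" "norm z < 1 + d" using that d by (auto simp: Ann_def R_def)
    have "1 - d \<le> 1 / R" using d by (simp add: R_def field_simps)
    then have "\<bar>norm z - 1\<bar> < d" using z by linarith
    \<comment> \<open>The radial projection of z to the circle lies at distance
      \<open>|norm z - 1|\<close>, so closeness to the circle is a condition on the norm
      alone.\<close>
    moreover have "z / of_real (norm z) - z = of_real (1 - norm z) * (z / of_real (norm z))"
      using z(1) by (simp add: field_simps)
    then have "dist (z / of_real (norm z)) z = \<bar>1 - norm z\<bar>"
      using z(1) by (simp only: dist_norm norm_mult norm_of_real norm_divide) simp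
    ultimately have "z \<in> ball (z / of_real (norm z)) e" using d by simp
    moreover have "z / of_real (norm z) \<in> circle" using z(1) by (simp add: norm_divide)
    ultimately show ?thesis using e(2) by blast
  qed
  then show thesis using that[of R] d by (auto simp: R_def)
qed

lemma holomorphic_eq_on_ball:
  assumes "f holomorphic_on ball 0 R" "g holomorphic_on ball 0 R" "1 < R" "\<And>z. z \<in> circle \<Longrightarrow> f z = g z" "z \<in> ball 0 R"
  shows "f z = g z"
proof -
  have "(\<lambda>z. f z - g z) z = 0"
    by (rule analytic_continuation[where f = "\<lambda>z. f z - g z" and S = "ball 0 R" and U = circle and \<xi> = 1])
      (use assms circle_islimpt in \<open>auto intro!: holomorphic_intros\<close>)
  then show ?thesis by simp
qed

text \<open>Cauchy's formula over a circle that avoids 0 expresses k near 0 through values where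
  smoothness in x is known; holomorphy at 0 for each x separately is then enough.\<close>

lemma sm_removable:
  assumes g: "sm (ball 0 R - {0}) k" and k: "\<And>x. k x holomorphic_on ball 0 R" and R: "R > 0"
  shows "sm (ball 0 R) k"
proof (rule sm_local)
  fix z :: complex assume z: "z \<in> ball 0 R"
  define r where "r = (norm z + R) / 2"
  have r: "0 < r" "r < R" "norm z < r" using z R norm_ge_zero[of z] by (auto simp: r_def simp del: norm_ge_zero intro: add_nonneg_pos)
  have nz: "of_real r * \<eta> - z \<noteq> 0" if "\<eta> \<in> circle" "z \<in> ball 0 r" for \<eta> z
    using that r by (auto simp: norm_mult)
  have "sm (ball 0 r) (\<lambda>x z. cint (\<lambda>\<eta>. k x (of_real r * \<eta>) * (of_real r * \<eta> / (of_real r * \<eta> - z))))"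
  proof (rule sm_cint_kernel[where \<kappa>' = "\<lambda>\<eta> z. of_real r * \<eta> / (of_real r * \<eta> - z)^2", OF g])
    show "((\<lambda>z. of_real r * \<eta> / (of_real r * \<eta> - z)) has_field_derivative of_real r * \<eta> / (of_real r * \<eta> - z)^2) (at z)"
      if "\<eta> \<in> circle" "z \<in> ball 0 r" for \<eta> z
      using has_field_derivative_inverse_linear[of "of_real r * \<eta>" 1 z "of_real r * \<eta>"] nz[OF that] by simp
    show "of_real r * \<eta> \<in> ball 0 R - {0}" if "\<eta> \<in> circle" for \<eta>
      using that r by (auto simp: norm_mult)
    show "continuous_on (circle \<times> ball 0 r) (\<lambda>(\<eta>, z). of_real r * \<eta> / (of_real r * \<eta> - z))"
      "continuous_on (circle \<times> ball 0 r) (\<lambda>(\<eta>, z). of_real r * \<eta> / (of_real r * \<eta> - z)\<^sup>2)"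
      using nz by (auto intro!: continuous_intros simp: case_prod_unfold)
  qed (auto intro!: continuous_intros)
  then have "sm (ball 0 r) k"
  proof (rule sm_cong_on)
    fix x :: real and z :: complex assume z: "z \<in> ball 0 r"
    have "contour_integral (circlepath 0 r) (\<lambda>u. k x u / (u - z)) = 2 * of_real pi * \<i> * k x z"
      by (rule contour_integral_unique, rule Cauchy_integral_circlepath_simple)
        (use z r in \<open>auto intro: holomorphic_on_subset[OF k]\<close>)
    then show "cint (\<lambda>\<eta>. k x (of_real r * \<eta>) * (of_real r * \<eta> / (of_real r * \<eta> - z))) = k x z"
      using r by (simp add: contour_integral_circlepath_eq_cint)
  qed
  then show "\<exists>E. open E \<and> z \<in> E \<and> sm E k" using r by (intro exI[of _ "ball 0 r"]) auto
qed auto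

text \<open>In the variable \<open>1 / z\<close>, boundedness near infinity is Riemann's condition
  for a removable singularity. It is given for each x without uniformity;
  \<open>sm_removable\<close> recovers smoothness in x at the added point.\<close>

lemma sm_exterior:
  assumes D: "open D" "Dinf \<subseteq> D" and f: "sm D f" and bd: "\<And>x. f x \<in> O[at_infinity](\<lambda>_. 1)"
  obtains R k where "1 < R" "sm (ball 0 R) k" "\<And>x z. 1 / R < norm z \<Longrightarrow> f x z = k x (1 / z)"
proof -
  have "circle \<subseteq> D" using D(2) by auto
  then obtain R where R: "1 < R" "Ann R \<subseteq> D"
    using annulus_in_open[OF D(1)] by metis
  have in_D: "z \<in> D" if "1 / R < norm z" for z
    using that R D(2) by (cases "norm z < R") (auto simp: Ann_def subset_iff)
  have im: "1 / z \<in> D" if "z \<in> ball 0 R - {0}" for z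
    by (rule in_D) (use that R in \<open>auto simp: norm_divide field_simps\<close>)
  have g: "sm (ball 0 R - {0}) (\<lambda>x z. f x (1 / z))"
  proof (rule sm_compose[OF f])
    show "(\<lambda>z. 1 / z) ` (ball 0 R - {0}) \<subseteq> D" using im by blast
  qed (auto intro!: holomorphic_intros)
  have "\<exists>k. k holomorphic_on ball 0 R \<and> (\<forall>z\<in>ball 0 R - {0}. k z = f x (1 / z))" for x
  proof (rule holomorphic_on_extend)
    show "(\<lambda>z. f x (1 / z)) holomorphic_on ball 0 R - {0}" using sm_holo[OF g] .
    show "0 \<in> interior (ball 0 R)" using R by (simp add: interior_open)
    obtain c where "eventually (\<lambda>z. norm (f x z) \<le> c * norm (1::complex)) at_infinity"
      using bd[of x] by (auto elim: landau_o.bigE)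
    then obtain b where b: "\<And>z. norm z \<ge> b \<Longrightarrow> norm (f x z) \<le> c" by (auto simp: eventually_at_infinity)
    define e where "e = 1 / (\<bar>b\<bar> + 1)"
    have "e > 0" by (simp add: e_def)
    moreover have "norm (f x (1 / z)) \<le> c" if "z \<noteq> 0" "dist z 0 < e" for z
    proof (rule b)
      have p: "0 < \<bar>b\<bar> + 1" by simp
      have "norm z < 1 / (\<bar>b\<bar> + 1)" using that by (simp add: e_def)
      then have "norm z * (\<bar>b\<bar> + 1) < 1" using p by (simp only: pos_less_divide_eq)
      then have "\<bar>b\<bar> + 1 < 1 / norm z" using that by (simp add: pos_less_divide_eq mult.commute)
      then show "b \<le> norm (1 / z)" by (simp add: norm_divide)
    qed
    ultimately have "eventually (\<lambda>z. norm (f x (1 / z)) \<le> c) (at 0)"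
      unfolding eventually_at by blast
    then show "(\<lambda>z. f x (1 / z)) \<in> O[at 0](\<lambda>_. 1)" by (intro bigoI[of _ c]) auto
  qed
  then obtain k where k: "\<And>x. k x holomorphic_on ball 0 R" "\<And>x z. z \<in> ball 0 R - {0} \<Longrightarrow> k x z = f x (1 / z)"
    by metis
  have "sm (ball 0 R - {0}) k" by (rule sm_cong_on[OF g]) (use k in auto)
  then have "sm (ball 0 R) k" by (rule sm_removable) (use k R in auto)
  moreover have "f x z = k x (1 / z)" if "1 / R < norm z" for x z
  proof -
    have "z \<noteq> 0" using that R by auto
    moreover have "1 / norm z < R" using that R \<open>z \<noteq> 0\<close> by (simp add: field_simps)
    ultimately show ?thesis using k(2)[of "1 / z" x] by (simp add: norm_divide)
  qed
  ultimately show thesis using that R by blast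
qed

text \<open>Multiplication by z removes the pole. The value at 0 comes from the factor in
  \<open>hol_inv_D0\<close>, chosen for each x independently; \<open>sm_removable\<close> turns this
  into a smooth family.\<close>

lemma sm_interior:
  assumes D: "open D" "D0p \<subseteq> D" and f: "sm D f" and h: "\<And>x. hol_inv_D0 (f x)"
  obtains R k where "1 < R" "sm (ball 0 R) k" "\<And>x z. z \<in> ball 0 R - {0} \<Longrightarrow> f x z = k x z / z"
proof -
  have "circle \<subseteq> D" using D(2) by auto
  then obtain R where R: "1 < R" "Ann R \<subseteq> D"
    using annulus_in_open[OF D(1)] by metis
  have in_D: "z \<in> D" if "z \<in> ball 0 R - {0}" for z
  proof (cases "norm z \<le> 1")
    case True
    then show ?thesis using that D(2) by auto
  next
    case False
    moreover have "1 / R < 1" using R by simp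
    ultimately have "1 / R < norm z" by linarith
    then show ?thesis using that R by (auto simp: Ann_def subset_iff)
  qed
  have "\<exists>h. h analytic_on cball 0 1 \<and> (\<forall>z\<in>D0p. f x z = h z / z)" for x using h[of x] by (auto simp: hol_inv_D0_def)
  then obtain h where h: "\<And>x. h x analytic_on cball 0 1" "\<And>x z. z \<in> D0p \<Longrightarrow> f x z = h x z / z" by metis
  define k where "k x z = (if z = 0 then h x 0 else z * f x z)" for x z
  have "sm (ball 0 R - {0}) (\<lambda>x z. z * f x z)"
    by (intro sm_mult sm_hol[OF holomorphic_on_ident] sm_subset[OF f]) (use in_D in blast)
  then have g: "sm (ball 0 R - {0}) k" by (rule sm_cong_on) (auto simp: k_def)
  have "k x holomorphic_on ball 0 R" for x
  proof -
    have "h x holomorphic_on ball 0 1"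
      using analytic_imp_holomorphic[OF h(1)] by (rule holomorphic_on_subset) auto
    then have "k x holomorphic_on ball 0 1"
      by (rule holomorphic_transform) (use h in \<open>auto simp: k_def\<close>)
    then have "k x holomorphic_on (ball 0 1 \<union> (ball 0 R - {0}))"
      by (rule holomorphic_on_Un) (use sm_holo[OF g] in auto)
    then show ?thesis by (rule holomorphic_on_subset) auto
  qed
  then have "sm (ball 0 R) k" using sm_removable[OF g] R by auto
  moreover have "f x z = k x z / z" if "z \<in> ball 0 R - {0}" for x z
    using that by (simp add: k_def)
  ultimately show thesis using that R by blast
qed

section \<open>Compactness over one period and uniqueness of branches\<close>

lemma periodic_reduce:
  assumes "\<And>x. f (x + 2 * pi) = f x"
  shows "\<exists>y\<in>{0..2 * pi}. f x = f y"
proof -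
  have nat: "f (x + 2 * pi * of_nat n) = f x" for x n
  proof (induction n)
    case (Suc n)
    have "x + 2 * pi * of_nat (Suc n) = (x + 2 * pi * of_nat n) + 2 * pi" by (simp add: algebra_simps)
    then show ?case using Suc assms by metis
  qed simp
  define m where "m = \<lfloor>x / (2 * pi)\<rfloor>"
  define y where "y = x - 2 * pi * of_int m"
  have "of_int m \<le> x / (2 * pi)" "x / (2 * pi) < of_int m + 1" unfolding m_def by linarith+
  then have "y \<in> {0..2 * pi}" by (simp add: y_def field_simps)
  moreover have "f x = f y"
  proof (cases "m \<ge> 0")
    case True
    then have "x = y + 2 * pi * of_nat (nat m)" by (simp add: y_def)
    then show ?thesis using nat by metis
  next
    case False
    then have "y = x + 2 * pi * of_nat (nat (- m))" by (simp add: y_def)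
    then show ?thesis using nat by metis
  qed
  ultimately show ?thesis by blast
qed

lemma exp_eq_1_discrete:
  assumes "exp a = 1" "a \<noteq> 0"
  shows "2 * pi \<le> norm (a :: complex)"
proof -
  obtain n :: int where n: "Re a = 0" "Im a = of_int (2 * n) * pi" using assms(1) by (auto simp: exp_eq_1)
  then have "n \<noteq> 0" using assms(2) complex_eq_iff by auto
  then have "1 \<le> \<bar>real_of_int n\<bar>" by linarith
  then have "2 * pi \<le> \<bar>Im a\<bar>" using n by (simp add: abs_mult)
  then show ?thesis using abs_Im_le_cmod order_trans by blast
qed

text \<open>The solutions of \<open>exp a = 1\<close> are at least \<open>2 * pi\<close> apart, so a
  continuous function with such values is constant on a connected set. Every identification of a
  constructed branch with one chosen by \<open>SOME\<close> goes back to this.\<close>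

lemma exp_one_constant:
  fixes g :: "'a::topological_space \<Rightarrow> complex"
  assumes "connected S" "continuous_on S g" "\<And>s. s \<in> S \<Longrightarrow> exp (g s) = 1" "a \<in> S" "b \<in> S"
  shows "g a = g b"
proof -
  have "g constant_on S"
  proof (rule continuous_discrete_range_constant[OF assms(1,2)])
    fix x assume "x \<in> S"
    show "\<exists>e>0. \<forall>y. y \<in> S \<and> g y \<noteq> g x \<longrightarrow> e \<le> norm (g y - g x)"
    proof (intro exI[of _ "2 * pi"] conjI allI impI)
      fix y assume "y \<in> S \<and> g y \<noteq> g x"
      then show "2 * pi \<le> norm (g y - g x)"
        using assms(3) \<open>x \<in> S\<close> by (intro exp_eq_1_discrete) (auto simp: exp_diff)
    qed simp
  qed
  then show ?thesis using assms(4,5) unfolding constant_on_def by metis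
qed

lemma logs_eq:
  fixes g1 g2 :: "'a::topological_space \<Rightarrow> complex"
  assumes "connected S" "continuous_on S g1" "continuous_on S g2" "\<And>s. s \<in> S \<Longrightarrow> exp (g1 s) = exp (g2 s)"
    "a \<in> S" "g1 a = g2 a" "b \<in> S"
  shows "g1 b = g2 b"
proof -
  have "g1 b - g2 b = g1 a - g2 a"
    by (rule exp_one_constant[OF assms(1), where g = "\<lambda>s. g1 s - g2 s"])
      (use assms in \<open>auto intro!: continuous_intros simp: exp_diff\<close>)
  then show ?thesis using assms(6) by simp
qed

text \<open>The product of the line and a disc is contractible, so a joint logarithm exists. It is
  normalised at the single point \<open>(0, 0)\<close>; uniqueness along the line
  \<open>z = 0\<close> then forces the prescribed value \<open>c x\<close> for every x.\<close>

lemma sm_family_log: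
  assumes h: "sm (ball 0 R) h" "\<And>x z. z \<in> ball 0 R \<Longrightarrow> h x z \<noteq> 0" and R: "R > 0"
    and c: "continuous_on UNIV c" "\<And>x. exp (c x) = h x 0"
  obtains g where "sm (ball 0 R) g" "\<And>x z. z \<in> ball 0 R \<Longrightarrow> exp (g x z) = h x z" "\<And>x. g x 0 = c x"
proof -
  have "contractible ((UNIV :: real set) \<times> ball (0::complex) R)"
    by (intro convex_imp_contractible convex_Times) auto
  then obtain G where G: "continuous_on (UNIV \<times> ball 0 R) G" "\<And>s. s \<in> UNIV \<times> ball 0 R \<Longrightarrow> (\<lambda>(x, z). h x z) s = exp (G s)"
    using continuous_logarithm_on_contractible[OF sm_cont[OF h(1)]] h(2) by (metis (no_types, lifting) SigmaE case_prod_conv)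
  define g where "g x z = G (x, z) - G (0, 0) + c 0" for x z
  have ex: "exp (g x z) = h x z" if "z \<in> ball 0 R" for x z
    using G(2)[of "(x, z)"] G(2)[of "(0, 0)"] c(2)[of 0] R that h(2)[of 0 0] by (simp add: g_def exp_add exp_diff)
  have cg: "continuous_on (UNIV \<times> ball 0 R) (\<lambda>(x, z). g x z)"
    unfolding g_def case_prod_unfold using G(1) by (auto intro!: continuous_intros)
  have "sm (ball 0 R) g" by (rule sm_log[OF _ h(1) cg ex]) auto
  moreover have "g x 0 = c x" for x
  proof (rule logs_eq[of UNIV "\<lambda>x. g x 0" c 0])
    show "continuous_on UNIV (\<lambda>x. g x 0)" by (rule sm_contx[OF \<open>sm (ball 0 R) g\<close>]) (use R in auto)
    show "g 0 0 = c 0" by (simp add: g_def)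
  qed (use c ex R in auto)
  ultimately show thesis using that ex by blast
qed

text \<open>Nonvanishing is known on the closed unit disc only. Over one period compactness gives a
  positive lower bound c there, and uniform continuity keeps h within less than c of these values on
  a slightly larger disc. Periodicity makes this radius valid for all x.\<close>

lemma nonzero_shrink:
  assumes h: "sm (ball 0 R) h" and per: "\<And>x z. z \<in> ball 0 R \<Longrightarrow> h (x + 2 * pi) z = h x z"
    and nz: "\<And>x z. z \<in> cball 0 1 \<Longrightarrow> h x z \<noteq> 0" and R: "1 < R"
  obtains r where "1 < r" "r \<le> R" "\<And>x z. z \<in> ball 0 r \<Longrightarrow> h x z \<noteq> 0"
proof -
  define s where "s = (1 + R) / 2"
  have s: "1 < s" "s < R" using R by (auto simp: s_def)
  have cont: "continuous_on ({0..2 * pi} \<times> cball 0 s) (\<lambda>(x, z). h x z)"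
    by (rule continuous_on_subset[OF sm_cont[OF h]]) (use s in auto)
  have comp: "compact ({0..2 * pi} \<times> cball (0::complex) s)" "compact ({0..2 * pi} \<times> cball (0::complex) 1)"
    by (intro compact_Times; auto)+
  have "\<exists>p\<in>{0..2 * pi} \<times> cball 0 1. \<forall>q\<in>{0..2 * pi} \<times> cball 0 1. norm ((\<lambda>(x, z). h x z) p) \<le> norm ((\<lambda>(x, z). h x z) q)"
    by (rule continuous_attains_inf[OF comp(2)])
      (use s in \<open>auto intro!: continuous_on_norm continuous_on_subset[OF cont]\<close>)
  then obtain p where p: "p \<in> {0..2 * pi} \<times> cball 0 1" "\<And>q. q \<in> {0..2 * pi} \<times> cball 0 1 \<Longrightarrow> norm ((\<lambda>(x, z). h x z) p) \<le> norm ((\<lambda>(x, z). h x z) q)"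
    by blast
  define c where "c = norm ((\<lambda>(x, z). h x z) p)"
  have c: "c > 0" using p(1) nz by (auto simp: c_def)
  have "uniformly_continuous_on ({0..2 * pi} \<times> cball 0 s) (\<lambda>(x, z). h x z)"
    by (rule compact_uniformly_continuous[OF cont comp(1)])
  then obtain d where d: "d > 0" "\<And>q q'. q \<in> {0..2 * pi} \<times> cball 0 s \<Longrightarrow> q' \<in> {0..2 * pi} \<times> cball 0 s \<Longrightarrow> dist q' q < d
     \<Longrightarrow> dist ((\<lambda>(x, z). h x z) q') ((\<lambda>(x, z). h x z) q) < c"
    using c unfolding uniformly_continuous_on_def by metis
  define r where "r = min s (1 + d)"
  have r: "1 < r" "r \<le> R" using s d by (auto simp: r_def)
  have *: "h x z \<noteq> 0" if x: "x \<in> {0..2 * pi}" and z: "z \<in> ball 0 r" for x z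
  proof (cases "norm z \<le> 1")
    case False
    define z' where "z' = z / of_real (norm z)"
    have z': "norm z' = 1" using False by (auto simp: z'_def norm_divide)
    have "z = of_real (norm z) * z'" using False by (auto simp: z'_def)
    then have "z - z' = of_real (norm z - 1) * z'" by (metis left_diff_distrib mult_1 of_real_1 of_real_diff)
    then have "dist z z' < d" using z z' False by (simp only: dist_norm norm_mult norm_of_real) (auto simp: r_def)
    then have "dist (h x z) (h x z') < c"
      using d(2)[of "(x, z')" "(x, z)"] x z z' s by (auto simp: dist_prod_def r_def)
    moreover have "c \<le> norm (h x z')" using p(2)[of "(x, z')"] x z' by (auto simp: c_def)
    ultimately show ?thesis by auto
  qed (use nz in auto)
  have "h x z \<noteq> 0" if "z \<in> ball 0 r" for x z
  proof -
    have "\<And>x. h (x + 2 * pi) z = h x z" using that r by (intro per) auto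
    from periodic_reduce[of "\<lambda>x. h x z", OF this, of x]
    obtain y where "y \<in> {0..2 * pi}" "h x z = h y z" by blast
    then show ?thesis using *[of y z] that by simp
  qed
  then show thesis using that r by blast
qed

lemma smooth_fun_sm: "smooth_fun f \<Longrightarrow> sm D (\<lambda>x z. f x)"
proof -
  assume "smooth_fun f"
  then obtain F where F: "F 0 = f" "\<And>n x. (F n has_vector_derivative F (Suc n) x) (at x)"
    unfolding smooth_fun_def by blast
  have c: "continuous_on UNIV (F n)" for n
    by (intro continuous_at_imp_continuous_on ballI has_vector_derivative_continuous[OF F(2)])
  show ?thesis unfolding sm_def
    by (rule exI[of _ "\<lambda>n x z. F n x"])
      (use F in \<open>auto simp: case_prod_unfold intro!: continuous_on_compose2[OF c] continuous_intros\<close>)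
qed

lemma sm_smooth_fun:
  assumes "sm D f" "z \<in> D" shows "smooth_fun (\<lambda>x. f x z)"
proof -
  define F where "F n = (dx ^^ n) f" for n
  have "sm D (F n)" for n by (induction n) (auto simp: F_def assms(1) sm_dx(1))
  then have "((\<lambda>y. F n y z) has_vector_derivative F (Suc n) x z) (at x)" for n x
    using sm_dx(2)[of D "F n" z x] assms(2) by (simp add: F_def)
  then show ?thesis unfolding smooth_fun_def
    by (intro exI[of _ "\<lambda>n x. F n x z"]) (auto simp: F_def)
qed

lemma lcoeff_simple_pole:
  assumes g: "g holomorphic_on ball 0 r" "1 < r" and f: "\<And>z. z \<in> circle \<Longrightarrow> f z = g z / z"
  shows "lcoeff f (-1) = g 0" and "lcoeff f 0 = deriv g 0"
proof -
  have "lcoeff f (-1) = cint (\<lambda>z. g z / z ^ 0)"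
    unfolding lcoeff_def
  proof (rule cint_cong)
    fix z :: complex assume "z \<in> circle"
    then have "z \<noteq> 0" by auto
    then show "f z * z powi - (-1) = g z / z ^ 0" using f[OF \<open>z \<in> circle\<close>] by simp
  qed
  then show "lcoeff f (-1) = g 0" using cint_higher_deriv[OF g, of 0] by simp
  have "lcoeff f 0 = cint (\<lambda>z. g z / z ^ 1)"
    unfolding lcoeff_def by (rule cint_cong) (simp add: f)
  then show "lcoeff f 0 = deriv g 0" using cint_higher_deriv[OF g, of 1] by simp
qed

lemma deriv_cong_open:
  assumes "open D" "z \<in> D" "\<And>w. w \<in> D \<Longrightarrow> f w = g w"
  shows "deriv f z = deriv g z"
  by (rule deriv_cong_ev) (use assms eventually_nhds in blast)+

lemma dx_cong: "(\<And>y. f y z = g y z) \<Longrightarrow> dx f x z = dx g x z"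
  unfolding dx_def by simp

lemma dx_periodic:
  assumes "\<And>x. f (x + 2 * pi) z = f x z"
  shows "dx f (x + 2 * pi) z = dx f x z"
proof -
  have "((\<lambda>y. f y z) has_vector_derivative D) (at (x + 2 * pi)) \<longleftrightarrow> ((\<lambda>y. f y z) has_vector_derivative D) (at x)" for D
  proof -
    have s1: "((\<lambda>y. f' (y + c)) has_vector_derivative D) (at a)"
      if "(f' has_vector_derivative D) (at (a + c))" for f' :: "real \<Rightarrow> complex" and a c
    proof -
      have "((\<lambda>y. y + c) has_vector_derivative 1) (at a)" by (auto intro!: derivative_eq_intros)
      from vector_diff_chain_at[OF this that] show ?thesis by (simp add: o_def)
    qed
    have s: "(f' has_vector_derivative D) (at (a + c)) \<longleftrightarrow> ((\<lambda>y. f' (y + c)) has_vector_derivative D) (at a)" for f' :: "real \<Rightarrow> complex" and a c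
      using s1[of f' a c] s1[of "\<lambda>y. f' (y + c)" "a + c" "- c"] by auto
    show ?thesis using s[of "\<lambda>y. f y z" x "2 * pi"] assms by simp
  qed
  then show ?thesis unfolding dx_def vector_derivative_def by simp
qed

lemma connected_Dinf: "connected Dinf"
proof -
  have "Dinf = - ball 0 1" by auto
  then show ?thesis using connected_complement_bounded_convex[of "ball (0::complex) 1"] by simp
qed

text \<open>The difference of two branches is constant on the connected exterior, and its limit at
  infinity shows that the constant is 0: infinity serves as the base point.\<close>

lemma logs_eq_exterior:
  fixes f g :: "complex \<Rightarrow> complex"
  assumes c: "continuous_on Dinf f" "continuous_on Dinf g" and l: "(f \<longlongrightarrow> 0) at_infinity" "(g \<longlongrightarrow> 0) at_infinity"
    and e: "\<And>z. z \<in> Dinf \<Longrightarrow> exp (f z) = exp (g z)" and z: "z \<in> Dinf"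
  shows "f z = g z"
proof -
  define d where "d z = f z - g z" for z
  have d0: "(d \<longlongrightarrow> 0) at_infinity" unfolding d_def using tendsto_diff[OF l] by simp
  have dc: "d z = d 1" if "z \<in> Dinf" for z
    by (rule exp_one_constant[OF connected_Dinf, of d])
      (use that c e in \<open>auto simp: d_def exp_diff intro!: continuous_intros\<close>)
  have ev: "\<forall>\<^sub>F z in at_infinity. d z = d 1"
    unfolding eventually_at_infinity by (intro exI[of _ 1] allI impI dc) simp
  have "((\<lambda>z::complex. d 1) \<longlongrightarrow> 0) at_infinity"
    by (rule Lim_transform_eventually[OF d0 ev])
  from tendsto_unique[OF trivial_limit_at_infinity tendsto_const this] have "d 1 = 0" .
  then show ?thesis using dc[OF z] by (simp add: d_def)
qed

lemma tendsto_inverse_arg_at_infinity: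
  fixes f :: "complex \<Rightarrow> complex"
  assumes "isCont f 0"
  shows "((\<lambda>z. f (1 / z)) \<longlongrightarrow> f 0) at_infinity"
  using assms by (rule isCont_tendsto_compose) (use tendsto_inverse_0 in \<open>simp add: divide_inverse\<close>)

lemma inverse_mem_ball:
  fixes z :: complex
  assumes "1 < r" "1 / r < norm z" shows "1 / z \<in> ball 0 r" "z \<noteq> 0"
proof -
  show "z \<noteq> 0" using assms by auto
  then have "1 / norm z < r" using assms by (simp add: divide_less_eq mult.commute)
  then show "1 / z \<in> ball 0 r" by (simp add: norm_divide)
qed

lemma Dinf_exterior: "1 < r \<Longrightarrow> z \<in> Dinf \<Longrightarrow> 1 / r < norm z"
proof -
  assume "1 < r" "z \<in> Dinf"
  then have "1 / r < 1" "1 \<le> norm z" by auto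
  then show "1 / r < norm z" by linarith
qed

lemma open_norm_exterior: "open {z::complex. c < norm z}"
  by (intro open_Collect_less continuous_intros)

text \<open>Disc coordinates of a loop, with one radius for all x: h is \<open>lam / z\<close> in
  the variable \<open>1 / z\<close>, k is \<open>z lamb\<close>, and Hl, Kl are their logarithms.
  The normalisation \<open>lam = z + O(1)\<close> becomes \<open>h x 0 = 1\<close>. Since Kl takes
  the value u at 0, it inherits a possible winding of u and need not be periodic.\<close>

locale loop_rep =
  fixes \<gamma> :: "real \<Rightarrow> point" and R :: real and h k Hl Kl :: "real \<Rightarrow> complex \<Rightarrow> complex"
  assumes R: "1 < R"
    and h: "sm (ball 0 R) h" and k: "sm (ball 0 R) k"
    and h0: "h x 0 = 1"
    and h_nz: "z \<in> ball 0 R \<Longrightarrow> h x z \<noteq> 0" and k_nz: "z \<in> ball 0 R \<Longrightarrow> k x z \<noteq> 0"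
    and h_per: "z \<in> ball 0 R \<Longrightarrow> h (x + 2 * pi) z = h x z"
    and k_per: "z \<in> ball 0 R \<Longrightarrow> k (x + 2 * pi) z = k x z"
    and lam_eq: "1 / R < norm z \<Longrightarrow> lam (\<gamma> x) z = z * h x (1 / z)"
    and lamb_eq: "z \<in> ball 0 R - {0} \<Longrightarrow> lamb (\<gamma> x) z = k x z / z"
    and L: "sm (Ann R) (\<lambda>x. logwz (\<gamma> x))"
    and exp_L: "z \<in> Ann R \<Longrightarrow> exp (logwz (\<gamma> x) z) = wfun (\<gamma> x) z / z"
    and L_per: "z \<in> Ann R \<Longrightarrow> logwz (\<gamma> (x + 2 * pi)) z = logwz (\<gamma> x) z"
    and exp_u: "exp (ucoord (\<gamma> x)) = k x 0"
    and u: "smooth_fun (\<lambda>x. ucoord (\<gamma> x))"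
    and Hl: "sm (ball 0 R) Hl" "z \<in> ball 0 R \<Longrightarrow> exp (Hl x z) = h x z" "Hl x 0 = 0"
    and Kl: "sm (ball 0 R) Kl" "z \<in> ball 0 R \<Longrightarrow> exp (Kl x z) = k x z" "Kl x 0 = ucoord (\<gamma> x)"

lemma LM0_loop_rep:
  assumes "\<gamma> \<in> LM0"
  obtains R h k Hl Kl where "loop_rep \<gamma> R h k Hl Kl"
proof -
  have M: "\<gamma> x \<in> M0_branched" for x using assms by (auto simp: LM0_def)
  then have M0: "(lam (\<gamma> x), lamb (\<gamma> x)) \<in> M0" and exp_u: "exp (ucoord (\<gamma> x)) = lcoeff (lamb (\<gamma> x)) (-1)"
    and exp_L: "\<And>z. z \<in> circle \<Longrightarrow> exp (logwz (\<gamma> x) z) = wfun (\<gamma> x) z / z" for x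
    by (auto simp: M0_branched_def)
  have lO: "(\<lambda>z. lam (\<gamma> x) z - z) \<in> O[at_infinity](\<lambda>_. 1)" and lb: "hol_inv_D0 (lamb (\<gamma> x))"
    and lb1: "lcoeff (lamb (\<gamma> x)) (-1) \<noteq> 0" and lnz: "\<And>z. z \<in> Dinf \<Longrightarrow> lam (\<gamma> x) z \<noteq> 0"
    and bnz: "\<And>z. z \<in> D0p \<Longrightarrow> lamb (\<gamma> x) z \<noteq> 0" for x
    using M0[of x] by (auto simp: M0_def Let_def)
  have sl: "smooth_loop Dinf (\<lambda>x. lam (\<gamma> x))" "smooth_loop D0p (\<lambda>x. lamb (\<gamma> x))"
    "smooth_loop circle (\<lambda>x. logwz (\<gamma> x))" "smooth_fun (\<lambda>x. ucoord (\<gamma> x))"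
    using assms by (auto simp: LM0_def)
  obtain D1 where D1: "open D1" "Dinf \<subseteq> D1" "sm D1 (\<lambda>x. lam (\<gamma> x))"
    using sl(1) unfolding smooth_loop_def smooth_germ_iff_sm by blast
  obtain D2 where D2: "open D2" "D0p \<subseteq> D2" "sm D2 (\<lambda>x. lamb (\<gamma> x))"
    using sl(2) unfolding smooth_loop_def smooth_germ_iff_sm by blast
  obtain D3 where D3: "open D3" "circle \<subseteq> D3" "sm D3 (\<lambda>x. logwz (\<gamma> x))"
    using sl(3) unfolding smooth_loop_def smooth_germ_iff_sm by blast
  have per: "\<And>x z. z \<in> Dinf \<Longrightarrow> lam (\<gamma> (x + 2 * pi)) z = lam (\<gamma> x) z"
     "\<And>x z. z \<in> D0p \<Longrightarrow> lamb (\<gamma> (x + 2 * pi)) z = lamb (\<gamma> x) z"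
     "\<And>x z. z \<in> circle \<Longrightarrow> logwz (\<gamma> (x + 2 * pi)) z = logwz (\<gamma> x) z"
    using sl unfolding smooth_loop_def by blast+
  have sl0: "sm D1 (\<lambda>x z. lam (\<gamma> x) z - z)" by (intro sm_diff D1 sm_hol[OF holomorphic_on_ident])
  obtain R1 k1 where R1: "1 < R1" "sm (ball 0 R1) k1" "\<And>x z. 1 / R1 < norm z \<Longrightarrow> lam (\<gamma> x) z - z = k1 x (1 / z)"
    using sm_exterior[OF D1(1,2) sl0 lO] by metis
  obtain R2 k where R2: "1 < R2" "sm (ball 0 R2) k" "\<And>x z. z \<in> ball 0 R2 - {0} \<Longrightarrow> lamb (\<gamma> x) z = k x z / z"
    using sm_interior[OF D2 lb] by metis
  obtain R3 where R3: "1 < R3" "Ann R3 \<subseteq> D3" using annulus_in_open[OF D3(1,2)] by metis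
  \<comment> \<open>Here k1 is \<open>lam - z\<close>, holomorphic at infinity, in the variable
    \<open>1 / z\<close>; dividing \<open>lam\<close> by z gives this h.\<close>
  define h where "h x z = 1 + z * k1 x z" for x z
  have sh: "sm (ball 0 R1) h"
    unfolding h_def by (intro sm_add sm_mult sm_const sm_hol[OF holomorphic_on_ident] R1)
  have h0: "h x 0 = 1" for x by (simp add: h_def)
  have lam1: "lam (\<gamma> x) z = z * h x (1 / z)" if "1 / R1 < norm z" for x z
  proof -
    have "z \<noteq> 0" using that R1(1) by auto
    then show ?thesis using R1(3)[OF that, of x] by (simp add: h_def algebra_simps)
  qed
  have kc: "lcoeff (lamb (\<gamma> x)) (-1) = k x 0" for x
  proof (rule lcoeff_simple_pole(1)[OF sm_holo[OF R2(2)] R2(1)])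
    fix z :: complex assume "z \<in> circle"
    then show "lamb (\<gamma> x) z = k x z / z" using R2(1) by (intro R2(3)) auto
  qed
  have hnz: "h x z \<noteq> 0" if "z \<in> cball 0 1" for x z
  proof (cases "z = 0")
    case False
    have "1 / R1 < 1" "1 \<le> norm (1 / z)" using that False R1(1) by (auto simp: norm_divide)
    then have "1 / R1 < norm (1 / z)" by linarith
    then have "lam (\<gamma> x) (1 / z) = (1 / z) * h x z" using lam1[of "1 / z" x] by simp
    then show ?thesis using lnz[of "1 / z" x] \<open>1 \<le> norm (1 / z)\<close> by auto
  qed (simp add: h0)
  have knz: "k x z \<noteq> 0" if "z \<in> cball 0 1" for x z
  proof (cases "z = 0")
    case False
    then show ?thesis using bnz[of z x] R2(3)[of z x] R2(1) that by auto
  qed (use lb1 kc in auto)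
  have hper: "h (x + 2 * pi) z = h x z" if "z \<in> ball 0 R1" for x z
  proof (rule holomorphic_eq_on_ball[OF sm_holo[OF sh] sm_holo[OF sh] R1(1) _ that])
    fix z :: complex assume z: "z \<in> circle"
    then have z1: "norm (1 / z) = 1" "z \<noteq> 0" by (auto simp: norm_divide)
    have *: "lam (\<gamma> x) (1 / z) = (1 / z) * h x z" for x
      using lam1[of "1 / z" x] z1 R1(1) by simp
    show "h (x + 2 * pi) z = h x z" using per(1)[of "1 / z" x] *[of x] *[of "x + 2 * pi"] z1 by simp
  qed
  have kper: "k (x + 2 * pi) z = k x z" if "z \<in> ball 0 R2" for x z
  proof (rule holomorphic_eq_on_ball[OF sm_holo[OF R2(2)] sm_holo[OF R2(2)] R2(1) _ that])
    fix z :: complex assume z: "z \<in> circle"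
    then have z1: "z \<noteq> 0" "z \<in> D0p" "z \<in> ball 0 R2 - {0}" using R2(1) by auto
    show "k (x + 2 * pi) z = k x z" using per(2)[of z x] R2(3)[of z x] R2(3)[of z "x + 2 * pi"] z1 by simp
  qed
  obtain r1 where r1: "1 < r1" "r1 \<le> R1" "\<And>x z. z \<in> ball 0 r1 \<Longrightarrow> h x z \<noteq> 0"
    using nonzero_shrink[OF sh hper hnz R1(1)] by metis
  obtain r2 where r2: "1 < r2" "r2 \<le> R2" "\<And>x z. z \<in> ball 0 r2 \<Longrightarrow> k x z \<noteq> 0"
    using nonzero_shrink[OF R2(2) kper knz R2(1)] by metis
  \<comment> \<open>One radius for which h and k are zero-free and the branch of
    \<open>log (w / z)\<close> is holomorphic.\<close>
  define R where "R = min r1 (min r2 R3)"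
  have R: "1 < R" "R \<le> r1" "R \<le> r2" "R \<le> R3" "R \<le> R1" "R \<le> R2" using r1 r2 R3 by (auto simp: R_def)
  have inv: "1 / R1 \<le> 1 / R" using R R1(1) by (simp add: frac_le)
  have Rsub: "ball 0 R \<subseteq> ball (0::complex) R1" "ball 0 R \<subseteq> ball (0::complex) R2" "Ann R \<subseteq> D3"
    using R Ann_mono[OF R(1) R(4)] R3 by auto
  have shR: "sm (ball 0 R) h" and skR: "sm (ball 0 R) k" and sLR: "sm (Ann R) (\<lambda>x. logwz (\<gamma> x))"
    using sm_subset sh R2(2) D3(3) Rsub by blast+
  have lam: "lam (\<gamma> x) z = z * h x (1 / z)" if "1 / R < norm z" for x z
    by (rule lam1) (use that inv in linarith)
  have lamb: "lamb (\<gamma> x) z = k x z / z" if "z \<in> ball 0 R - {0}" for x z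
    by (rule R2(3)) (use that R in auto)
  have wholo: "(\<lambda>z. wfun (\<gamma> x) z / z) holomorphic_on Ann R" for x
  proof -
    have "h x \<circ> (\<lambda>z. 1 / z) holomorphic_on Ann R"
    proof (rule holomorphic_on_compose_gen[OF _ sm_holo[OF shR]])
      show "(\<lambda>z. 1 / z) ` Ann R \<subseteq> ball 0 R" using Ann_inverse[OF R(1)] Ann_ball by blast
      show "(\<lambda>z. 1 / z) holomorphic_on Ann R" using Ann_nonzero[OF R(1)] by (intro holomorphic_intros) auto
    qed
    moreover have "k x holomorphic_on Ann R" by (rule holomorphic_on_subset[OF sm_holo[OF skR] Ann_ball])
    ultimately have "(\<lambda>z. (z * h x (1 / z) + k x z / z) / z) holomorphic_on Ann R"
      using Ann_nonzero[OF R(1)] by (intro holomorphic_intros) (auto simp: o_def)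
    then show ?thesis
      by (rule holomorphic_transform) (use lam lamb Ann_nonzero[OF R(1)] in \<open>auto simp: wfun_def Ann_def\<close>)
  qed
  have LR: "exp (logwz (\<gamma> x) z) = wfun (\<gamma> x) z / z" if "z \<in> Ann R" for x z
    by (rule holomorphic_eq_on_Ann[OF _ wholo R(1) exp_L that])
      (intro holomorphic_intros sm_holo[OF sLR], auto)
  have Lper: "logwz (\<gamma> (x + 2 * pi)) z = logwz (\<gamma> x) z" if "z \<in> Ann R" for x z
    by (rule holomorphic_eq_on_Ann[OF sm_holo[OF sLR] sm_holo[OF sLR] R(1) per(3) that])
  have hR: "\<And>x z. z \<in> ball 0 R \<Longrightarrow> h x z \<noteq> 0" "\<And>x z. z \<in> ball 0 R \<Longrightarrow> k x z \<noteq> 0"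
    using r1(3) r2(3) R by auto
  obtain Hl where Hl: "sm (ball 0 R) Hl" "\<And>x z. z \<in> ball 0 R \<Longrightarrow> exp (Hl x z) = h x z" "\<And>x. Hl x 0 = 0"
    by (rule sm_family_log[OF shR hR(1), of "\<lambda>_. 0"]) (use R h0 in auto)
  have cu: "continuous_on UNIV (\<lambda>x. ucoord (\<gamma> x))"
    using sm_contx[OF smooth_fun_sm[OF sl(4), of UNIV]] by blast
  obtain Kl where Kl: "sm (ball 0 R) Kl" "\<And>x z. z \<in> ball 0 R \<Longrightarrow> exp (Kl x z) = k x z" "\<And>x. Kl x 0 = ucoord (\<gamma> x)"
    by (rule sm_family_log[OF skR hR(2) _ cu]) (use R exp_u kc in auto)
  have "loop_rep \<gamma> R h k Hl Kl"
  proof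
    show "\<And>z x. z \<in> ball 0 R \<Longrightarrow> h (x + 2 * pi) z = h x z" "\<And>z x. z \<in> ball 0 R \<Longrightarrow> k (x + 2 * pi) z = k x z"
      using hper kper Rsub by blast+
    show "\<And>x. exp (ucoord (\<gamma> x)) = k x 0" using exp_u kc by simp
  qed (use R(1) shR skR h0 hR lam lamb sLR LR Lper sl(4) Hl Kl in blast)+
  then show thesis by (rule that)
qed

context loop_rep
begin

lemma Dinf_R: "z \<in> Dinf \<Longrightarrow> 1 / R < norm z"
  by (rule Dinf_exterior[OF R])

lemma inverse_in_ball:
  fixes z :: complex
  assumes "1 / R < norm z" shows "1 / z \<in> ball 0 R - {0}"
  using inverse_mem_ball[OF R assms] by simp

lemma lcoeff_lamb: "lcoeff (lamb (\<gamma> x)) (-1) = k x 0"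
proof (rule lcoeff_simple_pole(1)[OF sm_holo[OF k] R])
  fix z :: complex assume "z \<in> circle"
  then show "lamb (\<gamma> x) z = k x z / z" using R by (intro lamb_eq) auto
qed

lemma analytic_Dinf_h: "(\<lambda>z. Hl x (1 / z)) analytic_on Dinf"
proof -
  have "Hl x \<circ> (\<lambda>z. 1 / z) holomorphic_on {z. 1 / R < norm z}"
  proof (rule holomorphic_on_compose_gen[OF _ sm_holo[OF Hl(1)]])
    show "(\<lambda>z. 1 / z) ` {z::complex. 1 / R < norm z} \<subseteq> ball 0 R" using inverse_in_ball by blast
    show "(\<lambda>z. 1 / z) holomorphic_on {z. 1 / R < norm z}"
      by (intro holomorphic_intros) (use inverse_in_ball in force)
  qed
  then have "(\<lambda>z. Hl x (1 / z)) holomorphic_on {z. 1 / R < norm z}" by (simp only: o_def)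
  moreover have "Dinf \<subseteq> {z. 1 / R < norm z}" using Dinf_R by blast
  ultimately show ?thesis using analytic_on_holomorphic open_norm_exterior by blast
qed

text \<open>The choice by \<open>SOME\<close> is legitimate because Hl in the variable
  \<open>1 / z\<close> has the defining property, and its outcome on \<open>Dinf\<close> is forced
  by the limit at infinity.\<close>

lemma log_lam_spec:
  "log_lam (\<gamma> x) analytic_on Dinf" "(log_lam (\<gamma> x) \<longlongrightarrow> 0) at_infinity"
  "\<And>z. z \<in> Dinf \<Longrightarrow> exp (log_lam (\<gamma> x) z) = lam (\<gamma> x) z / z"
  and log_lam_eq: "z \<in> Dinf \<Longrightarrow> log_lam (\<gamma> x) z = Hl x (1 / z)"
proof -
  let ?P = "\<lambda>g. g analytic_on Dinf \<and> (g \<longlongrightarrow> 0) at_infinity \<and> (\<forall>z\<in>Dinf. exp (g z) = lam (\<gamma> x) z / z)"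
  have t: "((\<lambda>z. Hl x (1 / z)) \<longlongrightarrow> 0) at_infinity"
  proof -
    have "isCont (Hl x) 0"
      using holomorphic_on_imp_continuous_on[OF sm_holo[OF Hl(1), of x]] R
      by (simp add: continuous_on_eq_continuous_at)
    from tendsto_inverse_arg_at_infinity[OF this] show ?thesis by (simp add: Hl)
  qed
  have e: "exp (Hl x (1 / z)) = lam (\<gamma> x) z / z" if "z \<in> Dinf" for z
    using Hl(2)[of "1 / z" x] inverse_in_ball[OF Dinf_R[OF that]] lam_eq[OF Dinf_R[OF that], of x] by auto
  have "?P (\<lambda>z. Hl x (1 / z))" using analytic_Dinf_h t e by blast
  then have P: "?P (log_lam (\<gamma> x))" unfolding log_lam_def by (rule someI[where P = ?P])
  then show 1: "log_lam (\<gamma> x) analytic_on Dinf" "(log_lam (\<gamma> x) \<longlongrightarrow> 0) at_infinity"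
    "\<And>z. z \<in> Dinf \<Longrightarrow> exp (log_lam (\<gamma> x) z) = lam (\<gamma> x) z / z" by auto
  show "log_lam (\<gamma> x) z = Hl x (1 / z)" if "z \<in> Dinf"
  proof (rule logs_eq_exterior[OF _ _ 1(2) t _ that])
    show "exp (log_lam (\<gamma> x) z) = exp (Hl x (1 / z))" if "z \<in> Dinf" for z using 1(3)[OF that] e[OF that] by simp
  qed (intro holomorphic_on_imp_continuous_on analytic_imp_holomorphic 1 analytic_Dinf_h)+
qed

lemma log_lamb_spec:
  "log_lamb (\<gamma> x) analytic_on cball 0 1" "log_lamb (\<gamma> x) 0 = ucoord (\<gamma> x)"
  "\<And>z. z \<in> D0p \<Longrightarrow> exp (log_lamb (\<gamma> x) z) = z * lamb (\<gamma> x) z"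
  and log_lamb_eq: "z \<in> cball 0 1 \<Longrightarrow> log_lamb (\<gamma> x) z = Kl x z"
proof -
  let ?P = "\<lambda>g. g analytic_on cball 0 1 \<and> g 0 = ucoord (\<gamma> x) \<and> (\<forall>z\<in>D0p. exp (g z) = z * lamb (\<gamma> x) z)"
  have a: "Kl x analytic_on cball 0 1"
    by (rule analytic_on_subset[of _ "ball 0 R"]) (use sm_holo[OF Kl(1), of x] R in \<open>auto simp: analytic_on_open\<close>)
  have e: "exp (Kl x z) = z * lamb (\<gamma> x) z" if "z \<in> D0p" for z
    using Kl(2)[of z x] lamb_eq[of z x] that R by auto
  have "?P (Kl x)" using a e Kl(3) by blast
  then have P: "?P (log_lamb (\<gamma> x))" unfolding log_lamb_def by (rule someI[where P = ?P])
  then show 1: "log_lamb (\<gamma> x) analytic_on cball 0 1" "log_lamb (\<gamma> x) 0 = ucoord (\<gamma> x)"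
    "\<And>z. z \<in> D0p \<Longrightarrow> exp (log_lamb (\<gamma> x) z) = z * lamb (\<gamma> x) z" by auto
  show "log_lamb (\<gamma> x) z = Kl x z" if "z \<in> cball 0 1"
  proof (rule logs_eq[of "cball 0 1" "log_lamb (\<gamma> x)" "Kl x" 0])
    fix s :: complex assume "s \<in> cball 0 1"
    then show "exp (log_lamb (\<gamma> x) s) = exp (Kl x s)" using 1 e Kl(3) by (cases "s = 0") auto
  qed (use that 1 a Kl(3) in \<open>auto intro!: holomorphic_on_imp_continuous_on analytic_imp_holomorphic\<close>)
qed

end

section \<open>Toda vector fields and the differential of the Hamiltonians\<close>

lemma bracket_dx: "bracket f g x z = z * deriv (f x) z * dx g x z - z * deriv (g x) z * dx f x z"
  by (simp add: bracket_def dx_def)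

lemma log_quotient_identity:
  fixes l b l' b' :: complex
  assumes "l \<noteq> 0" "l + b \<noteq> 0"
  shows "((l' + b') * l - (l + b) * l') / (l * l) / ((l + b) / l) = (l' + b') / (l + b) - l' / l"
  using assms by (simp add: divide_simps)

lemma log_product_identity:
  fixes l b l' b' :: complex
  assumes "b \<noteq> 0" "l + b \<noteq> 0"
  shows "(b * (l' + b') + b' * (l + b)) / (b * (l + b)) = b' / b + (l' + b') / (l + b)"
    "(b' * (l + b) + (l' + b') * b) / (b * (l + b)) = b' / b + (l' + b') / (l + b)"
  using assms by (simp_all add: field_simps)

text \<open>The logarithmic derivatives required by the formal calculus follow from continuity of P
  and R and from their exponentials. One rule thus serves both x-derivatives along a loop and
  derivatives in a deformation parameter.\<close>

lemma ev_log_has_vector_derivative: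
  fixes l b P R :: "real \<Rightarrow> complex"
  assumes dl: "(l has_vector_derivative l') (at t)" and db: "(b has_vector_derivative b') (at t)"
    and S: "open S" "t \<in> S" and c: "continuous_on S P" "continuous_on S R"
    and e: "\<And>s. s \<in> S \<Longrightarrow> exp (P s) = (l s + b s) / l s" "\<And>s. s \<in> S \<Longrightarrow> exp (R s) = b s * (l s + b s)"
    and nz: "l t \<noteq> 0" "b t \<noteq> 0" "l t + b t \<noteq> 0"
  shows "((\<lambda>t. ev e (l t) (b t) (P t) (R t)) has_vector_derivative
     ev (d1 e) (l t) (b t) (P t) (R t) * l' + ev (d2 e) (l t) (b t) (P t) (R t) * b') (at t)"
proof -
  note dw = has_vector_derivative_add[OF dl db]
  have "(inverse \<circ> l has_vector_derivative l' * - (inverse (l t) ^ Suc (Suc 0))) (at t)"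
    by (rule field_vector_diff_chain_at[OF dl DERIV_inverse[OF nz(1)]])
  from has_vector_derivative_mult[OF dw this]
  have "((\<lambda>s. (l s + b s) * inverse (l s)) has_vector_derivative
      (l t + b t) * (l' * - (inverse (l t) ^ Suc (Suc 0))) + (l' + b') * inverse (l t)) (at t)"
    by (simp only: o_def)
  moreover have "w * (l' * - (inverse l ^ Suc (Suc 0))) + w' * inverse l = (w' * l - w * l') / (l * l)" if "l \<noteq> 0" for w l w' l' :: complex
    using that by (simp add: field_simps)
  from this[OF nz(1)] have "(l t + b t) * (l' * - (inverse (l t) ^ Suc (Suc 0))) + (l' + b') * inverse (l t)
     = ((l' + b') * l t - (l t + b t) * l') / (l t * l t)" .
  ultimately have dq: "((\<lambda>s. (l s + b s) / l s) has_vector_derivative ((l' + b') * l t - (l t + b t) * l') / (l t * l t)) (at t)"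
    by (simp only: divide_inverse)
  have "(P has_vector_derivative (l' + b') / (l t + b t) - l' / l t) (at t)"
    using has_vector_derivative_continuous_log[OF dq S c(1) e(1)] log_quotient_identity[OF nz(1,3)] by simp
  moreover have "(R has_vector_derivative b' / b t + (l' + b') / (l t + b t)) (at t)"
    using has_vector_derivative_continuous_log[OF has_vector_derivative_mult[OF db dw] S c(2) e(2)] log_product_identity(1)[OF nz(2,3)] by simp
  ultimately show ?thesis using ev_has_vector_derivative[OF dl db _ _ nz] by blast
qed

lemma sm_exterior_inverse:
  assumes "sm (ball 0 r) g" "1 < r"
  shows "sm {z. 1 / r < norm z} (\<lambda>x z. g x (1 / z))"
proof (rule sm_compose[OF assms(1)])
  show "(\<lambda>z. 1 / z) holomorphic_on {z. 1 / r < norm z}"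
    using inverse_mem_ball(2)[OF assms(2)] by (intro holomorphic_intros) auto
  show "(\<lambda>z. 1 / z) ` {z::complex. 1 / r < norm z} \<subseteq> ball 0 r"
    using inverse_mem_ball(1)[OF assms(2)] by blast
qed

context loop_rep
begin

text \<open>PA and RA extend \<open>log1p\<close> and \<open>log_lamb_w\<close> to the annulus. The
  ingredients of the latter are pinned down together on the circle only, while a z-derivative needs
  a full neighbourhood.\<close>

definition PA :: "real \<Rightarrow> complex \<Rightarrow> complex" where "PA x z = logwz (\<gamma> x) z - Hl x (1 / z)"
definition RA :: "real \<Rightarrow> complex \<Rightarrow> complex" where "RA x z = Kl x z + logwz (\<gamma> x) z"
definition evA :: "expr \<Rightarrow> real \<Rightarrow> complex \<Rightarrow> complex" where
  "evA e x z = ev e (lam (\<gamma> x) z) (lamb (\<gamma> x) z) (PA x z) (RA x z)"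

lemma nonzero_exterior: "1 / R < norm (z::complex) \<Longrightarrow> z \<noteq> 0"
  using R by auto

lemma Ann_exterior: "z \<in> Ann R \<Longrightarrow> 1 / R < norm z" and Ann_punctured: "z \<in> Ann R \<Longrightarrow> z \<in> ball 0 R - {0}"
  using Ann_nonzero[OF R] by (auto simp: Ann_def)

lemma sm_lam: "sm {z. 1 / R < norm z} (\<lambda>x. lam (\<gamma> x))"
  by (rule sm_cong_on[OF sm_mult[OF sm_hol[OF holomorphic_on_ident] sm_exterior_inverse[OF h R]]]) (simp add: lam_eq)

lemma sm_lamb: "sm (ball 0 R - {0}) (\<lambda>x. lamb (\<gamma> x))"
proof (rule sm_cong_on)
  show "sm (ball 0 R - {0}) (\<lambda>x z. k x z / z)"
    by (intro sm_divide sm_subset[OF k] sm_hol[OF holomorphic_on_ident]) auto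
qed (simp add: lamb_eq)

lemma sm_lam_Ann: "sm (Ann R) (\<lambda>x. lam (\<gamma> x))"
  by (rule sm_subset[OF sm_lam]) (use Ann_exterior in blast)

lemma sm_lamb_Ann: "sm (Ann R) (\<lambda>x. lamb (\<gamma> x))"
  by (rule sm_subset[OF sm_lamb]) (use Ann_punctured in blast)

lemma sm_wfun: "sm (Ann R) (\<lambda>x. wfun (\<gamma> x))"
  unfolding wfun_def[abs_def] by (intro sm_add sm_lam_Ann sm_lamb_Ann)

lemma lam_nz: "1 / R < norm z \<Longrightarrow> lam (\<gamma> x) z \<noteq> 0"
  using lam_eq[of z x] h_nz[of "1 / z" x] inverse_in_ball[of z] nonzero_exterior[of z] by auto

lemma lamb_nz: "z \<in> ball 0 R - {0} \<Longrightarrow> lamb (\<gamma> x) z \<noteq> 0"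
  using lamb_eq[of z x] k_nz[of z x] by auto

lemma wfun_nz: "z \<in> Ann R \<Longrightarrow> wfun (\<gamma> x) z \<noteq> 0"
  using exp_L[of z x] by (metis divide_eq_0_iff exp_not_eq_zero)

lemma sm_Kl_Ann: "sm (Ann R) Kl" and sm_Hl_Ann: "sm (Ann R) (\<lambda>x z. Hl x (1 / z))"
  by (rule sm_subset[OF Kl(1) Ann_ball], rule sm_subset[OF sm_exterior_inverse[OF Hl(1) R]]) (use Ann_exterior in blast)

lemma sm_PA: "sm (Ann R) PA" and sm_RA: "sm (Ann R) RA"
  unfolding PA_def[abs_def] RA_def[abs_def] by (intro sm_diff sm_add L sm_Kl_Ann sm_Hl_Ann)+

lemma exp_PA: "z \<in> Ann R \<Longrightarrow> exp (PA x z) = wfun (\<gamma> x) z / lam (\<gamma> x) z"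
  using exp_L[of z x] Hl(2)[of "1 / z" x] inverse_in_ball[OF Ann_exterior] lam_eq[OF Ann_exterior] nonzero_exterior[OF Ann_exterior]
  by (auto simp: PA_def exp_diff)

lemma exp_RA: "z \<in> Ann R \<Longrightarrow> exp (RA x z) = lamb (\<gamma> x) z * wfun (\<gamma> x) z"
  using exp_L[of z x] Kl(2)[of z x] Ann_punctured[of z] lamb_eq[of z x]
  by (auto simp: RA_def exp_add)

lemma sm_evA: "sm (Ann R) (evA e)"
  unfolding evA_def[abs_def]
  by (rule sm_ev[OF sm_lam_Ann sm_lamb_Ann sm_PA sm_RA])
    (use lam_nz lamb_nz wfun_nz Ann_exterior Ann_punctured in \<open>auto simp: wfun_def\<close>)

lemma evA_has_field_derivative:
  assumes z: "z \<in> Ann R"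
  shows "(evA e x has_field_derivative evA (d1 e) x z * deriv (lam (\<gamma> x)) z + evA (d2 e) x z * deriv (lamb (\<gamma> x)) z) (at z)"
proof -
  have nz: "lam (\<gamma> x) z \<noteq> 0" "lamb (\<gamma> x) z \<noteq> 0" "lam (\<gamma> x) z + lamb (\<gamma> x) z \<noteq> 0"
    using lam_nz lamb_nz wfun_nz[OF z, of x] Ann_exterior[OF z] Ann_punctured[OF z] by (auto simp: wfun_def)
  have dl: "(lam (\<gamma> x) has_field_derivative deriv (lam (\<gamma> x)) z) (at z)"
    and db: "(lamb (\<gamma> x) has_field_derivative deriv (lamb (\<gamma> x)) z) (at z)"
    using holomorphic_derivI[OF sm_holo[OF sm_lam_Ann] open_Ann z] holomorphic_derivI[OF sm_holo[OF sm_lamb_Ann] open_Ann z] by blast+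
  have dw: "(wfun (\<gamma> x) has_field_derivative deriv (lam (\<gamma> x)) z + deriv (lamb (\<gamma> x)) z) (at z)"
    unfolding wfun_def[abs_def] by (rule DERIV_add[OF dl db])
  have P: "(PA x has_field_derivative (deriv (lam (\<gamma> x)) z + deriv (lamb (\<gamma> x)) z) / (lam (\<gamma> x) z + lamb (\<gamma> x) z) - deriv (lam (\<gamma> x)) z / lam (\<gamma> x) z) (at z)"
    using has_field_derivative_continuous_log[OF DERIV_divide[OF dw dl nz(1)] open_Ann z holomorphic_on_imp_continuous_on[OF sm_holo[OF sm_PA]] exp_PA]
      log_quotient_identity[OF nz(1,3)] by (simp add: wfun_def)
  have Q: "(RA x has_field_derivative deriv (lamb (\<gamma> x)) z / lamb (\<gamma> x) z + (deriv (lam (\<gamma> x)) z + deriv (lamb (\<gamma> x)) z) / (lam (\<gamma> x) z + lamb (\<gamma> x) z)) (at z)"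
    using has_field_derivative_continuous_log[OF DERIV_mult[OF db dw] open_Ann z holomorphic_on_imp_continuous_on[OF sm_holo[OF sm_RA]] exp_RA]
      log_product_identity(2)[OF nz(2,3)] by (simp add: wfun_def)
  show ?thesis
    unfolding evA_def[abs_def] by (rule ev_has_field_derivative[OF dl db P Q nz])
qed

lemma evA_has_vector_derivative:
  assumes z: "z \<in> Ann R"
  shows "((\<lambda>x. evA e x z) has_vector_derivative evA (d1 e) x z * dx (\<lambda>x. lam (\<gamma> x)) x z + evA (d2 e) x z * dx (\<lambda>x. lamb (\<gamma> x)) x z) (at x)"
proof -
  have nz: "lam (\<gamma> x) z \<noteq> 0" "lamb (\<gamma> x) z \<noteq> 0" "lam (\<gamma> x) z + lamb (\<gamma> x) z \<noteq> 0"
    using lam_nz lamb_nz wfun_nz[OF z, of x] Ann_exterior[OF z] Ann_punctured[OF z] by (auto simp: wfun_def)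
  show ?thesis unfolding evA_def
    by (rule ev_log_has_vector_derivative[OF sm_dx(2)[OF sm_lam_Ann z] sm_dx(2)[OF sm_lamb_Ann z] open_UNIV UNIV_I
        sm_contx[OF sm_PA z] sm_contx[OF sm_RA z] _ _ nz])
      (use exp_PA[OF z] exp_RA[OF z] in \<open>auto simp: wfun_def\<close>)
qed

lemma dx_evA:
  "z \<in> Ann R \<Longrightarrow> dx (evA e) x z = evA (d1 e) x z * dx (\<lambda>x. lam (\<gamma> x)) x z + evA (d2 e) x z * dx (\<lambda>x. lamb (\<gamma> x)) x z"
  by (rule dx_eqI) (rule evA_has_vector_derivative)

text \<open>Within each bracket the terms with a repeated partial derivative cancel. What remains is
  a mixed partial derivative times \<open>lam_z lamb_x - lamb_z lam_x\<close>, with opposite signs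
  in the two brackets, and the mixed derivatives agree by \<open>ev_d1_d2\<close>.\<close>

lemma bracket_evA:
  assumes "z \<in> Ann R"
  shows "bracket (\<lambda>x. lam (\<gamma> x)) (evA (d1 e)) x z + bracket (\<lambda>x. lamb (\<gamma> x)) (evA (d2 e)) x z = 0"
  unfolding bracket_dx DERIV_imp_deriv[OF evA_has_field_derivative[OF assms]] dx_evA[OF assms]
  by (simp add: evA_def ev_d1_d2 algebra_simps)

lemma circle_in_Ann: "z \<in> circle \<Longrightarrow> z \<in> Ann R"
  using circle_Ann[OF R] by blast

lemma circle_logs:
  assumes "z \<in> circle"
  shows "log1p (\<gamma> x) z = PA x z" "log_lamb_w (\<gamma> x) z = RA x z"
  using assms by (auto simp: log1p_def log_lamb_w_def PA_def RA_def log_lam_eq log_lamb_eq)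

lemma Q_eq:
  assumes "z \<in> circle"
  shows "Q a p (\<gamma> x) z = evA (qexp a p) x z"
  using ev_qexp[of "\<gamma> x" z a p] lam_nz lamb_nz circle_in_Ann[OF assms] Ann_exterior Ann_punctured
  by (simp add: evA_def circle_logs[OF assms])

lemma theta_coeff_eq: "theta_coeff a q (\<gamma> x) = cint (evA (texp a q) x)"
proof -
  have c: "continuous_on circle (f x)" if "sm (Ann R) f" for f
    using holomorphic_on_imp_continuous_on[OF sm_holo[OF that]] continuous_on_subset circle_Ann[OF R] by blast
  have "theta_coeff a q (\<gamma> x) = cint (\<lambda>z. ev (texp a q) (lam (\<gamma> x) z) (lamb (\<gamma> x) z) (log1p (\<gamma> x) z) (log_lamb_w (\<gamma> x) z))"
  proof (rule theta_coeff_texp)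
    show "continuous_on circle (log1p (\<gamma> x))" "continuous_on circle (log_lamb_w (\<gamma> x))"
      by (rule continuous_on_eq[OF c[OF sm_PA]], simp add: circle_logs)
        (rule continuous_on_eq[OF c[OF sm_RA]], simp add: circle_logs)
  qed (use c[OF sm_lam_Ann] c[OF sm_lamb_Ann] lam_nz lamb_nz wfun_nz circle_in_Ann Ann_exterior Ann_punctured in blast)+
  also have "\<dots> = cint (evA (texp a q) x)"
    by (rule cint_cong) (simp add: evA_def circle_logs)
  finally show ?thesis .
qed

lemma Hl_per: "z \<in> ball 0 R \<Longrightarrow> Hl (x + 2 * pi) z = Hl x z"
  by (rule logs_eq[of "ball 0 R" "Hl (x + 2 * pi)" "Hl x" 0])
    (use R in \<open>auto simp: Hl h_per intro!: holomorphic_on_imp_continuous_on sm_holo[OF Hl(1)]\<close>)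

lemma Kl_per:
  assumes "\<And>x. ucoord (\<gamma> (x + 2 * pi)) = ucoord (\<gamma> x)" "z \<in> ball 0 R"
  shows "Kl (x + 2 * pi) z = Kl x z"
  by (rule logs_eq[of "ball 0 R" "Kl (x + 2 * pi)" "Kl x" 0])
    (use R assms in \<open>auto simp: Kl k_per intro!: holomorphic_on_imp_continuous_on sm_holo[OF Kl(1)]\<close>)

end

text \<open>\<open>ELogR\<close> is the only atom through which u enters other than by
  \<open>exp u\<close>. Expressions free of it are periodic in x even if u winds, which is why
  \<open>flow_defined\<close> restricts the index V alone.\<close>

primrec noR :: "expr \<Rightarrow> bool" where
  "noR ELam = True" | "noR ELamb = True" | "noR EInvLam = True" | "noR EInvLamb = True"
| "noR EInvW = True" | "noR ELogP = True" | "noR ELogR = False" | "noR (EConst c) = True"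
| "noR (EAdd e f) = (noR e \<and> noR f)" | "noR (EMul e f) = (noR e \<and> noR f)"

lemma ev_noR: "noR e \<Longrightarrow> ev e l b P R = ev e l b P R'"
  by (induction e) auto

lemma noR_d: "noR e \<Longrightarrow> noR (d1 e)" "noR e \<Longrightarrow> noR (d2 e)"
  by (induction e) auto

lemma noR_epow: "noR e \<Longrightarrow> noR (epow e n)"
  by (induction n) auto

lemma noR_texp: "a \<noteq> V \<Longrightarrow> noR (texp a q)"
  by (cases a) (auto simp: ewpow_def intro!: noR_epow)

section \<open>The Toda vector field in disc coordinates\<close>

locale flow = loop_rep +
  fixes a :: idx and p :: nat
  assumes fd: "flow_defined a \<gamma>"
begin

lemma evA_per:
  assumes "a \<noteq> V \<Longrightarrow> noR e" "z \<in> Ann R"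
  shows "evA e (x + 2 * pi) z = evA e x z"
proof -
  have "lam (\<gamma> (x + 2 * pi)) z = lam (\<gamma> x) z" "lamb (\<gamma> (x + 2 * pi)) z = lamb (\<gamma> x) z"
    using assms(2) lam_eq[OF Ann_exterior] lamb_eq[OF Ann_punctured] h_per k_per inverse_in_ball[OF Ann_exterior] Ann_punctured by auto
  moreover have "PA (x + 2 * pi) z = PA x z"
    using L_per Hl_per inverse_in_ball[OF Ann_exterior] assms(2) by (simp add: PA_def)
  moreover have "RA (x + 2 * pi) z = RA x z" if "a = V"
    using L_per Kl_per Ann_punctured assms(2) that fd by (simp add: RA_def flow_defined_def)
  ultimately show ?thesis unfolding evA_def using ev_noR[OF assms(1)] by metis
qed

text \<open>Strictly between 1 and R, so that both Cauchy circles of the Laurent splitting lie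
  inside \<open>Ann R\<close>.\<close>

definition rr :: real where "rr = (1 + R) / 2"

lemma rr: "1 < rr" "rr < R" using R by (auto simp: rr_def)

definition TE :: expr where "TE = texp a (Suc p)"
definition Qs :: "real \<Rightarrow> complex \<Rightarrow> complex" where "Qs = evA (qexp a p)"
definition qp :: "real \<Rightarrow> complex \<Rightarrow> complex" where "qp x = qpart rr (Qs x)"
definition pm :: "real \<Rightarrow> complex \<Rightarrow> complex" where "pm x = ppart rr (Qs x)"

lemma sm_Qs: "sm (Ann R) Qs" unfolding Qs_def by (rule sm_evA)
lemma sm_qp: "sm (ball 0 rr) qp" unfolding qp_def[abs_def] by (rule sm_qpart[OF sm_Qs rr])
lemma sm_pm: "sm (ball 0 rr) pm" unfolding pm_def[abs_def] by (rule sm_ppart[OF sm_Qs rr])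

lemma Qs_per: "z \<in> Ann R \<Longrightarrow> Qs (x + 2 * pi) z = Qs x z"
  unfolding Qs_def by (rule evA_per) (use noR_d noR_texp in \<open>auto simp: qexp_def\<close>)

lemma qp_per: "qp (x + 2 * pi) = qp x" and pm_per: "pm (x + 2 * pi) = pm x"
  unfolding qp_def pm_def qpart_def ppart_def
  by (auto intro!: ext cint_cong simp: Qs_per scaled_circle_Ann[OF rr, simplified])

lemma Qs_split: "z \<in> Ann rr \<Longrightarrow> Qs x z = qp x z + pm x (1 / z) / z"
  unfolding qp_def pm_def by (rule Laurent_split[OF sm_holo[OF sm_Qs] rr])

lemma Qs_diff: "Qs x z = evA (d2 TE) x z - evA (d1 TE) x z"
  by (simp add: Qs_def evA_def qexp_def TE_def)

lemma Q_circle: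
  assumes "z \<in> circle" shows "Q a p (\<gamma> x) z = qp x z + pm x (1 / z) / z"
  using Q_eq[OF assms] Qs_split[of z x] circle_Ann[OF rr(1)] assms by (auto simp: Qs_def)

lemma plus_part_Q: "z \<in> ball 0 rr \<Longrightarrow> plus_part (Q a p (\<gamma> x)) z = qp x z"
  by (rule plus_part_Laurent[OF sm_holo[OF sm_qp] sm_holo[OF sm_pm] rr(1) Q_circle])

lemma minus_part_Q: "1 / rr < norm z \<Longrightarrow> minus_part (Q a p (\<gamma> x)) z = pm x (1 / z) / z"
  by (rule minus_part_Laurent[OF sm_holo[OF sm_qp] sm_holo[OF sm_pm] rr(1) Q_circle])
    (use inverse_mem_ball[OF rr(1)] in auto)

text \<open>With \<open>\<lambda> = z h(1/z)\<close>, \<open>\<lambda>bar = k(z)/z\<close> and \<open>Q\<^sub>- = pm(1/z)/z\<close>, the two Poisson brackets of the Toda flow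
  are \<open>X1(1/z)\<close> and \<open>X2(z)/z\<close>; in these coordinates the pole orders at infinity and at the origin
  can be read off.\<close>

definition X1 :: "real \<Rightarrow> complex \<Rightarrow> complex" where
  "X1 x z = (pm x z + z * deriv (pm x) z) * dx h x z + (h x z - z * deriv (h x) z) * dx pm x z"

definition X2 :: "real \<Rightarrow> complex \<Rightarrow> complex" where
  "X2 x z = z * (deriv (qp x) z * dx k x z - deriv (k x) z * dx qp x z) + k x z * dx qp x z"

definition X0 :: tangent_loop where "X0 = (\<lambda>x z. X1 x (1 / z), \<lambda>x z. X2 x z / z)"

lemma sm_h_rr: "sm (ball 0 rr) h" and sm_k_rr: "sm (ball 0 rr) k"
  by (rule sm_subset[OF h], use rr in auto, rule sm_subset[OF k], use rr in auto)

lemma sm_X1: "sm (ball 0 rr) X1" and sm_X2: "sm (ball 0 rr) X2"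
  unfolding X1_def[abs_def] X2_def[abs_def]
  by (intro sm_add sm_mult sm_diff sm_deriv sm_dx(1) sm_hol[OF holomorphic_on_ident] sm_pm sm_qp sm_h_rr sm_k_rr open_ball)+

text \<open>The factors \<open>- 1 / z^2\<close> from the chain rule are balanced by the factor z of
  the bracket and the leading z of \<open>lam\<close>. The result is a function of
  \<open>1 / z\<close> holomorphic at 0, so the flow stays bounded at infinity although
  \<open>lam\<close> grows.\<close>

lemma exterior_bracket:
  assumes z: "1 / rr < norm z"
  shows "bracket (\<lambda>x z. - (pm x (1 / z) / z)) (\<lambda>x. lam (\<gamma> x)) x z = X1 x (1 / z)"
proof -
  have nz: "z \<noteq> 0" and iz: "1 / z \<in> ball 0 rr" using inverse_mem_ball[OF rr(1) z] by auto
  have "1 / R < 1 / rr" using rr by (simp add: frac_less2)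
  then have zR: "1 / R < norm z" using z by linarith
  have dinv: "((\<lambda>z. 1 / z) has_field_derivative - 1 / z\<^sup>2) (at z)"
    using DERIV_inverse[OF nz] by (simp add: divide_inverse power2_eq_square numeral_2_eq_2)
  have chain: "((\<lambda>z. g (1 / z)) has_field_derivative deriv g (1 / z) * (- 1 / z\<^sup>2)) (at z)" if "g holomorphic_on ball 0 rr" for g
    using DERIV_chain2[OF holomorphic_derivI[OF that open_ball iz] dinv] .
  have "((\<lambda>z. - (pm x (1 / z) / z)) has_field_derivative
     - ((deriv (pm x) (1 / z) * (- 1 / z\<^sup>2) * z - pm x (1 / z) * 1) / (z * z))) (at z)"
    by (intro DERIV_minus DERIV_divide chain sm_holo[OF sm_pm] DERIV_ident nz)
  then have 1: "deriv (\<lambda>z. - (pm x (1 / z) / z)) z = (deriv (pm x) (1 / z) / z + pm x (1 / z)) / (z * z)"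
    by (subst DERIV_imp_deriv) (use nz in \<open>auto simp: power2_eq_square field_simps\<close>)
  have "((\<lambda>z. z * h x (1 / z)) has_field_derivative 1 * h x (1 / z) + deriv (h x) (1 / z) * (- 1 / z\<^sup>2) * z) (at z)"
    by (intro DERIV_mult DERIV_ident chain sm_holo[OF sm_h_rr])
  then have 2: "deriv (lam (\<gamma> x)) z = h x (1 / z) - deriv (h x) (1 / z) / z"
    using deriv_cong_open[OF open_norm_exterior[of "1 / R"], of z "lam (\<gamma> x)" "\<lambda>z. z * h x (1 / z)"] zR lam_eq nz
    by (simp add: DERIV_imp_deriv power2_eq_square)
  have "((\<lambda>x. z * h x (1 / z)) has_vector_derivative z * dx h x (1 / z)) (at x)"
    by (intro has_vector_derivative_mult_right sm_dx(2)[OF sm_h_rr iz])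
  then have 3: "dx (\<lambda>x. lam (\<gamma> x)) x z = z * dx h x (1 / z)"
    using lam_eq[OF zR] by (intro dx_eqI) simp
  have "((\<lambda>x. pm x (1 / z) * (- 1 / z)) has_vector_derivative dx pm x (1 / z) * (- 1 / z)) (at x)"
    by (intro has_vector_derivative_mult_left sm_dx(2)[OF sm_pm iz])
  then have 4: "dx (\<lambda>x z. - (pm x (1 / z) / z)) x z = - (dx pm x (1 / z) / z)"
    by (intro dx_eqI) simp
  show ?thesis
    unfolding bracket_dx 1 2 3 4 X1_def using nz by (simp add: field_simps)
qed

lemma interior_bracket:
  assumes z: "z \<in> ball 0 rr - {0}"
  shows "bracket qp (\<lambda>x. lamb (\<gamma> x)) x z = X2 x z / z"
proof -
  have zR: "z \<in> ball 0 R - {0}" and nz: "z \<noteq> 0" and zr: "z \<in> ball 0 rr" using z rr by auto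
  have "((\<lambda>z. k x z / z) has_field_derivative (deriv (k x) z * z - k x z * 1) / (z * z)) (at z)"
    by (intro DERIV_divide DERIV_ident nz holomorphic_derivI[OF sm_holo[OF sm_k_rr] open_ball zr])
  then have 1: "deriv (lamb (\<gamma> x)) z = (deriv (k x) z * z - k x z) / (z * z)"
    using deriv_cong_open[of "ball 0 R - {0}" z "lamb (\<gamma> x)" "\<lambda>z. k x z / z"] zR lamb_eq
    by (simp add: DERIV_imp_deriv open_delete)
  have "((\<lambda>x. k x z * (1 / z)) has_vector_derivative dx k x z * (1 / z)) (at x)"
    by (intro has_vector_derivative_mult_left sm_dx(2)[OF sm_k_rr zr])
  then have 2: "dx (\<lambda>x. lamb (\<gamma> x)) x z = dx k x z / z"
    using lamb_eq[OF zR] by (intro dx_eqI) simp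
  show ?thesis
    unfolding bracket_dx 1 2 X2_def using nz by (simp add: field_simps)
qed

end

section \<open>Tangent loops in disc coordinates\<close>

lemma LTM0_I:
  assumes r: "1 < r" and K: "sm (ball 0 r) K" "sm (ball 0 r) Kb"
    and per: "\<And>x z. z \<in> ball 0 r \<Longrightarrow> K (x + 2 * pi) z = K x z" "\<And>x z. z \<in> ball 0 r \<Longrightarrow> Kb (x + 2 * pi) z = Kb x z"
  shows "(\<lambda>x z. K x (1 / z), \<lambda>x z. Kb x z / z) \<in> LTM0"
proof -
  have s1: "sm {z. 1 / r < norm z} (\<lambda>x z. K x (1 / z))" by (rule sm_exterior_inverse[OF K(1) r])
  have s2: "sm (ball 0 r - {0}) (\<lambda>x z. Kb x z / z)"
    by (intro sm_divide sm_subset[OF K(2)] sm_hol[OF holomorphic_on_ident]) auto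
  have sub: "Dinf \<subseteq> {z. 1 / r < norm z}" "D0p \<subseteq> ball 0 r - {0}" using Dinf_exterior[OF r] r by auto
  have op: "open {z::complex. 1 / r < norm z}" "open (ball (0::complex) r - {0})"
    by (rule open_norm_exterior, simp add: open_delete)
  have "smooth_loop Dinf (\<lambda>x z. K x (1 / z))"
    unfolding smooth_loop_def smooth_germ_iff_sm
    using s1 sub op per(1) inverse_mem_ball[OF r] Dinf_exterior[OF r] by blast
  moreover have "smooth_loop D0p (\<lambda>x z. Kb x z / z)"
    unfolding smooth_loop_def smooth_germ_iff_sm
  proof (intro conjI)
    show "\<exists>U. open U \<and> D0p \<subseteq> U \<and> sm U (\<lambda>x z. Kb x z / z)" using s2 sub op by blast
    show "\<forall>x. \<forall>z\<in>D0p. Kb (x + 2 * pi) z / z = Kb x z / z" using per(2) r by auto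
  qed
  moreover have "hol_Dinf (\<lambda>z. K x (1 / z))" for x
    unfolding hol_Dinf_def
  proof
    show "(\<lambda>z. K x (1 / z)) analytic_on Dinf"
      using sm_holo[OF s1] op(1) sub(1) analytic_on_holomorphic by blast
    have "isCont (K x) 0"
      using holomorphic_on_imp_continuous_on[OF sm_holo[OF K(1), of x]] r by (simp add: continuous_on_eq_continuous_at)
    from tendsto_inverse_arg_at_infinity[OF this]
    show "(\<lambda>z. K x (1 / z)) \<in> O[at_infinity](\<lambda>_. 1)" by (intro bigoI_tendsto[where c = "K x 0"]) auto
  qed
  moreover have "hol_inv_D0 (\<lambda>z. Kb x z / z)" for x
    unfolding hol_inv_D0_def
  proof (intro conjI exI[of _ "Kb x"])
    show "(\<lambda>z. Kb x z / z) analytic_on D0p" using sm_holo[OF s2] op(2) sub(2) analytic_on_holomorphic by blast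
    show "Kb x analytic_on cball 0 1"
      by (rule analytic_on_subset[of _ "ball 0 r"]) (use sm_holo[OF K(2), of x] r in \<open>auto simp: analytic_on_open\<close>)
  qed auto
  ultimately show ?thesis by (simp add: LTM0_def)
qed

lemma LTM0_rep:
  assumes "X \<in> LTM0"
  obtains r K Kb where "1 < r" "sm (ball 0 r) K" "sm (ball 0 r) Kb"
    "\<And>x z. 1 / r < norm z \<Longrightarrow> fst X x z = K x (1 / z)"
    "\<And>x z. z \<in> ball 0 r - {0} \<Longrightarrow> snd X x z = Kb x z / z"
    "\<And>x z. z \<in> ball 0 r \<Longrightarrow> K (x + 2 * pi) z = K x z" "\<And>x z. z \<in> ball 0 r \<Longrightarrow> Kb (x + 2 * pi) z = Kb x z"
proof -
  have X: "smooth_loop Dinf (fst X)" "smooth_loop D0p (snd X)" "\<And>x. hol_Dinf (fst X x)" "\<And>x. hol_inv_D0 (snd X x)"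
    using assms by (auto simp: LTM0_def)
  obtain D1 where D1: "open D1" "Dinf \<subseteq> D1" "sm D1 (fst X)"
    using X(1) unfolding smooth_loop_def smooth_germ_iff_sm by blast
  obtain D2 where D2: "open D2" "D0p \<subseteq> D2" "sm D2 (snd X)"
    using X(2) unfolding smooth_loop_def smooth_germ_iff_sm by blast
  have per: "\<And>x z. z \<in> Dinf \<Longrightarrow> fst X (x + 2 * pi) z = fst X x z" "\<And>x z. z \<in> D0p \<Longrightarrow> snd X (x + 2 * pi) z = snd X x z"
    using X(1,2) unfolding smooth_loop_def by blast+
  obtain r1 K where r1: "1 < r1" "sm (ball 0 r1) K" "\<And>x z. 1 / r1 < norm z \<Longrightarrow> fst X x z = K x (1 / z)"
    using sm_exterior[OF D1] X(3) unfolding hol_Dinf_def by metis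
  obtain r2 Kb where r2: "1 < r2" "sm (ball 0 r2) Kb" "\<And>x z. z \<in> ball 0 r2 - {0} \<Longrightarrow> snd X x z = Kb x z / z"
    using sm_interior[OF D2 X(4)] by metis
  define r where "r = min r1 r2"
  have r: "1 < r" "r \<le> r1" "r \<le> r2" using r1 r2 by (auto simp: r_def)
  have K: "sm (ball 0 r) K" "sm (ball 0 r) Kb"
    by (rule sm_subset[OF r1(2)], use r in auto, rule sm_subset[OF r2(2)], use r in auto)
  have inv: "1 / r1 \<le> 1 / r" using r r1 by (simp add: frac_le)
  have eq: "fst X x z = K x (1 / z)" if "1 / r < norm z" for x z
    by (rule r1(3)) (use that inv in linarith)
  have eqb: "snd X x z = Kb x z / z" if "z \<in> ball 0 r - {0}" for x z
    by (rule r2(3)) (use that r in auto)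
  have p1: "K (x + 2 * pi) z = K x z" if "z \<in> ball 0 r" for x z
  proof (rule holomorphic_eq_on_ball[OF sm_holo[OF K(1)] sm_holo[OF K(1)] r(1) _ that])
    fix z :: complex assume z: "z \<in> circle"
    then have "1 / r < norm (1 / z)" "1 / z \<in> Dinf" "1 / (1 / z) = z" using r(1) by (auto simp: norm_divide)
    then show "K (x + 2 * pi) z = K x z" using eq[of "1 / z"] per(1)[of "1 / z"] by simp
  qed
  have p2: "Kb (x + 2 * pi) z = Kb x z" if "z \<in> ball 0 r" for x z
  proof (rule holomorphic_eq_on_ball[OF sm_holo[OF K(2)] sm_holo[OF K(2)] r(1) _ that])
    fix z :: complex assume z: "z \<in> circle"
    then have "z \<in> ball 0 r - {0}" "z \<in> D0p" "z \<noteq> 0" using r(1) by auto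
    then show "Kb (x + 2 * pi) z = Kb x z" using eqb[of z x] eqb[of z "x + 2 * pi"] per(2)[of z x] by simp
  qed
  show thesis by (rule that[OF r(1) K eq eqb p1 p2])
qed

lemma holomorphic_factor_0:
  assumes "f holomorphic_on ball 0 r"
  obtains g where "g holomorphic_on ball 0 r" "\<And>z. z \<in> ball 0 r \<Longrightarrow> f z = f 0 + z * g z" "g 0 = deriv f 0"
proof
  show "(\<lambda>z. if z = 0 then deriv f 0 else (f z - f 0) / (z - 0)) holomorphic_on ball 0 r"
    by (rule pole_lemma_open[OF assms]) simp
qed auto

lemma lcoeff_cong: "(\<And>z. z \<in> circle \<Longrightarrow> f z = g z) \<Longrightarrow> lcoeff f n = lcoeff g n"
  unfolding lcoeff_def by (rule cint_cong) simp

text \<open>The w-component \<open>K(1/z) + B(z)/z\<close> loses information only in the powers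
  \<open>z^0\<close> and \<open>z^(-1)\<close>, to which both summands contribute. Exactly these are
  supplied by the v- and u-components: they give \<open>B'(0)\<close> and \<open>B(0)\<close>. After
  removing them, the difference is a Laurent splitting of zero.\<close>

lemma coords_inject:
  assumes X: "X \<in> LTM0" and Y: "Y \<in> LTM0" and eq: "triple_eq (coords \<gamma> X x) (coords \<gamma> Y x)"
    and nz: "lcoeff (lamb (\<gamma> x)) (-1) \<noteq> 0"
  shows "z \<in> Dinf \<Longrightarrow> fst X x z = fst Y x z" "z \<in> D0p \<Longrightarrow> snd X x z = snd Y x z"
proof -
  obtain r1 K1 B1 where 1: "1 < r1" "sm (ball 0 r1) K1" "sm (ball 0 r1) B1"
    "\<And>x z. 1 / r1 < norm z \<Longrightarrow> fst X x z = K1 x (1 / z)" "\<And>x z. z \<in> ball 0 r1 - {0} \<Longrightarrow> snd X x z = B1 x z / z"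
    using LTM0_rep[OF X] by metis
  obtain r2 K2 B2 where 2: "1 < r2" "sm (ball 0 r2) K2" "sm (ball 0 r2) B2"
    "\<And>x z. 1 / r2 < norm z \<Longrightarrow> fst Y x z = K2 x (1 / z)" "\<And>x z. z \<in> ball 0 r2 - {0} \<Longrightarrow> snd Y x z = B2 x z / z"
    using LTM0_rep[OF Y] by metis
  define r where "r = min r1 r2"
  have r: "1 < r" "r \<le> r1" "r \<le> r2" using 1(1) 2(1) by (auto simp: r_def)
  define K where "K z = K1 x z - K2 x z" for z
  define B where "B z = B1 x z - B2 x z" for z
  have sub: "ball 0 r \<subseteq> ball (0::complex) r1" "ball 0 r \<subseteq> ball (0::complex) r2" using r by auto
  have hol: "K holomorphic_on ball 0 r" "B holomorphic_on ball 0 r"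
    unfolding K_def[abs_def] B_def[abs_def]
    by (intro holomorphic_on_diff; (rule holomorphic_on_subset[OF sm_holo[OF 1(2)] sub(1)] holomorphic_on_subset[OF sm_holo[OF 2(2)] sub(2)]
       holomorphic_on_subset[OF sm_holo[OF 1(3)] sub(1)] holomorphic_on_subset[OF sm_holo[OF 2(3)] sub(2)]))+
  have e1: "fst X x z - fst Y x z = K (1 / z)" if "z \<in> Dinf" for z
    using 1(4)[OF Dinf_exterior[OF 1(1) that]] 2(4)[OF Dinf_exterior[OF 2(1) that]] by (simp add: K_def)
  have e2: "snd X x z - snd Y x z = B z / z" if "z \<in> D0p" for z
    using 1(5)[of z x] 2(5)[of z x] that 1(1) 2(1) by (simp add: B_def diff_divide_distrib)
  have sum0: "K (1 / z) + B z / z = 0" if z: "z \<in> circle" for z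
  proof -
    have "fst X x z + snd X x z = fst Y x z + snd Y x z" using eq z by (auto simp: triple_eq_def coords_def)
    moreover have "z \<in> Dinf" "z \<in> D0p" using z by auto
    ultimately show ?thesis using e1[of z] e2[of z] by (simp add: algebra_simps)
  qed
  have l0: "lcoeff (snd X x) 0 = lcoeff (snd Y x) 0" and l1: "lcoeff (snd X x) (-1) = lcoeff (snd Y x) (-1)"
    using eq nz by (auto simp: triple_eq_def coords_def)
  have sX: "snd X x z = B1 x z / z" and sY: "snd Y x z = B2 x z / z" if "z \<in> circle" for z
  proof -
    have "z \<in> ball 0 r1 - {0}" "z \<in> ball 0 r2 - {0}" using 1(1) 2(1) that by auto
    then show "snd X x z = B1 x z / z" "snd Y x z = B2 x z / z" using 1(5) 2(5) by blast+
  qed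
  have B0: "B 0 = 0" "deriv B 0 = 0"
  proof -
    show "B 0 = 0"
      using l1 lcoeff_simple_pole(1)[OF sm_holo[OF 1(3)] 1(1), OF sX] lcoeff_simple_pole(1)[OF sm_holo[OF 2(3)] 2(1), OF sY]
      by (simp add: B_def)
    have "deriv (B1 x) 0 = deriv (B2 x) 0"
      using l0 lcoeff_simple_pole(2)[OF sm_holo[OF 1(3)] 1(1), OF sX] lcoeff_simple_pole(2)[OF sm_holo[OF 2(3)] 2(1), OF sY]
      by simp
    moreover have "deriv B 0 = deriv (B1 x) 0 - deriv (B2 x) 0"
      unfolding B_def[abs_def]
      by (rule deriv_diff) (use sm_holo[OF 1(3)] sm_holo[OF 2(3)] 1(1) 2(1) in \<open>auto intro!: holomorphic_on_imp_differentiable_at[of _ "ball 0 _"]\<close>)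
    ultimately show "deriv B 0 = 0" by simp
  qed
  obtain m where m: "m holomorphic_on ball 0 r" "\<And>z. z \<in> ball 0 r \<Longrightarrow> B z = B 0 + z * m z" "m 0 = deriv B 0"
    using holomorphic_factor_0[OF hol(2)] by metis
  obtain n where n: "n holomorphic_on ball 0 r" "\<And>z. z \<in> ball 0 r \<Longrightarrow> K z = K 0 + z * n z" "n 0 = deriv K 0"
    using holomorphic_factor_0[OF hol(1)] by metis
  have L: "(m z + K 0) + n (1 / z) / z = 0" if z: "z \<in> circle" for z
  proof -
    have z': "z \<noteq> 0" "z \<in> ball 0 r" "1 / z \<in> ball 0 r" using z r by (auto simp: norm_divide)
    then show ?thesis using sum0[OF z] m(2)[of z] n(2)[of "1 / z"] B0 by (simp add: algebra_simps)
  qed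
  have hm: "(\<lambda>z. m z + K 0) holomorphic_on ball 0 r" by (intro holomorphic_intros m)
  have m0: "m z + K 0 = 0" and n0: "n z = 0" if "z \<in> ball 0 r" for z
    using Laurent_unique[OF hm n(1) r(1) L that] by auto
  have K0: "K 0 = 0" using m0[of 0] m(3) B0 r by simp
  have Kz: "K z = 0" and Bz: "B z = 0" if "z \<in> ball 0 r" for z
    using m0[OF that] n0[OF that] m(2)[OF that] n(2)[OF that] K0 B0 by auto
  show "fst X x z = fst Y x z" if "z \<in> Dinf"
    using e1[OF that] Kz[of "1 / z"] inverse_mem_ball[OF r(1) Dinf_exterior[OF r(1) that]] by simp
  show "snd X x z = snd Y x z" if "z \<in> D0p"
    using e2[OF that] Bz[of z] that r by auto
qed

lemma bracket_cong:
  assumes "open D" "z \<in> D" "\<And>y w. w \<in> D \<Longrightarrow> f y w = f' y w" "\<And>y w. w \<in> D \<Longrightarrow> g y w = g' y w"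
  shows "bracket f g x z = bracket f' g' x z"
  unfolding bracket_dx
  using deriv_cong_open[OF assms(1,2) assms(3)[of _ x]] deriv_cong_open[OF assms(1,2) assms(4)[of _ x]]
    dx_cong[of f z f' x] dx_cong[of g z g' x] assms(2-4) by simp

context flow
begin

lemma deriv_periodic:
  assumes "\<And>x z. z \<in> ball 0 rr \<Longrightarrow> f (x + 2 * pi) z = f x z" "z \<in> ball 0 rr"
  shows "deriv (f (x + 2 * pi)) z = deriv (f x) z"
  by (rule deriv_cong_open[OF open_ball assms(2) assms(1)])

lemma h_per_rr: "z \<in> ball 0 rr \<Longrightarrow> h (x + 2 * pi) z = h x z" and k_per_rr: "z \<in> ball 0 rr \<Longrightarrow> k (x + 2 * pi) z = k x z"
  using h_per k_per rr by auto

lemma X0_LTM0: "X0 \<in> LTM0"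
  unfolding X0_def
proof (rule LTM0_I[OF rr(1) sm_X1 sm_X2])
  fix x and z :: complex assume z: "z \<in> ball 0 rr"
  have "deriv (h (x + 2 * pi)) z = deriv (h x) z" "deriv (k (x + 2 * pi)) z = deriv (k x) z"
    by (rule deriv_periodic[of h], use h_per_rr z in auto, rule deriv_periodic[of k], use k_per_rr z in auto)
  note d = this dx_periodic[of pm z, OF fun_cong[OF pm_per]] dx_periodic[of qp z, OF fun_cong[OF qp_per]]
    dx_periodic[of h z, OF h_per_rr[OF z]] dx_periodic[of k z, OF k_per_rr[OF z]]
  show "X1 (x + 2 * pi) z = X1 x z" "X2 (x + 2 * pi) z = X2 x z"
    unfolding X1_def X2_def d pm_per qp_per h_per_rr[OF z] k_per_rr[OF z] by simp_all
qed

lemma toda_X0: "toda_flow a p \<gamma> X0"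
  unfolding toda_flow_def
proof (intro allI conjI ballI)
  fix x z assume "z \<in> Dinf"
  then have z: "1 / rr < norm z" by (rule Dinf_exterior[OF rr(1)])
  have "bracket (\<lambda>y \<zeta>. - minus_part (Q a p (\<gamma> y)) \<zeta>) (\<lambda>y. lam (\<gamma> y)) x z = bracket (\<lambda>x z. - (pm x (1 / z) / z)) (\<lambda>x. lam (\<gamma> x)) x z"
    by (rule bracket_cong[OF open_norm_exterior[of "1 / rr"]]) (use z minus_part_Q in auto)
  then show "fst X0 x z = bracket (\<lambda>y \<zeta>. - minus_part (Q a p (\<gamma> y)) \<zeta>) (\<lambda>y. lam (\<gamma> y)) x z"
    using exterior_bracket[OF z] by (simp add: X0_def)
next
  fix x z assume "z \<in> D0p"
  then have z: "z \<in> ball 0 rr - {0}" using rr by auto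
  have "bracket (\<lambda>y. plus_part (Q a p (\<gamma> y))) (\<lambda>y. lamb (\<gamma> y)) x z = bracket qp (\<lambda>x. lamb (\<gamma> x)) x z"
    by (rule bracket_cong[OF open_ball[of 0 rr]]) (use z plus_part_Q in auto)
  then show "snd X0 x z = bracket (\<lambda>y. plus_part (Q a p (\<gamma> y))) (\<lambda>y. lamb (\<gamma> y)) x z"
    using interior_bracket[OF z] by (simp add: X0_def)
qed

lemma toda_flow_iff:
  "toda_flow a p \<gamma> X \<longleftrightarrow> (\<forall>x. (\<forall>z\<in>Dinf. fst X x z = fst X0 x z) \<and> (\<forall>z\<in>D0p. snd X x z = snd X0 x z))"
  using toda_X0 unfolding toda_flow_def by simp

definition om :: "real \<Rightarrow> triple" where
  "om x = (\<lambda>z. evA (d1 TE) x z + pm x (1 / z) / z, qp x 0, k x 0 * deriv (qp x) 0)"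

lemma Ann_rr: "z \<in> Ann rr \<Longrightarrow> z \<in> Ann R \<and> 1 / z \<in> ball 0 rr \<and> z \<in> ball 0 rr \<and> z \<noteq> 0 \<and> 1 / rr < norm z"
proof -
  assume z: "z \<in> Ann rr"
  then have n: "1 / rr < norm z" by (simp add: Ann_def)
  show ?thesis using Ann_mono[of rr R] rr z inverse_mem_ball[OF rr(1) n] n by (auto simp: Ann_def)
qed

lemma sm_om: "sm (Ann rr) (\<lambda>x z. evA (d1 TE) x z + pm x (1 / z) / z)"
proof (intro sm_add sm_divide)
  show "sm (Ann rr) (evA (d1 TE))" by (rule sm_subset[OF sm_evA]) (use Ann_rr in blast)
  show "sm (Ann rr) (\<lambda>x z. pm x (1 / z))" by (rule sm_subset[OF sm_exterior_inverse[OF sm_pm rr(1)]]) (use Ann_rr in blast)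
  show "sm (Ann rr) (\<lambda>x z. z)" by (intro sm_hol holomorphic_on_ident)
qed (use Ann_rr in auto)

lemma om_alt: "z \<in> Ann rr \<Longrightarrow> evA (d1 TE) x z + pm x (1 / z) / z = evA (d2 TE) x z - qp x z"
  using Qs_split[of z x] Qs_diff[of x z] by (simp add: algebra_simps)

lemma smooth_form_om: "smooth_form om"
proof -
  have 0: "(0::complex) \<in> ball 0 rr" using rr by simp
  have "smooth_loop circle (\<lambda>x. fst (om x))"
    unfolding smooth_loop_def smooth_germ_iff_sm
  proof (intro conjI allI ballI)
    show "\<exists>U. open U \<and> circle \<subseteq> U \<and> sm U (\<lambda>x. fst (om x))"
      using sm_om open_Ann circle_Ann[OF rr(1)] by (auto simp: om_def intro!: exI[of _ "Ann rr"])
    fix x z assume "z \<in> circle"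
    then have "z \<in> Ann R" by (rule circle_in_Ann)
    then have "evA (d1 TE) (x + 2 * pi) z = evA (d1 TE) x z"
      by (rule evA_per[rotated]) (simp add: TE_def noR_d noR_texp)
    then show "fst (om (x + 2 * pi)) z = fst (om x) z" by (simp add: om_def pm_per)
  qed
  moreover have "smooth_loop_fun (\<lambda>x. fst (snd (om x)))"
    using sm_smooth_fun[OF sm_qp 0] by (simp add: om_def smooth_loop_fun_def qp_per)
  moreover have "smooth_loop_fun (\<lambda>x. snd (snd (om x)))"
    using sm_smooth_fun[OF sm_mult[OF sm_k_rr sm_deriv[OF open_ball sm_qp]] 0] k_per_rr[OF 0]
    by (simp add: om_def smooth_loop_fun_def qp_per)
  ultimately show ?thesis by (simp add: smooth_form_def)
qed

text \<open>Each of the two forms of the first component is used with its own variable: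
  \<open>A + Q_-\<close> in the bracket with \<open>lam\<close>, and \<open>B - Q_+\<close> in the
  bracket with \<open>lamb\<close>. The terms in A and B cancel by \<open>bracket_evA\<close>, and
  the rest are the two Toda brackets.\<close>

lemma fst_X0_bracket:
  assumes z: "z \<in> Ann rr"
  shows "X1 x (1 / z) + X2 x z / z = bracket (\<lambda>y. wfun (\<gamma> y)) (\<lambda>y. fst (om y)) x z"
proof -
  note zz = Ann_rr[OF z]
  let ?M = "\<lambda>x z. pm x (1 / z) / z"
  let ?O = "\<lambda>x z. evA (d1 TE) x z + pm x (1 / z) / z"
  have sM: "sm (Ann rr) ?M"
    by (intro sm_divide sm_subset[OF sm_exterior_inverse[OF sm_pm rr(1)]] sm_hol[OF holomorphic_on_ident]) (use Ann_rr in auto)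
  have sA: "sm (Ann rr) (evA e)" for e by (rule sm_subset[OF sm_evA]) (use Ann_rr in blast)
  have sq: "sm (Ann rr) qp" by (rule sm_subset[OF sm_qp Ann_ball])
  have sl: "sm (Ann rr) (\<lambda>x. lam (\<gamma> x))" "sm (Ann rr) (\<lambda>x. lamb (\<gamma> x))"
    by (rule sm_subset[OF sm_lam_Ann], use Ann_rr in blast, rule sm_subset[OF sm_lamb_Ann], use Ann_rr in blast)
  have fd: "f x field_differentiable at z" if "sm (Ann rr) f" for f
    using holomorphic_on_imp_differentiable_at[OF sm_holo[OF that] open_Ann z] .
  note vd = sm_dx(2)[OF _ z]
  have O1: "deriv (?O x) z = deriv (evA (d1 TE) x) z + deriv (?M x) z" "dx ?O x z = dx (evA (d1 TE)) x z + dx ?M x z"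
    by (rule deriv_add[OF fd[OF sA] fd[OF sM]], rule dx_eqI, rule has_vector_derivative_add[OF vd[OF sA] vd[OF sM]])
  have O2: "deriv (?O x) z = deriv (evA (d2 TE) x) z - deriv (qp x) z" "dx ?O x z = dx (evA (d2 TE)) x z - dx qp x z"
  proof -
    have "deriv (?O x) z = deriv (\<lambda>z. evA (d2 TE) x z - qp x z) z"
      by (rule deriv_cong_open[OF open_Ann z om_alt])
    also have "\<dots> = deriv (evA (d2 TE) x) z - deriv (qp x) z" by (rule deriv_diff[OF fd[OF sA] fd[OF sq]])
    finally show "deriv (?O x) z = deriv (evA (d2 TE) x) z - deriv (qp x) z" .
    have "dx ?O x z = dx (\<lambda>x z. evA (d2 TE) x z - qp x z) x z" by (rule dx_cong, rule om_alt[OF z])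
    also have "\<dots> = dx (evA (d2 TE)) x z - dx qp x z"
      by (rule dx_eqI, rule has_vector_derivative_diff[OF vd[OF sA] vd[OF sq]])
    finally show "dx ?O x z = dx (evA (d2 TE)) x z - dx qp x z" .
  qed
  have W: "deriv (wfun (\<gamma> x)) z = deriv (lam (\<gamma> x)) z + deriv (lamb (\<gamma> x)) z"
    "dx (\<lambda>x. wfun (\<gamma> x)) x z = dx (\<lambda>x. lam (\<gamma> x)) x z + dx (\<lambda>x. lamb (\<gamma> x)) x z"
    unfolding wfun_def[abs_def]
    by (rule deriv_add[OF fd[OF sl(1)] fd[OF sl(2)]], rule dx_eqI, rule has_vector_derivative_add[OF vd[OF sl(1)] vd[OF sl(2)]])
  have N: "deriv (\<lambda>z. - (?M x z)) z = - deriv (?M x) z" "dx (\<lambda>x z. - (?M x z)) x z = - dx ?M x z"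
    by (rule deriv_minus[OF fd[OF sM]], rule dx_eqI, rule has_vector_derivative_minus[OF vd[OF sM]])
  have fo: "(\<lambda>y. fst (om y)) = ?O" by (simp add: om_def fun_eq_iff)
  have "bracket (\<lambda>y. wfun (\<gamma> y)) (\<lambda>y. fst (om y)) x z =
      z * (deriv (lam (\<gamma> x)) z * dx ?O x z - deriv (?O x) z * dx (\<lambda>x. lam (\<gamma> x)) x z)
    + z * (deriv (lamb (\<gamma> x)) z * dx ?O x z - deriv (?O x) z * dx (\<lambda>x. lamb (\<gamma> x)) x z)"
    unfolding bracket_dx fo W by (simp only: algebra_simps)
  also have "deriv (lam (\<gamma> x)) z * dx ?O x z - deriv (?O x) z * dx (\<lambda>x. lam (\<gamma> x)) x z
     = deriv (lam (\<gamma> x)) z * (dx (evA (d1 TE)) x z + dx ?M x z) - (deriv (evA (d1 TE) x) z + deriv (?M x) z) * dx (\<lambda>x. lam (\<gamma> x)) x z"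
    unfolding O1 ..
  also have "deriv (lamb (\<gamma> x)) z * dx ?O x z - deriv (?O x) z * dx (\<lambda>x. lamb (\<gamma> x)) x z
     = deriv (lamb (\<gamma> x)) z * (dx (evA (d2 TE)) x z - dx qp x z) - (deriv (evA (d2 TE) x) z - deriv (qp x) z) * dx (\<lambda>x. lamb (\<gamma> x)) x z"
    unfolding O2 ..
  also have "z * (deriv (lam (\<gamma> x)) z * (dx (evA (d1 TE)) x z + dx ?M x z) - (deriv (evA (d1 TE) x) z + deriv (?M x) z) * dx (\<lambda>x. lam (\<gamma> x)) x z)
    + z * (deriv (lamb (\<gamma> x)) z * (dx (evA (d2 TE)) x z - dx qp x z) - (deriv (evA (d2 TE) x) z - deriv (qp x) z) * dx (\<lambda>x. lamb (\<gamma> x)) x z)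
    = (bracket (\<lambda>x. lam (\<gamma> x)) (evA (d1 TE)) x z + bracket (\<lambda>x. lamb (\<gamma> x)) (evA (d2 TE)) x z)
      + bracket (\<lambda>x z. - (?M x z)) (\<lambda>x. lam (\<gamma> x)) x z + bracket qp (\<lambda>x. lamb (\<gamma> x)) x z"
    unfolding bracket_dx N by (simp add: algebra_simps)
  also have "\<dots> = X1 x (1 / z) + X2 x z / z"
    using bracket_evA zz exterior_bracket[of z x] interior_bracket[of z x] by simp
  finally show ?thesis by simp
qed

text \<open>At \<open>z = 0\<close> only the term \<open>k dx qp\<close> of X2 survives; dividing by
  \<open>k x 0\<close>, the passage from \<open>exp u\<close> to u, leaves the x-derivative of the
  zeroth coefficient of Q. To first order in z the terms with \<open>deriv (k x) 0\<close> cancel,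
  and the x-derivative of the product of \<open>exp u\<close> and the first coefficient
  remains.\<close>

lemma coords_X0: "triple_eq (coords \<gamma> X0 x) (poisson_op \<gamma> om x)"
proof -
  have 0: "(0::complex) \<in> ball 0 rr" using rr by simp
  have k0: "k x 0 \<noteq> 0" using k_nz R by simp
  have l: "lcoeff (snd X0 x) (-1) = X2 x 0" "lcoeff (snd X0 x) 0 = deriv (X2 x) 0"
    using lcoeff_simple_pole[OF sm_holo[OF sm_X2] rr(1), of "snd X0 x" x] by (auto simp: X0_def)
  have "lcoeff (snd X0 x) (-1) / lcoeff (lamb (\<gamma> x)) (-1) = dx qp x 0"
    using k0 by (simp add: l lcoeff_lamb X2_def)
  moreover have "deriv (X2 x) 0 = dx k x 0 * deriv (qp x) 0 + k x 0 * deriv (dx qp x) 0"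
  proof -
    let ?g = "\<lambda>z. deriv (qp x) z * dx k x z - deriv (k x) z * dx qp x z"
    have "sm (ball 0 rr) (\<lambda>x z. deriv (qp x) z * dx k x z - deriv (k x) z * dx qp x z)"
      by (intro sm_mult sm_diff sm_deriv sm_dx(1) sm_qp sm_k_rr open_ball)
    then have g: "(?g has_field_derivative deriv ?g 0) (at 0)"
      using holomorphic_derivI[OF sm_holo open_ball 0] by blast
    have kd: "(k x has_field_derivative deriv (k x) 0) (at 0)" "(dx qp x has_field_derivative deriv (dx qp x) 0) (at 0)"
      using holomorphic_derivI[OF sm_holo[OF sm_k_rr] open_ball 0] holomorphic_derivI[OF sm_holo[OF sm_dx(1)[OF sm_qp]] open_ball 0] by blast+
    have "(X2 x has_field_derivative (1 * ?g 0 + deriv ?g 0 * 0) + (deriv (k x) 0 * dx qp x 0 + deriv (dx qp x) 0 * k x 0)) (at 0)"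
      unfolding X2_def[abs_def] by (intro DERIV_add DERIV_mult DERIV_ident g kd)
    then show ?thesis by (simp add: DERIV_imp_deriv algebra_simps)
  qed
  moreover have "((\<lambda>x. k x 0 * deriv (qp x) 0) has_vector_derivative k x 0 * deriv (dx qp x) 0 + dx k x 0 * deriv (qp x) 0) (at x)"
    using has_vector_derivative_mult[OF sm_dx(2)[OF sm_k_rr 0] sm_dx(2)[OF sm_deriv[OF open_ball sm_qp] 0]]
      sm_dx_deriv[OF open_ball sm_qp 0] by simp
  then have "vector_derivative (\<lambda>x. k x 0 * deriv (qp x) 0) (at x) = k x 0 * deriv (dx qp x) 0 + dx k x 0 * deriv (qp x) 0"
    by (rule vector_derivative_at)
  moreover have "fst (coords \<gamma> X0 x) z = fst (poisson_op \<gamma> om x) z" if "z \<in> circle" for z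
    using fst_X0_bracket[of z x] circle_Ann[OF rr(1)] that by (auto simp: coords_def poisson_op_def X0_def)
  ultimately show ?thesis
    by (simp add: triple_eq_def coords_def poisson_op_def l om_def dx_def)
qed

end

section \<open>Derivatives of the Hamiltonians along a variation\<close>

lemma line_has_vector_derivative: "((\<lambda>\<epsilon>. c + of_real \<epsilon> * d) has_vector_derivative d) (at e)" for c d :: complex
proof -
  have "((\<lambda>\<epsilon>. of_real \<epsilon> :: complex) has_vector_derivative 1) (at e)"
    by (simp add: has_vector_derivative_def scaleR_conv_of_real has_derivative_of_real has_derivative_ident)
  from has_vector_derivative_add[OF has_vector_derivative_const has_vector_derivative_mult_left[OF this]]
  show ?thesis by simp
qed

text \<open>A continuous logarithm along the line \<open>\<epsilon> \<mapsto> F t + \<epsilon> D t\<close> is recovered from its value at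
  \<open>\<epsilon> = 0\<close> by integrating the logarithmic derivative; this gives joint continuity from continuity in
  \<open>\<epsilon>\<close> alone.\<close>

lemma log_line_continuous:
  fixes F D :: "'a::t2_space \<Rightarrow> complex" and g :: "real \<Rightarrow> 'a \<Rightarrow> complex"
  assumes F: "continuous_on T F" "continuous_on T D"
    and nz: "\<And>\<epsilon> t. \<epsilon> \<in> {-\<delta><..<\<delta>} \<Longrightarrow> t \<in> T \<Longrightarrow> F t + of_real \<epsilon> * D t \<noteq> 0"
    and g: "\<And>t. t \<in> T \<Longrightarrow> continuous_on {-\<delta><..<\<delta>} (\<lambda>\<epsilon>. g \<epsilon> t)" "continuous_on T (g 0)"
      "\<And>\<epsilon> t. \<epsilon> \<in> {-\<delta><..<\<delta>} \<Longrightarrow> t \<in> T \<Longrightarrow> exp (g \<epsilon> t) = F t + of_real \<epsilon> * D t"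
  shows "continuous_on ({-\<delta><..<\<delta>} \<times> T) (\<lambda>(\<epsilon>, t). g \<epsilon> t)"
proof -
  have sI: "s * \<epsilon> \<in> {-\<delta><..<\<delta>}" if "\<epsilon> \<in> {-\<delta><..<\<delta>}" "s \<in> {0..1}" for s \<epsilon> :: real
  proof -
    have "\<bar>s * \<epsilon>\<bar> \<le> \<bar>\<epsilon>\<bar>" using that by (auto simp: abs_mult intro: mult_left_le_one_le)
    then show ?thesis using that by auto
  qed
  let ?q = "\<lambda>p s. of_real (fst p) * (D (snd p) / (F (snd p) + of_real (s * fst p) * D (snd p)))"
  have eq: "g \<epsilon> t = g 0 t + integral (cbox 0 1) (?q (\<epsilon>, t))" if e: "\<epsilon> \<in> {-\<delta><..<\<delta>}" and t: "t \<in> T" for \<epsilon> t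
  proof -
    have "((\<lambda>s. g (s * \<epsilon>) t) has_vector_derivative ?q (\<epsilon>, t) s) (at s within {0..1})" if s: "s \<in> {0..1}" for s
    proof -
      from has_vector_derivative_continuous_log[OF line_has_vector_derivative _ sI[OF e s] g(1)[OF t] g(3)[OF _ t]]
      have 1: "((\<lambda>\<epsilon>. g \<epsilon> t) has_vector_derivative D t / (F t + of_real (s * \<epsilon>) * D t)) (at (s * \<epsilon>))" by simp
      have 2: "((\<lambda>s. s * \<epsilon>) has_vector_derivative \<epsilon>) (at s)" by (auto intro!: derivative_eq_intros)
      from has_vector_derivative_at_within[OF vector_diff_chain_at[OF 2 1]] show ?thesis
        by (simp only: o_def scaleR_conv_of_real fst_conv snd_conv)
    qed
    from fundamental_theorem_of_calculus[OF _ this]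
    have "(?q (\<epsilon>, t) has_integral g (1 * \<epsilon>) t - g (0 * \<epsilon>) t) {0..1}" by simp
    then show ?thesis by (simp add: integral_unique)
  qed
  have c: "continuous_on S (\<lambda>s. F (f s))" "continuous_on S (\<lambda>s. D (f s))" "continuous_on S (\<lambda>s. g 0 (f s))"
    if "continuous_on S f" "\<And>s. s \<in> S \<Longrightarrow> f s \<in> T" for S :: "'b::t2_space set" and f
    using continuous_on_compose2[OF F(1) that(1)] continuous_on_compose2[OF F(2) that(1)] continuous_on_compose2[OF g(2) that(1)] that(2)
    by blast+
  have nzq: "F (snd (fst q)) + of_real (snd q * fst (fst q)) * D (snd (fst q)) \<noteq> 0"
    if "q \<in> ({-\<delta><..<\<delta>} \<times> T) \<times> cbox 0 1" for q
    by (rule nz; (rule sI)?) (use that in \<open>auto simp: mem_Times_iff\<close>)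
  have "continuous_on (({-\<delta><..<\<delta>} \<times> T) \<times> cbox 0 1) (\<lambda>q. ?q (fst q) (snd q))"
    by (intro continuous_on_mult continuous_on_divide continuous_on_add continuous_on_of_real c continuous_on_projections ballI nzq)
      (auto intro!: continuous_intros)
  then have "continuous_on (({-\<delta><..<\<delta>} \<times> T) \<times> cbox 0 1) (\<lambda>(p, s). ?q p s)"
    by (simp only: case_prod_unfold)
  from integral_continuous_on_param[OF this]
  have "continuous_on ({-\<delta><..<\<delta>} \<times> T) (\<lambda>p. g 0 (snd p) + integral (cbox 0 1) (?q p))"
    by (intro continuous_intros c) auto
  then show ?thesis
  proof (rule continuous_on_eq)
    fix q assume "q \<in> {-\<delta><..<\<delta>} \<times> T"
    then obtain \<epsilon> t where q: "q = (\<epsilon>, t)" "\<epsilon> \<in> {-\<delta><..<\<delta>}" "t \<in> T" by auto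
    show "g 0 (snd q) + integral (cbox 0 1) (?q q) = (\<lambda>(\<epsilon>, t). g \<epsilon> t) q"
      unfolding q(1) using eq[OF q(2,3), symmetric] by (simp only: snd_conv case_prod_conv)
  qed
qed

text \<open>Counterpart of \<open>sm_family_log\<close> for the pair \<open>(\<epsilon>, x)\<close>
  as parameter and the closed disc. Convexity of the parameter set gives contractibility of the
  product, and the values c at the centre fix the branch.\<close>

lemma continuous_log_param:
  fixes F :: "'a::real_normed_vector \<Rightarrow> complex \<Rightarrow> complex"
  assumes S: "convex S" "s0 \<in> S" and F: "continuous_on (S \<times> cball 0 1) (\<lambda>(s, z). F s z)"
    and nz: "\<And>s z. s \<in> S \<Longrightarrow> z \<in> cball 0 1 \<Longrightarrow> F s z \<noteq> 0"
    and c: "continuous_on S c" "\<And>s. s \<in> S \<Longrightarrow> exp (c s) = F s 0"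
  obtains g where "continuous_on (S \<times> cball 0 1) (\<lambda>(s, z). g s z)"
    "\<And>s z. s \<in> S \<Longrightarrow> z \<in> cball 0 1 \<Longrightarrow> exp (g s z) = F s z" "\<And>s. s \<in> S \<Longrightarrow> g s 0 = c s"
proof -
  have "contractible (S \<times> cball (0::complex) 1)"
    by (intro convex_imp_contractible convex_Times S) auto
  then obtain G where G: "continuous_on (S \<times> cball 0 1) G" "\<And>p. p \<in> S \<times> cball 0 1 \<Longrightarrow> (\<lambda>(s, z). F s z) p = exp (G p)"
    using continuous_logarithm_on_contractible[OF F] nz by (metis (no_types, lifting) SigmaE case_prod_conv)
  define g where "g s z = G (s, z) - G (s0, 0) + c s0" for s z
  have ex: "exp (g s z) = F s z" if "s \<in> S" "z \<in> cball 0 1" for s z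
    using G(2)[of "(s, z)"] G(2)[of "(s0, 0)"] c(2)[OF S(2)] S(2) that nz[OF S(2), of 0] by (simp add: g_def exp_add exp_diff)
  have cg: "continuous_on (S \<times> cball 0 1) (\<lambda>(s, z). g s z)"
    unfolding g_def case_prod_unfold using G(1) by (auto intro!: continuous_intros)
  moreover have "g s 0 = c s" if "s \<in> S" for s
  proof (rule logs_eq[of S "\<lambda>s. g s 0" c s0])
    have "continuous_on S (\<lambda>s. (\<lambda>(s, z). g s z) (s, 0))"
      by (rule continuous_on_compose2[OF cg]) (auto intro!: continuous_intros)
    then show "continuous_on S (\<lambda>s. g s 0)" by simp
    show "g s0 0 = c s0" by (simp add: g_def)
    show "connected S" using S convex_connected by blast
  qed (use c ex S that in auto)
  ultimately show thesis using that ex by blast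
qed

text \<open>The deformed loops each have their own radius and disc coordinates. Stating the facts on
  the fixed closed domains allows them to be used for all deformation parameters together.\<close>

lemma LM0_log_specs:
  assumes "\<gamma> \<in> LM0"
  shows "continuous_on Dinf (log_lam (\<gamma> x))" "(log_lam (\<gamma> x) \<longlongrightarrow> 0) at_infinity"
    "\<And>z. z \<in> Dinf \<Longrightarrow> exp (log_lam (\<gamma> x) z) = lam (\<gamma> x) z / z"
    "continuous_on (cball 0 1) (log_lamb (\<gamma> x))" "log_lamb (\<gamma> x) 0 = ucoord (\<gamma> x)"
    "\<And>z. z \<in> D0p \<Longrightarrow> exp (log_lamb (\<gamma> x) z) = z * lamb (\<gamma> x) z"
    "\<And>z. z \<in> circle \<Longrightarrow> exp (logwz (\<gamma> x) z) = wfun (\<gamma> x) z / z"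
    "exp (ucoord (\<gamma> x)) = lcoeff (lamb (\<gamma> x)) (-1)"
    "\<And>z. z \<in> Dinf \<Longrightarrow> lam (\<gamma> x) z \<noteq> 0" "\<And>z. z \<in> D0p \<Longrightarrow> lamb (\<gamma> x) z \<noteq> 0" "\<And>z. z \<in> circle \<Longrightarrow> wfun (\<gamma> x) z \<noteq> 0"
    "theta_coeff a q (\<gamma> x) = cint (\<lambda>z. ev (texp a q) (lam (\<gamma> x) z) (lamb (\<gamma> x) z) (log1p (\<gamma> x) z) (log_lamb_w (\<gamma> x) z))"
proof -
  obtain R h k Hl Kl where "loop_rep \<gamma> R h k Hl Kl" using LM0_loop_rep[OF assms] .
  then interpret loop_rep \<gamma> R h k Hl Kl .
  show "continuous_on Dinf (log_lam (\<gamma> x))" "continuous_on (cball 0 1) (log_lamb (\<gamma> x))"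
    using log_lam_spec(1) log_lamb_spec(1) by (auto intro: holomorphic_on_imp_continuous_on analytic_imp_holomorphic)
  show "(log_lam (\<gamma> x) \<longlongrightarrow> 0) at_infinity" "\<And>z. z \<in> Dinf \<Longrightarrow> exp (log_lam (\<gamma> x) z) = lam (\<gamma> x) z / z"
    "log_lamb (\<gamma> x) 0 = ucoord (\<gamma> x)" "\<And>z. z \<in> D0p \<Longrightarrow> exp (log_lamb (\<gamma> x) z) = z * lamb (\<gamma> x) z"
    using log_lam_spec log_lamb_spec by blast+
  have "\<gamma> x \<in> M0_branched" using assms by (simp add: LM0_def)
  then show "\<And>z. z \<in> circle \<Longrightarrow> exp (logwz (\<gamma> x) z) = wfun (\<gamma> x) z / z" "exp (ucoord (\<gamma> x)) = lcoeff (lamb (\<gamma> x)) (-1)"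
    by (auto simp: M0_branched_def)
  show "\<And>z. z \<in> Dinf \<Longrightarrow> lam (\<gamma> x) z \<noteq> 0" using lam_nz Dinf_R by blast
  show "\<And>z. z \<in> D0p \<Longrightarrow> lamb (\<gamma> x) z \<noteq> 0" using lamb_nz R by auto
  show "\<And>z. z \<in> circle \<Longrightarrow> wfun (\<gamma> x) z \<noteq> 0" using wfun_nz circle_in_Ann by blast
  show "theta_coeff a q (\<gamma> x) = cint (\<lambda>z. ev (texp a q) (lam (\<gamma> x) z) (lamb (\<gamma> x) z) (log1p (\<gamma> x) z) (log_lamb_w (\<gamma> x) z))"
    unfolding theta_coeff_eq by (rule cint_cong) (simp add: evA_def circle_logs)
qed

context flow
begin

text \<open>Substituting \<open>A = \<omega> - Q_-\<close> and \<open>B = \<omega> + Q_+\<close>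
  leaves two corrections. The product of \<open>Q_-\<close> with the variation of \<open>lam\<close>
  has only negative powers and mean 0. The product of \<open>Q_+\<close> with the variation of
  \<open>lamb\<close>, which has a simple pole, has as mean the zeroth and first coefficients of Q
  times the v- and u-variations; \<open>exp u\<close> in the last component undoes the division in
  \<open>coords\<close>.\<close>

lemma pairing_om:
  assumes X: "X \<in> LTM0"
  shows "cint (\<lambda>z. evA (d1 TE) x z * fst X x z + evA (d2 TE) x z * snd X x z) = pairing (om x) (coords \<gamma> X x)"
proof -
  obtain s K Kb where s: "1 < s" "sm (ball 0 s) K" "sm (ball 0 s) Kb"
    "\<And>x z. 1 / s < norm z \<Longrightarrow> fst X x z = K x (1 / z)" "\<And>x z. z \<in> ball 0 s - {0} \<Longrightarrow> snd X x z = Kb x z / z"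
    using LTM0_rep[OF X] by metis
  define r where "r = min s rr"
  have r: "1 < r" "r \<le> s" "r \<le> rr" using s rr by (auto simp: r_def)
  have hol: "K x holomorphic_on ball 0 r" "Kb x holomorphic_on ball 0 r" "pm x holomorphic_on ball 0 r" "qp x holomorphic_on ball 0 r"
    using holomorphic_on_subset[OF sm_holo[OF s(2)]] holomorphic_on_subset[OF sm_holo[OF s(3)]]
      holomorphic_on_subset[OF sm_holo[OF sm_pm]] holomorphic_on_subset[OF sm_holo[OF sm_qp]] r
    by (metis subset_ball)+
  have fX: "fst X x z = K x (1 / z)" and sX: "snd X x z = Kb x z / z" if "z \<in> circle" for z
  proof -
    have "1 / s < norm z" using that s(1) by simp
    then show "fst X x z = K x (1 / z)" by (rule s(4))
    have "z \<in> ball 0 s - {0}" using that s(1) by auto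
    then show "snd X x z = Kb x z / z" by (rule s(5))
  qed
  have cb: "continuous_on circle f" if "f holomorphic_on ball 0 r" for f
    by (rule continuous_on_subset[OF holomorphic_on_imp_continuous_on[OF that]]) (use r in auto)
  have ci: "continuous_on circle (\<lambda>z. f (1 / z))" if "f holomorphic_on ball 0 r" for f
    by (rule continuous_on_compose2[OF cb[OF that]]) (auto intro!: continuous_intros simp: norm_divide)
  have cO: "continuous_on circle (\<lambda>z. fst (om x) z)"
    unfolding om_def fst_conv
    by (rule continuous_on_subset[OF holomorphic_on_imp_continuous_on[OF sm_holo[OF sm_om]]]) (use circle_Ann[OF rr(1)] in blast)
  have cX: "continuous_on circle (fst X x)" "continuous_on circle (snd X x)"
    by (rule continuous_on_eq[OF ci[OF hol(1)]], simp add: fX)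
      (rule continuous_on_eq[OF continuous_on_divide[OF cb[OF hol(2)] continuous_on_id]], auto simp: sX)
  have "cint (\<lambda>z. evA (d1 TE) x z * fst X x z + evA (d2 TE) x z * snd X x z)
    = cint (\<lambda>z. (fst (om x) z * (fst X x z + snd X x z) - (\<lambda>u. u * pm x u * K x u) (1 / z)) + qp x z * Kb x z / z ^ 1)"
  proof (rule cint_cong)
    fix z :: complex assume z: "z \<in> circle"
    then have zA: "z \<in> Ann rr" using circle_Ann[OF rr(1)] by blast
    have A: "evA (d1 TE) x z = fst (om x) z - pm x (1 / z) / z" by (simp add: om_def)
    have B: "evA (d2 TE) x z = fst (om x) z + qp x z" using om_alt[OF zA, of x] by (simp add: om_def)
    show "evA (d1 TE) x z * fst X x z + evA (d2 TE) x z * snd X x z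
      = (fst (om x) z * (fst X x z + snd X x z) - (\<lambda>u. u * pm x u * K x u) (1 / z)) + qp x z * Kb x z / z ^ 1"
      unfolding A B using fX[OF z] sX[OF z] by (simp add: algebra_simps)
  qed
  also have "\<dots> = cint (\<lambda>z. fst (om x) z * (fst X x z + snd X x z)) - cint (\<lambda>z. (\<lambda>u. u * pm x u * K x u) (1 / z)) + cint (\<lambda>z. qp x z * Kb x z / z ^ 1)"
  proof -
    have c1: "continuous_on circle (\<lambda>z. fst (om x) z * (fst X x z + snd X x z))" by (intro continuous_intros cO cX)
    have c2: "continuous_on circle (\<lambda>z. (\<lambda>u. u * pm x u * K x u) (1 / z))" by (rule ci) (intro holomorphic_intros hol)
    have c3: "continuous_on circle (\<lambda>z. qp x z * Kb x z / z ^ 1)"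
      by (intro continuous_on_divide continuous_on_mult cb hol continuous_on_power continuous_on_id) auto
    show ?thesis
      unfolding cint_add[OF continuous_on_diff[OF c1 c2] c3] cint_diff[OF c1 c2] ..
  qed
  also have "cint (\<lambda>z. (\<lambda>u. u * pm x u * K x u) (1 / z)) = cint (\<lambda>u. u * pm x u * K x u)"
    by (rule cint_inverse_arg) (intro cb holomorphic_intros hol)
  also have "\<dots> = cint (\<lambda>u. (pm x u * K x u) * u ^ 1)" by (rule cint_cong) simp
  also have "\<dots> = 0" by (rule cint_mult_power[OF _ r(1)]) (intro holomorphic_intros hol, simp)
  also have "cint (\<lambda>z. qp x z * Kb x z / z ^ 1) = deriv (\<lambda>z. qp x z * Kb x z) 0"
    using cint_higher_deriv[of "\<lambda>z. qp x z * Kb x z" r 1] r(1) hol by (simp add: holomorphic_on_mult)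
  also have "\<dots> = qp x 0 * deriv (Kb x) 0 + deriv (qp x) 0 * Kb x 0"
    by (rule deriv_mult) (use hol r in \<open>auto intro!: holomorphic_on_imp_differentiable_at[of _ "ball 0 r"]\<close>)
  finally have "cint (\<lambda>z. evA (d1 TE) x z * fst X x z + evA (d2 TE) x z * snd X x z)
    = cint (\<lambda>z. fst (om x) z * (fst X x z + snd X x z)) - 0 + (qp x 0 * deriv (Kb x) 0 + deriv (qp x) 0 * Kb x 0)" .
  moreover have "Kb x 0 = lcoeff (snd X x) (-1)" "deriv (Kb x) 0 = lcoeff (snd X x) 0"
    using lcoeff_simple_pole[OF hol(2) r(1) sX] by auto
  ultimately show ?thesis
    using k_nz[of 0 x] R by (simp add: pairing_def coords_def lcoeff_lamb om_def)
qed

text \<open>Differentiation passes under the circle mean and then under the integral over x, which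
  requires joint continuity in \<epsilon>, x and z. A variation provides continuity of its branches
  in \<epsilon> alone, and \<open>log_lam\<close>, \<open>log_lamb\<close> are chosen afresh for
  every loop. Most of the proof rebuilds these logarithms as jointly continuous functions.\<close>

lemma is_differential_om: "is_differential (Ham a p) \<gamma> om"
  unfolding is_differential_def
proof (intro conjI smooth_form_om ballI allI impI)
  fix X \<delta> \<Gamma> assume X: "X \<in> LTM0" and var: "variation \<gamma> X \<delta> \<Gamma>"
  define I where "I = {-\<delta><..<\<delta>}"
  have d: "\<delta> > 0" and G0: "\<Gamma> 0 = \<gamma>" and GL: "\<And>\<epsilon>. \<epsilon> \<in> I \<Longrightarrow> \<Gamma> \<epsilon> \<in> LM0"
    and Gl: "\<And>\<epsilon> x z. \<epsilon> \<in> I \<Longrightarrow> z \<in> Dinf \<Longrightarrow> lam (\<Gamma> \<epsilon> x) z = lam (\<gamma> x) z + of_real \<epsilon> * fst X x z"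
    and Gb: "\<And>\<epsilon> x z. \<epsilon> \<in> I \<Longrightarrow> z \<in> D0p \<Longrightarrow> lamb (\<Gamma> \<epsilon> x) z = lamb (\<gamma> x) z + of_real \<epsilon> * snd X x z"
    and Gu: "\<And>x. continuous_on I (\<lambda>\<epsilon>. ucoord (\<Gamma> \<epsilon> x))"
    and GL': "\<And>x z. z \<in> circle \<Longrightarrow> continuous_on I (\<lambda>\<epsilon>. logwz (\<Gamma> \<epsilon> x) z)"
    using var unfolding variation_def I_def by auto
  have I: "0 \<in> I" "open I" "convex I" using d by (auto simp: I_def)
  obtain s K Kb where s: "1 < s" "sm (ball 0 s) K" "sm (ball 0 s) Kb"
    "\<And>x z. 1 / s < norm z \<Longrightarrow> fst X x z = K x (1 / z)" "\<And>x z. z \<in> ball 0 s - {0} \<Longrightarrow> snd X x z = Kb x z / z"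
    using LTM0_rep[OF X] by metis
  have fX: "fst X x z = K x (1 / z)" if "z \<in> Dinf" for x z by (rule s(4)[OF Dinf_exterior[OF s(1) that]])
  have sX: "snd X x z = Kb x z / z" if "z \<in> D0p" for x z by (rule s(5)) (use that s(1) in auto)
  have l\<gamma>: "lam (\<gamma> x) z = z * h x (1 / z)" if "z \<in> Dinf" for x z by (rule lam_eq[OF Dinf_R[OF that]])
  have b\<gamma>: "lamb (\<gamma> x) z = k x z / z" if "z \<in> D0p" for x z by (rule lamb_eq) (use that R in auto)
  note sp = LM0_log_specs[OF GL]
  have cD: "z \<in> Dinf" "z \<in> D0p" "z \<noteq> 0" if "z \<in> circle" for z using that by auto
  have invD: "1 / z \<in> Dinf" if "z \<in> cball 0 1" "z \<noteq> 0" for z :: complex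
    using that by (simp add: norm_divide)
  have sub: "cball 0 1 \<subseteq> ball (0::complex) R" "cball 0 1 \<subseteq> ball (0::complex) s" using R s by auto
  have smc: "continuous_on S (\<lambda>q. f (u q) (v q))" if "sm (ball 0 t) f" "1 < t" "continuous_on S u" "continuous_on S v" "\<And>q. q \<in> S \<Longrightarrow> v q \<in> cball 0 1"
    for f t S and u :: "'q::t2_space \<Rightarrow> real" and v
    by (rule sm_cont2[OF that(1,3,4)]) (use that(2,5) in force)
  let ?S = "I \<times> (UNIV :: real set)"
  have convS: "convex ?S" "(0, 0) \<in> ?S" using I by (auto intro: convex_Times)

  \<comment> \<open>This is \<open>lam / z\<close> of the deformed loop in the variable
    \<open>1 / z\<close>, and that loop stays in \<open>LM0\<close>, where \<open>lam\<close> has no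
    zeros; at \<open>z = 0\<close> the value is 1.\<close>
  have lnz: "h x z + of_real \<epsilon> * (z * K x z) \<noteq> 0" if "\<epsilon> \<in> I" "z \<in> cball 0 1" for \<epsilon> x z
  proof (cases "z = 0")
    case False
    have "lam (\<Gamma> \<epsilon> x) (1 / z) = (1 / z) * (h x z + of_real \<epsilon> * (z * K x z))"
      using Gl[OF that(1) invD[OF that(2) False]] l\<gamma>[OF invD[OF that(2) False]] fX[OF invD[OF that(2) False]] False
      by (simp add: field_simps)
    then show ?thesis using sp(9)[OF that(1) invD[OF that(2) False], of x] by auto
  qed (simp add: h0)
  have "continuous_on (?S \<times> cball 0 1) (\<lambda>(q, z). h (snd q) z + of_real (fst q) * (z * K (snd q) z))"
    unfolding case_prod_unfold
    by (intro continuous_intros smc[OF h R] smc[OF s(2,1)]) auto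
  \<comment> \<open>A branch of \<open>log (lam / z)\<close> continuous in all variables; the limit
    0 at infinity identifies it with the choice made by \<open>log_lam\<close>.\<close>
  then obtain gl where gl: "continuous_on (?S \<times> cball 0 1) (\<lambda>(q, z). gl q z)"
    "\<And>q z. q \<in> ?S \<Longrightarrow> z \<in> cball 0 1 \<Longrightarrow> exp (gl q z) = h (snd q) z + of_real (fst q) * (z * K (snd q) z)"
    "\<And>q. q \<in> ?S \<Longrightarrow> gl q 0 = 0"
    by (rule continuous_log_param[OF convS, where c = "\<lambda>_. 0"]) (use lnz h0 in auto)
  have gl_eq: "log_lam (\<Gamma> \<epsilon> x) z = gl (\<epsilon>, x) (1 / z)" if e: "\<epsilon> \<in> I" and z: "z \<in> Dinf" for \<epsilon> x z
  proof (rule logs_eq_exterior[OF sp(1)[OF e] _ sp(2)[OF e] _ _ z])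
    have c1: "continuous_on (cball 0 1) (gl (\<epsilon>, x))" by (rule continuous_on_slice[OF gl(1)]) (use e in auto)
    show "continuous_on Dinf (\<lambda>z. gl (\<epsilon>, x) (1 / z))"
      by (rule continuous_on_compose2[OF c1]) (auto intro!: continuous_intros simp: norm_divide divide_le_eq_1)
    have "isCont (gl (\<epsilon>, x)) 0"
      by (rule continuous_on_interior[OF c1]) (simp add: interior_cball)
    from tendsto_inverse_arg_at_infinity[OF this]
    show "((\<lambda>z. gl (\<epsilon>, x) (1 / z)) \<longlongrightarrow> 0) at_infinity" using gl(3)[of "(\<epsilon>, x)"] e by simp
    fix z :: complex assume z: "z \<in> Dinf"
    then have z': "1 / z \<in> cball 0 1" "z \<noteq> 0" by (auto simp: norm_divide divide_le_eq_1)
    then show "exp (log_lam (\<Gamma> \<epsilon> x) z) = exp (gl (\<epsilon>, x) (1 / z))"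
      using sp(3)[OF e z, of x] gl(2)[of "(\<epsilon>, x)" "1 / z"] e Gl[OF e z] l\<gamma>[OF z] fX[OF z] by (simp add: add_divide_distrib)
  qed

  have u\<epsilon>: "exp (ucoord (\<Gamma> \<epsilon> x)) = k x 0 + of_real \<epsilon> * Kb x 0" if e: "\<epsilon> \<in> I" for \<epsilon> x
  proof -
    define r where "r = min R s"
    have r: "1 < r" "r \<le> R" "r \<le> s" using R s by (auto simp: r_def)
    have "lcoeff (lamb (\<Gamma> \<epsilon> x)) (-1) = (\<lambda>z. k x z + of_real \<epsilon> * Kb x z) 0"
    proof (rule lcoeff_simple_pole(1)[OF _ r(1)])
      show "(\<lambda>z. k x z + of_real \<epsilon> * Kb x z) holomorphic_on ball 0 r"
        by (intro holomorphic_intros holomorphic_on_subset[OF sm_holo[OF k]] holomorphic_on_subset[OF sm_holo[OF s(3)]]) (use r in auto)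
      show "lamb (\<Gamma> \<epsilon> x) z = (k x z + of_real \<epsilon> * Kb x z) / z" if "z \<in> circle" for z
        using Gb[OF e cD(2)[OF that]] b\<gamma>[OF cD(2)[OF that]] sX[OF cD(2)[OF that]] by (simp add: add_divide_distrib)
    qed
    then show ?thesis using sp(8)[OF e] by simp
  qed
  \<comment> \<open>Given is continuity of u in \<epsilon> for each x; since \<open>exp u\<close> is
    affine in \<epsilon>, its branch is recovered jointly from the smooth u at
    \<open>\<epsilon> = 0\<close>.\<close>
  have cu: "continuous_on ?S (\<lambda>(\<epsilon>, x). ucoord (\<Gamma> \<epsilon> x))"
    unfolding I_def
  proof (rule log_line_continuous[where F = "\<lambda>x. k x 0" and D = "\<lambda>x. Kb x 0"])
    show "continuous_on UNIV (\<lambda>x. k x 0)" "continuous_on UNIV (\<lambda>x. Kb x 0)"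
      by (rule sm_contx[OF k], use R in simp, rule sm_contx[OF s(3)], use s in simp)
    show "continuous_on UNIV (\<lambda>x. ucoord (\<Gamma> 0 x))"
      unfolding G0 by (rule sm_contx[OF smooth_fun_sm[OF u, of UNIV]]) simp
    show "k x 0 + of_real \<epsilon> * Kb x 0 \<noteq> 0" if "\<epsilon> \<in> {-\<delta><..<\<delta>}" for \<epsilon> x
      using u\<epsilon>[of \<epsilon> x] that by (metis I_def exp_not_eq_zero)
  qed (use Gu u\<epsilon> in \<open>auto simp: I_def\<close>)
  have bnz: "k x z + of_real \<epsilon> * Kb x z \<noteq> 0" if "\<epsilon> \<in> I" "z \<in> cball 0 1" for \<epsilon> x z
  proof (cases "z = 0")
    case False
    then have zD: "z \<in> D0p" using that by auto
    have "lamb (\<Gamma> \<epsilon> x) z = (k x z + of_real \<epsilon> * Kb x z) / z"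
      using Gb[OF that(1) zD] b\<gamma>[OF zD] sX[OF zD] by (simp add: add_divide_distrib)
    then show ?thesis using sp(10)[OF that(1) zD, of x] by auto
  next
    case True
    then show ?thesis using u\<epsilon>[OF that(1), of x] by (metis exp_not_eq_zero)
  qed
  have "continuous_on (?S \<times> cball 0 1) (\<lambda>(q, z). k (snd q) z + of_real (fst q) * Kb (snd q) z)"
    unfolding case_prod_unfold
    by (intro continuous_intros smc[OF k R] smc[OF s(3,1)]) auto
  then obtain gb where gb: "continuous_on (?S \<times> cball 0 1) (\<lambda>(q, z). gb q z)"
    "\<And>q z. q \<in> ?S \<Longrightarrow> z \<in> cball 0 1 \<Longrightarrow> exp (gb q z) = k (snd q) z + of_real (fst q) * Kb (snd q) z"
    "\<And>q. q \<in> ?S \<Longrightarrow> gb q 0 = (\<lambda>(\<epsilon>, x). ucoord (\<Gamma> \<epsilon> x)) q"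
    by (rule continuous_log_param[OF convS _ _ cu]) (use bnz u\<epsilon> in auto)
  have gb_eq: "log_lamb (\<Gamma> \<epsilon> x) z = gb (\<epsilon>, x) z" if e: "\<epsilon> \<in> I" and z: "z \<in> cball 0 1" for \<epsilon> x z
  proof (rule logs_eq[of "cball 0 1" "log_lamb (\<Gamma> \<epsilon> x)" "gb (\<epsilon>, x)" 0])
    show "continuous_on (cball 0 1) (gb (\<epsilon>, x))" by (rule continuous_on_slice[OF gb(1)]) (use e in auto)
    show 0: "log_lamb (\<Gamma> \<epsilon> x) 0 = gb (\<epsilon>, x) 0" using sp(5)[OF e] gb(3)[of "(\<epsilon>, x)"] e by simp
    fix z :: complex assume z: "z \<in> cball 0 1"
    show "exp (log_lamb (\<Gamma> \<epsilon> x) z) = exp (gb (\<epsilon>, x) z)"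
    proof (cases "z = 0")
      case False
      then have zD: "z \<in> D0p" using z by auto
      then show ?thesis
        using sp(6)[OF e zD, of x] gb(2)[of "(\<epsilon>, x)" z] e z Gb[OF e zD] b\<gamma>[OF zD] sX[OF zD] False by (simp add: distrib_left)
    qed (use 0 in simp)
  qed (use z sp(4)[OF e] in auto)

  have cXc: "continuous_on (UNIV \<times> circle) (\<lambda>(x, z). fst X x z)" "continuous_on (UNIV \<times> circle) (\<lambda>(x, z). snd X x z)"
  proof -
    have "continuous_on (UNIV \<times> circle) (\<lambda>q. K (fst q) (1 / snd q))"
      by (intro smc[OF s(2,1)] continuous_intros) (auto simp: norm_divide)
    then show "continuous_on (UNIV \<times> circle) (\<lambda>(x, z). fst X x z)"
      by (rule continuous_on_eq) (auto simp: fX)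
    have "continuous_on (UNIV \<times> circle) (\<lambda>q. Kb (fst q) (snd q) / snd q)"
      by (intro continuous_on_divide smc[OF s(3,1)] continuous_intros) auto
    then show "continuous_on (UNIV \<times> circle) (\<lambda>(x, z). snd X x z)"
      by (rule continuous_on_eq) (clarify, simp only: case_prod_conv fst_conv snd_conv, rule sX[OF cD(2), symmetric])
  qed
  have c\<gamma>: "continuous_on (UNIV \<times> circle) (\<lambda>(x, z). lam (\<gamma> x) z)" "continuous_on (UNIV \<times> circle) (\<lambda>(x, z). lamb (\<gamma> x) z)"
    "continuous_on (UNIV \<times> circle) (\<lambda>(x, z). logwz (\<gamma> x) z)"
    by (rule continuous_on_subset[OF sm_cont], rule sm_lam_Ann, use circle_Ann[OF R] in blast,
        rule continuous_on_subset[OF sm_cont], rule sm_lamb_Ann, use circle_Ann[OF R] in blast,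
        rule continuous_on_subset[OF sm_cont], rule L, use circle_Ann[OF R] in blast)
  have w\<epsilon>: "exp (logwz (\<Gamma> \<epsilon> x) z) = (lam (\<gamma> x) z + lamb (\<gamma> x) z) / z + of_real \<epsilon> * ((fst X x z + snd X x z) / z)" if "\<epsilon> \<in> I" "z \<in> circle" for \<epsilon> x z
    using sp(7)[OF that] Gl[OF that(1) cD(1)[OF that(2)]] Gb[OF that(1) cD(2)[OF that(2)]]
    by (simp add: wfun_def add_divide_distrib algebra_simps)
  \<comment> \<open>The same argument for \<open>log (w / z)\<close>, with x and z together as the
    parameter.\<close>
  have cw: "continuous_on (I \<times> (UNIV \<times> circle)) (\<lambda>(\<epsilon>, t). logwz (\<Gamma> \<epsilon> (fst t)) (snd t))"
    unfolding I_def
  proof (rule log_line_continuous[where F = "\<lambda>t. (lam (\<gamma> (fst t)) (snd t) + lamb (\<gamma> (fst t)) (snd t)) / snd t"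
        and D = "\<lambda>t. (fst X (fst t) (snd t) + snd X (fst t) (snd t)) / snd t"])
    show "continuous_on (UNIV \<times> circle) (\<lambda>t. (lam (\<gamma> (fst t)) (snd t) + lamb (\<gamma> (fst t)) (snd t)) / snd t)"
      "continuous_on (UNIV \<times> circle) (\<lambda>t. (fst X (fst t) (snd t) + snd X (fst t) (snd t)) / snd t)"
      using c\<gamma> cXc unfolding case_prod_unfold by (intro continuous_intros; auto)+
    show "continuous_on (UNIV \<times> circle) (\<lambda>t. logwz (\<Gamma> 0 (fst t)) (snd t))"
      using c\<gamma>(3) unfolding G0 case_prod_unfold .
    show "(lam (\<gamma> (fst t)) (snd t) + lamb (\<gamma> (fst t)) (snd t)) / snd t + of_real \<epsilon> * ((fst X (fst t) (snd t) + snd X (fst t) (snd t)) / snd t) \<noteq> 0"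
      if "\<epsilon> \<in> {-\<delta><..<\<delta>}" "t \<in> UNIV \<times> circle" for \<epsilon> t
      using w\<epsilon>[of \<epsilon> "snd t" "fst t"] that exp_not_eq_zero by (metis I_def mem_Times_iff)
  qed (use GL' w\<epsilon> in \<open>auto simp: I_def\<close>)

  define Y where "Y e \<epsilon> x z = ev e (lam (\<Gamma> \<epsilon> x) z) (lamb (\<Gamma> \<epsilon> x) z) (log1p (\<Gamma> \<epsilon> x) z) (log_lamb_w (\<Gamma> \<epsilon> x) z)" for e \<epsilon> x z
  let ?T = "?S \<times> circle"
  have cT: "continuous_on ?T (\<lambda>t. lam (\<Gamma> (fst (fst t)) (snd (fst t))) (snd t))"
    "continuous_on ?T (\<lambda>t. lamb (\<Gamma> (fst (fst t)) (snd (fst t))) (snd t))"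
    "continuous_on ?T (\<lambda>t. log1p (\<Gamma> (fst (fst t)) (snd (fst t))) (snd t))"
    "continuous_on ?T (\<lambda>t. log_lamb_w (\<Gamma> (fst (fst t)) (snd (fst t))) (snd t))"
    "continuous_on ?T (\<lambda>t. fst X (snd (fst t)) (snd t))" "continuous_on ?T (\<lambda>t. snd X (snd (fst t)) (snd t))"
  proof -
    have pr: "continuous_on ?T (\<lambda>t. (snd (fst t), snd t))" "(\<lambda>t. (snd (fst t), snd t)) ` ?T \<subseteq> UNIV \<times> circle"
      by (auto intro!: continuous_intros)
    note cp = continuous_on_compose2[OF _ pr(1) pr(2)]
    show X': "continuous_on ?T (\<lambda>t. fst X (snd (fst t)) (snd t))" "continuous_on ?T (\<lambda>t. snd X (snd (fst t)) (snd t))"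
      using cp[OF cXc(1)] cp[OF cXc(2)] by simp_all
    have A: "continuous_on ?T (\<lambda>t. lam (\<gamma> (snd (fst t))) (snd t) + of_real (fst (fst t)) * fst X (snd (fst t)) (snd t))"
      "continuous_on ?T (\<lambda>t. lamb (\<gamma> (snd (fst t))) (snd t) + of_real (fst (fst t)) * snd X (snd (fst t)) (snd t))"
      using cp[OF c\<gamma>(1)] cp[OF c\<gamma>(2)] X' by (auto intro!: continuous_intros)
    show "continuous_on ?T (\<lambda>t. lam (\<Gamma> (fst (fst t)) (snd (fst t))) (snd t))"
      by (rule continuous_on_eq[OF A(1)]) (clarsimp simp: Gl)
    show "continuous_on ?T (\<lambda>t. lamb (\<Gamma> (fst (fst t)) (snd (fst t))) (snd t))"
      by (rule continuous_on_eq[OF A(2)]) (clarify, simp only: fst_conv snd_conv, rule Gb[OF _ cD(2), symmetric])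
    have L: "continuous_on ?T (\<lambda>t. logwz (\<Gamma> (fst (fst t)) (snd (fst t))) (snd t))"
    proof -
      have "continuous_on ?T (\<lambda>t. (\<lambda>(\<epsilon>, t). logwz (\<Gamma> \<epsilon> (fst t)) (snd t)) (fst (fst t), (snd (fst t), snd t)))"
        by (rule continuous_on_compose2[OF cw]) (auto intro!: continuous_intros)
      then show ?thesis by simp
    qed
    have "continuous_on ?T (\<lambda>t. (\<lambda>(q, z). gl q z) (fst t, 1 / snd t))" "continuous_on ?T (\<lambda>t. (\<lambda>(q, z). gb q z) (fst t, snd t))"
      by (rule continuous_on_compose2[OF gl(1)], (auto intro!: continuous_intros simp: norm_divide)[2],
          rule continuous_on_compose2[OF gb(1)], (auto intro!: continuous_intros)[2])
    then have B: "continuous_on ?T (\<lambda>t. logwz (\<Gamma> (fst (fst t)) (snd (fst t))) (snd t) - gl (fst t) (1 / snd t))"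
      "continuous_on ?T (\<lambda>t. gb (fst t) (snd t) + logwz (\<Gamma> (fst (fst t)) (snd (fst t))) (snd t))"
      using L unfolding case_prod_unfold by (auto intro!: continuous_on_diff continuous_on_add)
    show "continuous_on ?T (\<lambda>t. log1p (\<Gamma> (fst (fst t)) (snd (fst t))) (snd t))"
      by (rule continuous_on_eq[OF B(1)]) (clarsimp simp: log1p_def gl_eq)
    show "continuous_on ?T (\<lambda>t. log_lamb_w (\<Gamma> (fst (fst t)) (snd (fst t))) (snd t))"
      by (rule continuous_on_eq[OF B(2)]) (clarsimp simp: log_lamb_w_def gb_eq)
  qed
  have cY: "continuous_on ?T (\<lambda>(q, z). Y e (fst q) (snd q) z)" for e
    unfolding Y_def case_prod_unfold
    by (rule continuous_on_ev[OF cT(1-4)]) (use sp(9-11) cD in \<open>auto simp: wfun_def\<close>)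
  define Y' where "Y' \<epsilon> x z = Y (d1 TE) \<epsilon> x z * fst X x z + Y (d2 TE) \<epsilon> x z * snd X x z" for \<epsilon> x z
  have cY': "continuous_on ?T (\<lambda>(q, z). Y' (fst q) (snd q) z)"
    using cY cT(5,6) unfolding Y'_def case_prod_unfold by (auto intro!: continuous_intros)
  have sl1: "continuous_on (I \<times> circle) (\<lambda>(\<epsilon>, z). f \<epsilon> x z)" if "continuous_on ?T (\<lambda>(q, z). f (fst q) (snd q) z)" for f :: "real \<Rightarrow> real \<Rightarrow> complex \<Rightarrow> complex" and x
  proof -
    have "continuous_on (I \<times> circle) (\<lambda>t. (\<lambda>(q, z). f (fst q) (snd q) z) ((fst t, x), snd t))"
      by (rule continuous_on_compose2[OF that]) (auto intro!: continuous_intros)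
    then show ?thesis by (simp add: case_prod_unfold)
  qed
  have dY: "((\<lambda>\<epsilon>. Y TE \<epsilon> x z) has_vector_derivative Y' \<epsilon> x z) (at \<epsilon>)" if e: "\<epsilon> \<in> I" and z: "z \<in> circle" for \<epsilon> x z
  proof -
    have dl: "((\<lambda>\<epsilon>. lam (\<Gamma> \<epsilon> x) z) has_vector_derivative fst X x z) (at \<epsilon>)"
    proof (rule has_vector_derivative_transform_within_open)
      show "((\<lambda>\<epsilon>. lam (\<gamma> x) z + of_real \<epsilon> * fst X x z) has_vector_derivative fst X x z) (at \<epsilon>)"
        by (rule line_has_vector_derivative)
    qed (use I(2) e Gl cD(1)[OF z] in auto)
    have db: "((\<lambda>\<epsilon>. lamb (\<Gamma> \<epsilon> x) z) has_vector_derivative snd X x z) (at \<epsilon>)"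
    proof (rule has_vector_derivative_transform_within_open)
      show "((\<lambda>\<epsilon>. lamb (\<gamma> x) z + of_real \<epsilon> * snd X x z) has_vector_derivative snd X x z) (at \<epsilon>)"
        by (rule line_has_vector_derivative)
    qed (use I(2) e Gb cD(2)[OF z] in auto)
    have cs: "continuous_on I (\<lambda>\<epsilon>. f (\<epsilon>, x) z)" if "continuous_on ?T (\<lambda>t. f (fst t) (snd t))" for f :: "real \<times> real \<Rightarrow> complex \<Rightarrow> complex"
    proof -
      have "continuous_on I (\<lambda>\<epsilon>. (\<lambda>t. f (fst t) (snd t)) ((\<epsilon>, x), z))"
        by (rule continuous_on_compose2[OF that]) (use z in \<open>auto intro!: continuous_intros\<close>)
      then show ?thesis by simp
    qed
    show ?thesis unfolding Y_def Y'_def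
    proof (rule ev_log_has_vector_derivative[OF dl db I(2) e])
      show "continuous_on I (\<lambda>\<epsilon>. log1p (\<Gamma> \<epsilon> x) z)" using cs[of "\<lambda>q. log1p (\<Gamma> (fst q) (snd q))"] cT(3) by simp
      show "continuous_on I (\<lambda>\<epsilon>. log_lamb_w (\<Gamma> \<epsilon> x) z)" using cs[of "\<lambda>q. log_lamb_w (\<Gamma> (fst q) (snd q))"] cT(4) by simp
      show "exp (log1p (\<Gamma> \<epsilon> x) z) = (lam (\<Gamma> \<epsilon> x) z + lamb (\<Gamma> \<epsilon> x) z) / lam (\<Gamma> \<epsilon> x) z" if "\<epsilon> \<in> I" for \<epsilon>
        using sp(7)[OF that z] sp(3)[OF that cD(1)[OF z]] cD(3)[OF z] by (simp add: log1p_def exp_diff wfun_def)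
      show "exp (log_lamb_w (\<Gamma> \<epsilon> x) z) = lamb (\<Gamma> \<epsilon> x) z * (lam (\<Gamma> \<epsilon> x) z + lamb (\<Gamma> \<epsilon> x) z)" if "\<epsilon> \<in> I" for \<epsilon>
        using sp(7)[OF that z] sp(6)[OF that cD(2)[OF z]] cD(3)[OF z] by (simp add: log_lamb_w_def exp_add wfun_def)
    qed (use sp(9)[OF e cD(1)[OF z]] sp(10)[OF e cD(2)[OF z]] sp(11)[OF e z] in \<open>auto simp: wfun_def\<close>)
  qed
  have dJ: "((\<lambda>\<epsilon>. cint (Y TE \<epsilon> x)) has_vector_derivative cint (Y' \<epsilon> x)) (at \<epsilon>)" if "\<epsilon> \<in> I" for \<epsilon> x
  proof (rule cint_has_vector_derivative[OF dY _ sl1[OF cY'] I(2,3) that])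
    show "continuous_on circle (Y TE \<epsilon> x)" if "\<epsilon> \<in> I" for \<epsilon>
      by (rule continuous_on_slice[OF sl1[OF cY] that])
  qed
  have cJ: "continuous_on ?S (\<lambda>q. cint (Y TE (fst q) (snd q)))" "continuous_on ?S (\<lambda>q. cint (Y' (fst q) (snd q)))"
    by (rule cint_continuous_param[OF cY], rule cint_continuous_param[OF cY'])
  \<comment> \<open>Second differentiation under an integral, now over x; the inner circle mean is
    covered by \<open>dJ\<close>.\<close>
  have "((\<lambda>\<epsilon>. integral (cbox 0 (2 * pi)) (\<lambda>x. cint (Y TE \<epsilon> x))) has_vector_derivative integral (cbox 0 (2 * pi)) (\<lambda>x. cint (Y' 0 x))) (at 0 within I)"
  proof (rule leibniz_rule_vector_derivative[OF _ _ _ I(1,3)])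
    show "((\<lambda>\<epsilon>. cint (Y TE \<epsilon> x)) has_vector_derivative cint (Y' \<epsilon> x)) (at \<epsilon> within I)" if "\<epsilon> \<in> I" for \<epsilon> x
      using dJ[OF that] by (rule has_vector_derivative_at_within)
    show "(\<lambda>x. cint (Y TE \<epsilon> x)) integrable_on cbox 0 (2 * pi)" if "\<epsilon> \<in> I" for \<epsilon>
    proof (rule integrable_continuous)
      have "continuous_on (cbox 0 (2 * pi)) (\<lambda>x. (\<lambda>q. cint (Y TE (fst q) (snd q))) (\<epsilon>, x))"
        by (rule continuous_on_compose2[OF cJ(1)]) (use that in \<open>auto intro!: continuous_intros\<close>)
      then show "continuous_on (cbox 0 (2 * pi)) (\<lambda>x. cint (Y TE \<epsilon> x))" by simp
    qed
    show "continuous_on (I \<times> cbox 0 (2 * pi)) (\<lambda>(\<epsilon>, x). cint (Y' \<epsilon> x))"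
      using continuous_on_subset[OF cJ(2), of "I \<times> cbox 0 (2 * pi)"] by (auto simp: case_prod_unfold)
  qed
  then have "((\<lambda>\<epsilon>. integral {0..2 * pi} (\<lambda>x. cint (Y TE \<epsilon> x))) has_vector_derivative integral {0..2 * pi} (\<lambda>x. cint (Y' 0 x))) (at 0)"
    unfolding at_within_open[OF I(1,2)] cbox_interval .
  moreover have "integral {0..2 * pi} (\<lambda>x. cint (Y TE \<epsilon> x)) = Ham a p (\<Gamma> \<epsilon>)" if "\<epsilon> \<in> I" for \<epsilon>
    unfolding Ham_def sp(12)[OF that] Y_def TE_def by simp
  ultimately have "((\<lambda>\<epsilon>. Ham a p (\<Gamma> \<epsilon>)) has_vector_derivative integral {0..2 * pi} (\<lambda>x. cint (Y' 0 x))) (at 0)"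
    by (rule has_vector_derivative_transform_within_open[OF _ I(2,1)])
  moreover have "cint (Y' 0 x) = pairing (om x) (coords \<gamma> X x)" for x
  proof -
    have "cint (Y' 0 x) = cint (\<lambda>z. evA (d1 TE) x z * fst X x z + evA (d2 TE) x z * snd X x z)"
      by (rule cint_cong) (simp add: Y'_def Y_def G0 evA_def circle_logs)
    then show ?thesis using pairing_om[OF X] by simp
  qed
  ultimately show "((\<lambda>\<epsilon>. Ham a p (\<Gamma> \<epsilon>)) has_vector_derivative integral {0..2 * pi} (\<lambda>x. pairing (om x) (coords \<gamma> X x))) (at 0)"
    by simp
qed

end

section \<open>Variations in arbitrary directions\<close>

text \<open>Compactness of one period bounds the family over the whole line. This lets a single
  \<delta> serve all points of a loop.\<close>

lemma periodic_bounded: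
  fixes F :: "real \<Rightarrow> 'a::metric_space \<Rightarrow> complex"
  assumes C: "compact C" and F: "continuous_on (UNIV \<times> C) (\<lambda>(x, c). F x c)"
    and per: "\<And>x c. c \<in> C \<Longrightarrow> F (x + 2 * pi) c = F x c"
  obtains M where "0 < M" "\<And>x c. c \<in> C \<Longrightarrow> norm (F x c) \<le> M"
proof -
  have "compact ((\<lambda>(x, c). F x c) ` ({0..2 * pi} \<times> C))"
    by (intro compact_continuous_image continuous_on_subset[OF F] compact_Times C) auto
  from compact_imp_bounded[OF this, unfolded bounded_pos]
  obtain M where M: "0 < M" "\<And>y. y \<in> (\<lambda>(x, c). F x c) ` ({0..2 * pi} \<times> C) \<Longrightarrow> norm y \<le> M"
    by blast
  have "norm (F x c) \<le> M" if c: "c \<in> C" for x c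
  proof -
    from periodic_reduce[of "\<lambda>x. F x c", OF per[OF c], of x]
    obtain y where "y \<in> {0..2 * pi}" "F x c = F y c" by blast
    moreover have "F y c \<in> (\<lambda>(x, c). F x c) ` ({0..2 * pi} \<times> C)"
      using calculation(1) c by (intro image_eqI[of _ _ "(y, c)"]) auto
    ultimately show ?thesis using M(2) by simp
  qed
  then show thesis using that M(1) by blast
qed

lemma divdiff_continuous:
  assumes f: "sm (Ann R) f" and r: "1 < r" "r < R"
  shows "continuous_on (UNIV \<times> (Ann r \<times> Ann r)) (\<lambda>(x, q). divdiff r (f x) (fst q) (snd q))"
proof -
  have nz1: "of_real r * \<eta> - z \<noteq> 0" if "\<eta> \<in> circle" "z \<in> Ann r" for \<eta> z
    using that r by (auto simp: Ann_def norm_mult)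
  have nz2: "of_real (1 / r) * \<eta> - z \<noteq> 0" if "\<eta> \<in> circle" "z \<in> Ann r" for \<eta> z
    using that r by (auto simp: Ann_def norm_mult norm_divide)
  let ?S = "(UNIV :: real set) \<times> (Ann r \<times> Ann r)"
  have pr: "continuous_on S (\<lambda>t. fst (snd (fst t)))" "continuous_on S (\<lambda>t. snd (snd (fst t)))"
    for S :: "((real \<times> complex \<times> complex) \<times> complex) set"
    by (auto intro!: continuous_intros)
  have "continuous_on ?S (\<lambda>t. cint (\<lambda>\<eta>. f (fst t) (c * \<eta>) * (c * \<eta> / ((c * \<eta> - fst (snd t)) * (c * \<eta> - snd (snd t))))))"
    if "\<And>\<eta>. \<eta> \<in> circle \<Longrightarrow> c * \<eta> \<in> Ann R" "\<And>\<eta> z. \<eta> \<in> circle \<Longrightarrow> z \<in> Ann r \<Longrightarrow> c * \<eta> - z \<noteq> 0" for c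
  proof (rule cint_continuous_param, unfold case_prod_unfold)
    have "continuous_on (?S \<times> circle) (\<lambda>t. f (fst (fst t)) (c * snd t))"
      by (rule sm_cont2[OF f]) (use that(1) in \<open>auto intro!: continuous_intros\<close>)
    then show "continuous_on (?S \<times> circle) (\<lambda>t. f (fst (fst t)) (c * snd t) *
      (c * snd t / ((c * snd t - fst (snd (fst t))) * (c * snd t - snd (snd (fst t))))))"
      by (intro continuous_on_mult continuous_on_divide continuous_on_diff pr continuous_on_projections continuous_on_const)
        (use that(2) in auto)
  qed
  from continuous_on_diff[OF this[of "of_real r"] this[of "of_real (1 / r)"]]
  show ?thesis
    unfolding divdiff_def case_prod_unfold using scaled_circle_Ann[OF r] nz1 nz2 by blast
qed

lemma deriv_from_quotient:
  fixes f :: "complex \<Rightarrow> complex"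
  assumes "open D" "b \<in> D" "\<And>a. a \<in> D \<Longrightarrow> f a - f b = (a - b) * G a" "continuous_on D G"
  shows "deriv f b = G b"
proof -
  have "(G \<longlongrightarrow> G b) (at b)" using assms(1,2,4) continuous_on_eq_continuous_at isCont_def by blast
  moreover have "\<forall>\<^sub>F a in at b. G a = (f a - f b) / (a - b)"
    unfolding eventually_at_topological using assms(1-3) by (intro exI[of _ D]) auto
  ultimately have "((\<lambda>a. (f a - f b) / (a - b)) \<longlongrightarrow> G b) (at b)" by (rule Lim_transform_eventually)
  then show ?thesis by (intro DERIV_imp_deriv) (simp add: has_field_derivative_iff)
qed

lemma circlepath_image: "circle = circlepath 0 1 ` {0..1}"
  using path_image_circlepath[of 0 1] by (simp add: path_image_def)

text \<open>The parametrisation of the circle repeats a point only at the endpoints 0 and 1.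
  Simplicity of the curve thus becomes injectivity on the circle, which divided differences
  control.\<close>

lemma simple_path_circle_iff:
  assumes "continuous_on circle f"
  shows "simple_path (f \<circ> circlepath 0 1) \<longleftrightarrow> inj_on f circle"
proof
  assume sp: "simple_path (f \<circ> circlepath 0 1)"
  have c01: "circlepath 0 1 0 = (circlepath 0 1 1 :: complex)"
    using pathstart_circlepath[of 0 1] pathfinish_circlepath[of 0 1] by (simp add: pathstart_def pathfinish_def)
  show "inj_on f circle"
  proof (rule inj_onI)
    fix a b :: complex assume ab: "a \<in> circle" "b \<in> circle" "f a = f b"
    then obtain s t where st: "s \<in> {0..1}" "t \<in> {0..1}" "a = circlepath 0 1 s" "b = circlepath 0 1 t"
      using circlepath_image by blast
    then have "s = t \<or> s = 0 \<and> t = 1 \<or> s = 1 \<and> t = 0"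
      using sp ab(3) unfolding simple_path_def loop_free_def by auto
    then show "a = b" using st c01 by auto
  qed
next
  assume inj: "inj_on f circle"
  have cp: "simple_path (circlepath 0 1)" by (simp add: simple_path_circlepath)
  have "path (f \<circ> circlepath 0 1)"
    unfolding path_def o_def by (rule continuous_on_circle_path[OF assms])
  moreover have "loop_free (f \<circ> circlepath 0 1)"
    unfolding loop_free_def o_def
  proof (intro ballI impI)
    fix s t :: real assume "s \<in> {0..1}" "t \<in> {0..1}" "f (circlepath 0 1 s) = f (circlepath 0 1 t)"
    then have "circlepath 0 1 s = (circlepath 0 1 t :: complex)"
      using inj circlepath_in_circle by (meson inj_onD)
    then show "s = t \<or> s = 0 \<and> t = 1 \<or> s = 1 \<and> t = 0"
      using cp \<open>s \<in> {0..1}\<close> \<open>t \<in> {0..1}\<close> unfolding simple_path_def loop_free_def by blast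
  qed
  ultimately show "simple_path (f \<circ> circlepath 0 1)" by (simp add: simple_path_def)
qed

text \<open>As g is closer to f than f is to 0, both loops wind equally often around 0. A nonzero
  number puts 0 inside the new curve. Inside a simple closed curve the winding number is constantly
  1 or constantly -1, and its value at 0 decides.\<close>

lemma winding_number_stable:
  assumes c: "continuous_on circle f" "continuous_on circle g" and inj: "inj_on g circle"
    and wn: "winding_number (f \<circ> circlepath 0 1) 0 = 1"
    and near: "\<And>z. z \<in> circle \<Longrightarrow> norm (g z - f z) < norm (f z)"
  shows "simple_path (g \<circ> circlepath 0 1)" "0 \<in> inside (path_image (g \<circ> circlepath 0 1))"
    "\<And>a. a \<in> inside (path_image (g \<circ> circlepath 0 1)) \<Longrightarrow> winding_number (g \<circ> circlepath 0 1) a = 1"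
proof -
  let ?f = "f \<circ> circlepath 0 1" and ?g = "g \<circ> circlepath 0 1"
  show sp: "simple_path ?g" using inj simple_path_circle_iff[OF c(2)] by blast
  have p: "path ?f" "path ?g" unfolding path_def o_def by (rule continuous_on_circle_path[OF c(1)], rule continuous_on_circle_path[OF c(2)])
  have loop: "pathfinish ?f = pathstart ?f" "pathfinish ?g = pathstart ?g"
    using pathstart_circlepath[of 0 1] pathfinish_circlepath[of 0 1] by (auto simp: pathstart_def pathfinish_def)
  have wg: "winding_number ?g 0 = 1"
    using winding_number_nearby_loops_eq[OF p loop, of 0] near circlepath_in_circle wn by simp
  have "g z \<noteq> 0" if "z \<in> circle" for z using near[OF that] by auto
  then have "0 \<notin> path_image ?g"
    using circlepath_in_circle unfolding path_image_def by fastforce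
  moreover have "0 \<notin> outside (path_image ?g)"
    using winding_number_zero_in_outside[OF p(2) loop(2)] wg by force
  ultimately show 0: "0 \<in> inside (path_image ?g)" using inside_Un_outside[of "path_image ?g"] by blast
  show "winding_number ?g a = 1" if "a \<in> inside (path_image ?g)" for a
  proof (rule simple_closed_path_winding_number_inside[OF sp])
    assume "\<And>z. z \<in> inside (path_image ?g) \<Longrightarrow> winding_number ?g z = -1"
    from this[OF 0] wg show ?thesis by simp
  qed (use that in blast)
qed

lemma one_plus_small:
  fixes c :: complex
  assumes "norm c < 1"
  shows "1 + c \<notin> \<real>\<^sub>\<le>\<^sub>0" "1 + c \<noteq> 0"
proof -
  have "\<bar>Re c\<bar> < 1" using assms abs_Re_le_cmod[of c] by linarith
  then have "0 < Re (1 + c)" by simp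
  then show "1 + c \<notin> \<real>\<^sub>\<le>\<^sub>0" by (auto simp: complex_nonpos_Reals_iff)
  then show "1 + c \<noteq> 0" by auto
qed

lemma sm_Ln_one_plus:
  assumes "open D" "sm D q" "\<And>x z. z \<in> D \<Longrightarrow> norm (c * q x z) < 1"
  shows "sm D (\<lambda>x z. Ln (1 + c * q x z))"
proof (rule sm_log[OF assms(1)])
  show 1: "sm D (\<lambda>x z. 1 + c * q x z)" by (intro sm_add sm_mult sm_const assms)
  show "continuous_on (UNIV \<times> D) (\<lambda>(x, z). Ln (1 + c * q x z))"
    unfolding case_prod_unfold
  proof (rule continuous_on_Ln')
    show "continuous_on (UNIV \<times> D) (\<lambda>p. 1 + c * q (fst p) (snd p))"
      using sm_cont[OF 1] by (simp only: case_prod_unfold)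
    show "1 + c * q (fst p) (snd p) \<notin> \<real>\<^sub>\<le>\<^sub>0" if "p \<in> UNIV \<times> D" for p
      by (rule one_plus_small(1)[OF assms(3)]) (use that in auto)
  qed
  show "exp (Ln (1 + c * q x z)) = 1 + c * q x z" if "z \<in> D" for x z
    by (rule exp_Ln, rule one_plus_small(2)[OF assms(3)[OF that]])
qed

lemma continuous_on_Ln_line:
  assumes "\<And>\<epsilon>. \<epsilon> \<in> I \<Longrightarrow> norm (of_real \<epsilon> * q) < 1"
  shows "continuous_on I (\<lambda>\<epsilon>. Ln (1 + of_real \<epsilon> * q))"
  by (intro continuous_intros continuous_on_Ln') (use one_plus_small assms in auto)

context loop_rep
begin

text \<open>Each function attached to the deformed loop is the original one times
  \<open>1 + \<epsilon> q\<close>, with a quotient q bounded uniformly in x. For small \<epsilon>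
  this factor lies in the disc of radius 1 around 1: it has no zeros, so the conditions of
  \<open>M0\<close> persist, and it avoids the negative axis, so the principal \<open>Ln\<close>
  continues the branches.\<close>

lemma variation_exists:
  assumes \<gamma>: "\<gamma> \<in> LM0" and X: "X \<in> LTM0"
  shows "\<exists>\<delta> \<Gamma>. variation \<gamma> X \<delta> \<Gamma>"
proof -
  obtain s K Kb where s: "1 < s" "sm (ball 0 s) K" "sm (ball 0 s) Kb"
    "\<And>x z. 1 / s < norm z \<Longrightarrow> fst X x z = K x (1 / z)" "\<And>x z. z \<in> ball 0 s - {0} \<Longrightarrow> snd X x z = Kb x z / z"
    "\<And>x z. z \<in> ball 0 s \<Longrightarrow> K (x + 2 * pi) z = K x z" "\<And>x z. z \<in> ball 0 s \<Longrightarrow> Kb (x + 2 * pi) z = Kb x z"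
    by (rule LTM0_rep[OF X]) blast
  define r0 where "r0 = min R s"
  define r where "r = (1 + r0) / 2"
  have r: "1 < r" "r < r0" "1 < r0" "r0 \<le> R" "r0 \<le> s" using R s by (auto simp: r0_def r_def)
  have inv: "1 / R \<le> 1 / r0" "1 / s \<le> 1 / r0" "1 / r0 < 1 / r" "1 / r < 1" using r by (auto simp: frac_le frac_less2)
  have bsub: "ball 0 r0 \<subseteq> ball (0::complex) R" "ball 0 r0 \<subseteq> ball (0::complex) s" using r by auto
  have AR: "Ann r0 \<subseteq> Ann R" by (rule Ann_mono) (use r in auto)
  note sK = sm_subset[OF s(2) bsub(2)] and sKb = sm_subset[OF s(3) bsub(2)]
    and sh = sm_subset[OF h bsub(1)] and sk = sm_subset[OF k bsub(1)]
  have fX: "fst X x z = K x (1 / z)" if "1 / r0 < norm z" for x z by (rule s(4)) (use that inv in linarith)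
  have sX: "snd X x z = Kb x z / z" if "z \<in> ball 0 r0 - {0}" for x z by (rule s(5)) (use that r in auto)
  have lam0: "lam (\<gamma> x) z = z * h x (1 / z)" if "1 / r0 < norm z" for x z by (rule lam_eq) (use that inv in linarith)
  have lamb0: "lamb (\<gamma> x) z = k x z / z" if "z \<in> ball 0 r0 - {0}" for x z by (rule lamb_eq) (use that r in auto)
  define W where "W x z = fst X x z + snd X x z" for x z
  have sfX: "sm {z. 1 / r0 < norm z} (fst X)"
    by (rule sm_cong_on[OF sm_exterior_inverse[OF sK r(3)]]) (simp add: fX)
  have ssX: "sm (ball 0 r0 - {0}) (snd X)"
    by (rule sm_cong_on[OF sm_divide[OF sm_subset[OF sKb] sm_hol[OF holomorphic_on_ident]]]) (auto simp: sX)
  have Asub: "Ann r0 \<subseteq> {z. 1 / r0 < norm z}" "Ann r0 \<subseteq> ball 0 r0 - {0}"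
    using Ann_nonzero[OF r(3)] by (auto simp: Ann_def)
  have sW: "sm (Ann r0) W"
    unfolding W_def[abs_def] by (rule sm_add[OF sm_subset[OF sfX Asub(1)] sm_subset[OF ssX Asub(2)]])
  have sw: "sm (Ann r0) (\<lambda>x. wfun (\<gamma> x))" by (rule sm_subset[OF sm_wfun AR])
  have slam: "sm {z. 1 / r0 < norm z} (\<lambda>x. lam (\<gamma> x))"
    by (rule sm_subset[OF sm_lam]) (use inv in auto)
  have slamb: "sm (ball 0 r0 - {0}) (\<lambda>x. lamb (\<gamma> x))"
    by (rule sm_subset[OF sm_lamb]) (use r in auto)
  have Wper: "W (x + 2 * pi) z = W x z" if "z \<in> Ann r0" for x z
  proof -
    have "1 / r0 < norm z" "z \<in> ball 0 r0 - {0}" using that Asub by auto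
    then show ?thesis using inverse_mem_ball[OF r(3)] s(6,7) bsub by (auto simp: W_def fX sX subset_iff)
  qed
  have wper: "wfun (\<gamma> (x + 2 * pi)) z = wfun (\<gamma> x) z" if "z \<in> Ann r0" for x z
  proof -
    have "1 / r0 < norm z" "z \<in> ball 0 r0 - {0}" using that Asub by auto
    then show ?thesis using inverse_mem_ball[OF r(3)] h_per k_per bsub by (auto simp: wfun_def lam0 lamb0 subset_iff)
  qed
  have M0\<gamma>: "(lam (\<gamma> x), lamb (\<gamma> x)) \<in> M0" for x using \<gamma> by (auto simp: LM0_def M0_branched_def)
  have cwc: "continuous_on circle (f x)" if "sm (Ann r0) f" for f x
    by (rule continuous_on_subset[OF holomorphic_on_imp_continuous_on[OF sm_holo[OF that]] circle_Ann[OF r(3)]])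
  have M0w: "inj_on (wfun (\<gamma> x)) circle" "winding_number (wfun (\<gamma> x) \<circ> circlepath 0 1) 0 = 1"
    "\<And>z. z \<in> circle \<Longrightarrow> deriv (wfun (\<gamma> x)) z \<noteq> 0" for x
    using M0\<gamma>[of x] simple_path_circle_iff[OF cwc[OF sw, of x]] by (auto simp: M0_def Let_def wfun_def[abs_def])
  \<comment> \<open>All requirements on \<open>\<epsilon>\<close> are bounds on four quotients, one of them for injectivity.\<close>
  let ?A = "\<lambda>z::complex. 1 / r \<le> norm z \<and> norm z \<le> r"
  have cA: "compact {z. ?A z}"
  proof -
    have "{z. ?A z} = cball 0 r \<inter> {z. 1 / r \<le> norm z}" by auto
    moreover have "closed {z::complex. 1 / r \<le> norm z}" by (intro closed_Collect_le continuous_intros)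
    ultimately show ?thesis using compact_Int_closed by (metis compact_cball)
  qed
  have Ar0: "{z. ?A z} \<subseteq> Ann r0" using inv r by (auto simp: Ann_def)
  have crsub: "cball 0 r \<subseteq> ball (0::complex) r0" using r by auto
  have hk_nz: "\<And>x z. z \<in> ball 0 r0 \<Longrightarrow> h x z \<noteq> 0" "\<And>x z. z \<in> ball 0 r0 \<Longrightarrow> k x z \<noteq> 0" "\<And>x z. z \<in> Ann r0 \<Longrightarrow> wfun (\<gamma> x) z \<noteq> 0"
    using h_nz k_nz wfun_nz bsub AR by blast+
  \<comment> \<open>Relative changes of, in turn, \<open>lam\<close> (in the variable
    \<open>1 / z\<close>), \<open>lamb\<close>, w and the divided differences of w.\<close>
  define q1 where "q1 x z = z * K x z / h x z" for x z
  define q2 where "q2 x z = Kb x z / k x z" for x z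
  define q3 where "q3 x z = W x z / wfun (\<gamma> x) z" for x z
  define q4 where "q4 x q = divdiff r (W x) (fst q) (snd q) / divdiff r (wfun (\<gamma> x)) (fst q) (snd q)" for x q
  have sq: "sm (ball 0 r0) q1" "sm (ball 0 r0) q2" "sm (Ann r0) q3"
    unfolding q1_def[abs_def] q2_def[abs_def] q3_def[abs_def]
    by (intro sm_divide sm_mult sm_hol[OF holomorphic_on_ident] sK sKb sh sk sW sw; use hk_nz in blast)+
  have circ: "circle \<subseteq> Ann r" by (rule circle_Ann[OF r(1)])
  have dd_w: "wfun (\<gamma> x) a - wfun (\<gamma> x) b = (a - b) * divdiff r (wfun (\<gamma> x)) a b"
    and dd_W: "W x a - W x b = (a - b) * divdiff r (W x) a b" if "a \<in> Ann r" "b \<in> Ann r" for x a b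
    by (rule divdiff[OF sm_holo[OF sw] r(1,2) that], rule divdiff[OF sm_holo[OF sW] r(1,2) that])
  have dd_cont: "continuous_on (Ann r) (\<lambda>a. divdiff r (f x) a b)" if "sm (Ann r0) f" "b \<in> Ann r" for f x b
  proof -
    have "continuous_on (Ann r) (\<lambda>a. (\<lambda>(x, q). divdiff r (f x) (fst q) (snd q)) (x, (a, b)))"
      by (rule continuous_on_compose2[OF divdiff_continuous[OF that(1) r(1,2)]]) (use that in \<open>auto intro!: continuous_intros\<close>)
    then show ?thesis by simp
  qed
  \<comment> \<open>Off the diagonal this is injectivity of w on the circle, on the diagonal it is
    \<open>w' \<noteq> 0\<close>.\<close>
  have dd_nz: "divdiff r (wfun (\<gamma> x)) a b \<noteq> 0" if ab: "a \<in> circle" "b \<in> circle" for x a b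
  proof (cases "a = b")
    case False
    then have "wfun (\<gamma> x) a \<noteq> wfun (\<gamma> x) b" using M0w(1)[of x] ab by (meson inj_onD)
    moreover have "a \<in> Ann r" "b \<in> Ann r" using ab circ by blast+
    ultimately show ?thesis using dd_w[of a b x] by auto
  next
    case True
    have "deriv (wfun (\<gamma> x)) b = divdiff r (wfun (\<gamma> x)) b b"
    proof (rule deriv_from_quotient[OF open_Ann[of r], where G = "\<lambda>a. divdiff r (wfun (\<gamma> x)) a b"])
      show "b \<in> Ann r" using ab circ by blast
      then show "continuous_on (Ann r) (\<lambda>a. divdiff r (wfun (\<gamma> x)) a b)"
        "\<And>a. a \<in> Ann r \<Longrightarrow> wfun (\<gamma> x) a - wfun (\<gamma> x) b = (a - b) * divdiff r (wfun (\<gamma> x)) a b"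
        using dd_w by (auto intro: dd_cont sw)
    qed
    then show ?thesis using M0w(3)[OF ab(2), of x] True by simp
  qed
  have dper: "divdiff r (f (x + 2 * pi)) a b = divdiff r (f x) a b" if "\<And>x z. z \<in> Ann r0 \<Longrightarrow> f (x + 2 * pi) z = f x z" for f :: "real \<Rightarrow> complex \<Rightarrow> complex" and x a b
    unfolding divdiff_def using that scaled_circle_Ann[OF r(1,2)] by (intro arg_cong2[where f = "(-)"] cint_cong) auto
  obtain M1 where M1: "0 < M1" "\<And>x z. z \<in> cball 0 r \<Longrightarrow> norm (q1 x z) \<le> M1"
  proof (rule periodic_bounded[OF compact_cball[of 0 r], of q1])
    show "continuous_on (UNIV \<times> cball 0 r) (\<lambda>(x, z). q1 x z)" by (rule continuous_on_subset[OF sm_cont[OF sq(1)]]) (use crsub in blast)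
    show "q1 (x + 2 * pi) z = q1 x z" if "z \<in> cball 0 r" for x z
      using that crsub bsub s(6) h_per by (simp add: q1_def subset_iff)
  qed blast
  obtain M2 where M2: "0 < M2" "\<And>x z. z \<in> cball 0 r \<Longrightarrow> norm (q2 x z) \<le> M2"
  proof (rule periodic_bounded[OF compact_cball[of 0 r], of q2])
    show "continuous_on (UNIV \<times> cball 0 r) (\<lambda>(x, z). q2 x z)" by (rule continuous_on_subset[OF sm_cont[OF sq(2)]]) (use crsub in blast)
    show "q2 (x + 2 * pi) z = q2 x z" if "z \<in> cball 0 r" for x z
      using that crsub bsub s(7) k_per by (simp add: q2_def subset_iff)
  qed blast
  obtain M3 where M3: "0 < M3" "\<And>x z. z \<in> {z. ?A z} \<Longrightarrow> norm (q3 x z) \<le> M3"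
  proof (rule periodic_bounded[OF cA, of q3])
    show "continuous_on (UNIV \<times> {z. ?A z}) (\<lambda>(x, z). q3 x z)" by (rule continuous_on_subset[OF sm_cont[OF sq(3)]]) (use Ar0 in blast)
    show "q3 (x + 2 * pi) z = q3 x z" if "z \<in> {z. ?A z}" for x z
      using Wper wper that Ar0 by (simp add: q3_def subset_iff)
  qed blast
  obtain M4 where M4: "0 < M4" "\<And>x q. q \<in> circle \<times> circle \<Longrightarrow> norm (q4 x q) \<le> M4"
  proof (rule periodic_bounded[of "circle \<times> circle" q4])
    have c: "continuous_on (UNIV \<times> (circle \<times> circle)) (\<lambda>t. divdiff r (f (fst t)) (fst (snd t)) (snd (snd t)))" if "sm (Ann r0) f" for f
      using continuous_on_subset[OF divdiff_continuous[OF that r(1,2)], of "UNIV \<times> (circle \<times> circle)"] circ by (auto simp: case_prod_unfold)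
    show "continuous_on (UNIV \<times> (circle \<times> circle)) (\<lambda>(x, q). q4 x q)"
      unfolding q4_def case_prod_unfold by (intro continuous_on_divide c sW sw) (use dd_nz in auto)
    show "q4 (x + 2 * pi) q = q4 x q" for x q
      using dper[of W x] dper[of "\<lambda>x. wfun (\<gamma> x)" x] Wper wper by (simp add: q4_def)
    show "compact (circle \<times> circle)" by (intro compact_Times compact_sphere)
  qed blast
  \<comment> \<open>The sum dominates each of the four bounds, so that the one estimate
    \<open>small\<close> applies to all quotients.\<close>
  define \<delta> where "\<delta> = 1 / (M1 + M2 + M3 + M4)"
  have \<delta>: "\<delta> > 0" using M1 M2 M3 M4 by (simp add: \<delta>_def)
  have small: "norm (of_real \<epsilon> * c) < 1" if e: "\<epsilon> \<in> {-\<delta><..<\<delta>}" and c: "norm c \<le> M1 \<or> norm c \<le> M2 \<or> norm c \<le> M3 \<or> norm c \<le> M4" for \<epsilon> and c :: complex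
  proof -
    have "norm c \<le> M1 + M2 + M3 + M4" using c M1(1) M2(1) M3(1) M4(1) by linarith
    then have "norm (of_real \<epsilon> * c) \<le> \<bar>\<epsilon>\<bar> * (M1 + M2 + M3 + M4)"
      unfolding norm_mult norm_of_real by (intro mult_left_mono) auto
    also have "\<dots> < \<delta> * (M1 + M2 + M3 + M4)"
      using e M1(1) M2(1) M3(1) M4(1) by (intro mult_strict_right_mono) auto
    also have "\<dots> = 1" using M1(1) M2(1) M3(1) M4(1) by (simp add: \<delta>_def)
    finally show ?thesis .
  qed
  \<comment> \<open>The added logarithms vanish at \<open>\<epsilon> = 0\<close> and are continuous
    in \<epsilon>, as a continued branch must be. For u the quotient is taken at 0, because
    \<open>exp u\<close> is the value of \<open>z lamb\<close> there.\<close>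
  define \<Gamma> where "\<Gamma> \<epsilon> x = Point (\<lambda>z. lam (\<gamma> x) z + of_real \<epsilon> * fst X x z) (\<lambda>z. lamb (\<gamma> x) z + of_real \<epsilon> * snd X x z)
     (ucoord (\<gamma> x) + Ln (1 + of_real \<epsilon> * q2 x 0)) (\<lambda>z. logwz (\<gamma> x) z + Ln (1 + of_real \<epsilon> * q3 x z))" for \<epsilon> x
  have wG: "wfun (\<Gamma> \<epsilon> x) z = wfun (\<gamma> x) z + of_real \<epsilon> * W x z" for \<epsilon> x z
    by (simp add: wfun_def \<Gamma>_def W_def algebra_simps)
  have G0: "\<Gamma> 0 = \<gamma>" by (simp add: \<Gamma>_def fun_eq_iff)
  have zero_r: "(0::complex) \<in> cball 0 r" using r by simp
  have uc: "continuous_on {-\<delta><..<\<delta>} (\<lambda>\<epsilon>. ucoord (\<Gamma> \<epsilon> x))" for x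
    unfolding \<Gamma>_def point.sel
    by (intro continuous_on_add continuous_on_const continuous_on_Ln_line small) (use M2(2)[OF zero_r] in auto)
  have Lc: "continuous_on {-\<delta><..<\<delta>} (\<lambda>\<epsilon>. logwz (\<Gamma> \<epsilon> x) z)" if "z \<in> circle" for x z
    unfolding \<Gamma>_def point.sel
    by (intro continuous_on_add continuous_on_const continuous_on_Ln_line small)
      (use M3(2)[of z x] that r inv in auto)
  have "\<Gamma> \<epsilon> \<in> LM0" if e: "\<epsilon> \<in> {-\<delta><..<\<delta>}" for \<epsilon>
  proof -
    have n1: "1 + of_real \<epsilon> * q1 x z \<noteq> 0" and n2: "1 + of_real \<epsilon> * q2 x z \<noteq> 0" if "z \<in> cball 0 r" for x z
      using one_plus_small(2)[OF small[OF e]] M1(2)[OF that] M2(2)[OF that] by auto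
    have n3: "norm (of_real \<epsilon> * q3 x z) < 1" if "z \<in> Ann r" for x z
      by (rule small[OF e]) (use M3(2)[of z x] that in \<open>auto simp: Ann_def\<close>)
    have n4: "1 + of_real \<epsilon> * q4 x q \<noteq> 0" if "q \<in> circle \<times> circle" for x q
      using one_plus_small(2)[OF small[OF e]] M4(2)[OF that] by auto
    have sl: "sm {z. 1 / r0 < norm z} (\<lambda>x. lam (\<Gamma> \<epsilon> x))"
      unfolding \<Gamma>_def point.sel by (intro sm_add sm_mult sm_const slam sfX)
    have sb: "sm (ball 0 r0 - {0}) (\<lambda>x. lamb (\<Gamma> \<epsilon> x))"
      unfolding \<Gamma>_def point.sel by (intro sm_add sm_mult sm_const slamb ssX)
    have sL: "sm (Ann r) (\<lambda>x. logwz (\<Gamma> \<epsilon> x))"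
      unfolding \<Gamma>_def point.sel
    proof (rule sm_add)
      have Arr: "Ann r \<subseteq> Ann r0" by (rule Ann_mono) (use r in auto)
      show "sm (Ann r) (\<lambda>x. logwz (\<gamma> x))" by (rule sm_subset[OF L]) (use Arr AR in blast)
      show "sm (Ann r) (\<lambda>x z. Ln (1 + of_real \<epsilon> * q3 x z))"
        by (rule sm_Ln_one_plus[OF open_Ann sm_subset[OF sq(3) Arr] n3])
    qed
    have su: "smooth_fun (\<lambda>x. ucoord (\<Gamma> \<epsilon> x))"
    proof -
      have "sm (ball 0 r) (\<lambda>x z. ucoord (\<gamma> x) + Ln (1 + of_real \<epsilon> * q2 x z))"
        by (intro sm_add smooth_fun_sm[OF u] sm_Ln_one_plus[OF open_ball sm_subset[OF sq(2)]] small[OF e])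
          (use crsub M2(2) in auto)
      from sm_smooth_fun[OF this, of 0] show ?thesis using r by (simp add: \<Gamma>_def)
    qed
    have Dsub: "Dinf \<subseteq> {z. 1 / r0 < norm z}" "D0p \<subseteq> ball 0 r0 - {0}" using Dinf_exterior[OF r(3)] r by auto
    have op: "open {z::complex. 1 / r0 < norm z}" "open (ball (0::complex) r0 - {0})"
      by (rule open_norm_exterior, simp add: open_delete)
    have lnz: "lam (\<Gamma> \<epsilon> x) z \<noteq> 0" if z: "z \<in> Dinf" for x z
    proof -
      have z': "1 / r0 < norm z" "z \<noteq> 0" "1 / z \<in> cball 0 r" "1 / z \<in> ball 0 r0"
        using Dinf_exterior[OF r(3) z] Dinf_exterior[OF r(1) z] inverse_mem_ball[of r z] inverse_mem_ball[of r0 z] r by auto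
      have "lam (\<Gamma> \<epsilon> x) z = z * h x (1 / z) * (1 + of_real \<epsilon> * q1 x (1 / z))"
        using hk_nz(1)[OF z'(4), of x] z'(2) by (simp add: \<Gamma>_def lam0[OF z'(1)] fX[OF z'(1)] q1_def field_simps)
      then show ?thesis using n1[OF z'(3), of x] hk_nz(1)[OF z'(4), of x] z'(2) by simp
    qed
    have beq: "lamb (\<Gamma> \<epsilon> x) z = k x z * (1 + of_real \<epsilon> * q2 x z) / z" if z: "z \<in> ball 0 r0 - {0}" for x z
      using hk_nz(2)[of z x] z by (simp add: \<Gamma>_def lamb0[OF z] sX[OF z] q2_def field_simps)
    have bh: "(\<lambda>z. k x z * (1 + of_real \<epsilon> * q2 x z)) holomorphic_on ball 0 r0" for x
      by (intro holomorphic_intros sm_holo[OF sk] sm_holo[OF sq(2)])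
    have bl: "lcoeff (lamb (\<Gamma> \<epsilon> x)) (-1) = k x 0 * (1 + of_real \<epsilon> * q2 x 0)" for x
      by (rule lcoeff_simple_pole(1)[OF bh r(3)], rule beq) (use r in auto)
    have bnz: "lamb (\<Gamma> \<epsilon> x) z \<noteq> 0" if z: "z \<in> D0p" for x z
    proof -
      have "z \<in> ball 0 r0 - {0}" "z \<in> cball 0 r" "z \<in> ball 0 r0" "z \<noteq> 0" using z r by auto
      then show ?thesis using beq[of z x] n2[of z x] hk_nz(2)[of z x] by simp
    qed
    have wh: "wfun (\<Gamma> \<epsilon> x) holomorphic_on Ann r0" for x
      unfolding wG by (intro holomorphic_intros sm_holo[OF sw] sm_holo[OF sW])
    have wq: "wfun (\<Gamma> \<epsilon> x) a - wfun (\<Gamma> \<epsilon> x) b = (a - b) * (divdiff r (wfun (\<gamma> x)) a b + of_real \<epsilon> * divdiff r (W x) a b)"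
      if "a \<in> Ann r" "b \<in> Ann r" for x a b
    proof -
      have "wfun (\<Gamma> \<epsilon> x) a - wfun (\<Gamma> \<epsilon> x) b = (wfun (\<gamma> x) a - wfun (\<gamma> x) b) + of_real \<epsilon> * (W x a - W x b)"
        unfolding wG by (simp add: algebra_simps)
      then show ?thesis unfolding dd_w[OF that] dd_W[OF that] by (simp add: algebra_simps)
    qed
    have wd: "divdiff r (wfun (\<gamma> x)) a b + of_real \<epsilon> * divdiff r (W x) a b \<noteq> 0" if "a \<in> circle" "b \<in> circle" for x a b
    proof -
      have "divdiff r (wfun (\<gamma> x)) a b + of_real \<epsilon> * divdiff r (W x) a b = divdiff r (wfun (\<gamma> x)) a b * (1 + of_real \<epsilon> * q4 x (a, b))"
        using dd_nz[OF that, of x] by (simp add: q4_def field_simps)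
      then show ?thesis using dd_nz[OF that, of x] n4[of "(a, b)" x] that by auto
    qed
    have winj: "inj_on (wfun (\<Gamma> \<epsilon> x)) circle" for x
    proof (rule inj_onI)
      fix a b :: complex assume ab: "a \<in> circle" "b \<in> circle" "wfun (\<Gamma> \<epsilon> x) a = wfun (\<Gamma> \<epsilon> x) b"
      then have "(a - b) * (divdiff r (wfun (\<gamma> x)) a b + of_real \<epsilon> * divdiff r (W x) a b) = 0"
        using wq[of a b x] circ by (simp add: subset_iff)
      then show "a = b" using wd[OF ab(1,2), of x] by simp
    qed
    have wderiv: "deriv (wfun (\<Gamma> \<epsilon> x)) z \<noteq> 0" if z: "z \<in> circle" for x z
    proof -
      have "deriv (wfun (\<Gamma> \<epsilon> x)) z = divdiff r (wfun (\<gamma> x)) z z + of_real \<epsilon> * divdiff r (W x) z z"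
      proof (rule deriv_from_quotient[OF open_Ann[of r], where G = "\<lambda>a. divdiff r (wfun (\<gamma> x)) a z + of_real \<epsilon> * divdiff r (W x) a z"])
        show zA: "z \<in> Ann r" using z circ by blast
        show "continuous_on (Ann r) (\<lambda>a. divdiff r (wfun (\<gamma> x)) a z + of_real \<epsilon> * divdiff r (W x) a z)"
          by (intro continuous_on_add continuous_on_mult continuous_on_const dd_cont[OF sw zA] dd_cont[OF sW zA])
      qed (use wq z circ in blast)
      then show ?thesis using wd[OF z z, of x] by simp
    qed
    have near: "norm (wfun (\<Gamma> \<epsilon> x) z - wfun (\<gamma> x) z) < norm (wfun (\<gamma> x) z)" if z: "z \<in> circle" for x z
    proof -
      have zA: "z \<in> Ann r" "z \<in> Ann r0" using z circ circle_Ann[OF r(3)] by auto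
      have "wfun (\<Gamma> \<epsilon> x) z - wfun (\<gamma> x) z = wfun (\<gamma> x) z * (of_real \<epsilon> * q3 x z)"
        using hk_nz(3)[OF zA(2), of x] unfolding wG by (simp add: q3_def)
      then show ?thesis using n3[OF zA(1), of x] hk_nz(3)[OF zA(2), of x] by (simp add: norm_mult)
    qed
    have cG: "continuous_on circle (wfun (\<Gamma> \<epsilon> x))" for x
      by (rule continuous_on_subset[OF holomorphic_on_imp_continuous_on[OF wh] circle_Ann[OF r(3)]])
    have stable: "simple_path (wfun (\<Gamma> \<epsilon> x) \<circ> circlepath 0 1)" "0 \<in> inside (path_image (wfun (\<Gamma> \<epsilon> x) \<circ> circlepath 0 1))" for x
      using winding_number_stable(1,2)[OF cwc[OF sw] cG winj M0w(2) near, of x] by blast+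
    have stable3: "\<forall>a\<in>inside (path_image (wfun (\<Gamma> \<epsilon> x) \<circ> circlepath 0 1)). winding_number (wfun (\<Gamma> \<epsilon> x) \<circ> circlepath 0 1) a = 1" for x
      by (intro ballI) (rule winding_number_stable(3)[OF cwc[OF sw, of x] cG winj M0w(2)[of x] near])
    have la: "lam (\<Gamma> \<epsilon> x) analytic_on Dinf" for x
      using sm_holo[OF sl] op(1) Dsub(1) analytic_on_holomorphic by blast
    have lO: "(\<lambda>z. lam (\<Gamma> \<epsilon> x) z - z) \<in> O[at_infinity](\<lambda>_. 1)" for x
    proof -
      have "(\<lambda>z. lam (\<gamma> x) z - z) \<in> O[at_infinity](\<lambda>_. 1)" using M0\<gamma>[of x] by (auto simp: M0_def)
      moreover have "fst X x \<in> O[at_infinity](\<lambda>_. 1)" using X by (auto simp: LTM0_def hol_Dinf_def)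
      then have "(\<lambda>z. of_real \<epsilon> * fst X x z) \<in> O[at_infinity](\<lambda>_. 1)" by simp
      ultimately have "(\<lambda>z. (lam (\<gamma> x) z - z) + of_real \<epsilon> * fst X x z) \<in> O[at_infinity](\<lambda>_. 1)" by (rule sum_in_bigo)
      then show ?thesis by (simp add: \<Gamma>_def algebra_simps)
    qed
    have bi: "hol_inv_D0 (lamb (\<Gamma> \<epsilon> x))" for x
      unfolding hol_inv_D0_def
    proof (intro conjI exI[of _ "\<lambda>z. k x z * (1 + of_real \<epsilon> * q2 x z)"] ballI)
      show "lamb (\<Gamma> \<epsilon> x) analytic_on D0p" using sm_holo[OF sb] op(2) Dsub(2) analytic_on_holomorphic by blast
      show "(\<lambda>z. k x z * (1 + of_real \<epsilon> * q2 x z)) analytic_on cball 0 1"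
        by (rule analytic_on_subset[of _ "ball 0 r0"]) (use bh r in \<open>auto simp: analytic_on_open\<close>)
    qed (use beq Dsub in blast)
    have "(lam (\<Gamma> \<epsilon> x), lamb (\<Gamma> \<epsilon> x)) \<in> M0" for x
      unfolding M0_def Let_def
      using la lO bi bl[of x] n2[OF zero_r, of x] k_nz[of 0 x] R wderiv[of _ x] stable[of x] stable3[of x] lnz bnz
      by (auto simp: wfun_def[abs_def])
    moreover have "exp (ucoord (\<Gamma> \<epsilon> x)) = lcoeff (lamb (\<Gamma> \<epsilon> x)) (-1)" for x
      unfolding bl using n2[OF zero_r, of x] by (simp add: \<Gamma>_def exp_add exp_u)
    moreover have "logwz (\<Gamma> \<epsilon> x) analytic_on circle" for x
      using sm_holo[OF sL] open_Ann circ analytic_on_holomorphic by blast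
    moreover have "exp (logwz (\<Gamma> \<epsilon> x) z) = wfun (\<Gamma> \<epsilon> x) z / z" if z: "z \<in> circle" for x z
    proof -
      have zA: "z \<in> Ann r" "z \<in> Ann r0" "z \<in> Ann R" using z circ circle_Ann[OF r(3)] AR by auto
      have "exp (logwz (\<Gamma> \<epsilon> x) z) = wfun (\<gamma> x) z / z * (1 + of_real \<epsilon> * q3 x z)"
        using one_plus_small(2)[OF n3[OF zA(1)], of x] exp_L[OF zA(3), of x] by (simp add: \<Gamma>_def exp_add)
      also have "\<dots> = (wfun (\<gamma> x) z * (1 + of_real \<epsilon> * q3 x z)) / z" by simp
      also have "wfun (\<gamma> x) z * (1 + of_real \<epsilon> * q3 x z) = wfun (\<Gamma> \<epsilon> x) z"
        using hk_nz(3)[OF zA(2), of x] unfolding wG by (simp add: q3_def distrib_left)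
      finally show ?thesis .
    qed
    ultimately have MB: "\<Gamma> \<epsilon> x \<in> M0_branched" for x by (auto simp: M0_branched_def)
    have "smooth_loop Dinf (\<lambda>x. lam (\<Gamma> \<epsilon> x))"
      unfolding smooth_loop_def smooth_germ_iff_sm
    proof (intro conjI allI ballI)
      show "\<exists>U. open U \<and> Dinf \<subseteq> U \<and> sm U (\<lambda>x. lam (\<Gamma> \<epsilon> x))" using sl op(1) Dsub(1) by blast
      fix x z assume "z \<in> Dinf"
      then show "lam (\<Gamma> \<epsilon> (x + 2 * pi)) z = lam (\<Gamma> \<epsilon> x) z"
        using \<gamma> X unfolding LM0_def LTM0_def smooth_loop_def by (auto simp: \<Gamma>_def)
    qed
    moreover have "smooth_loop D0p (\<lambda>x. lamb (\<Gamma> \<epsilon> x))"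
      unfolding smooth_loop_def smooth_germ_iff_sm
    proof (intro conjI allI ballI)
      show "\<exists>U. open U \<and> D0p \<subseteq> U \<and> sm U (\<lambda>x. lamb (\<Gamma> \<epsilon> x))" using sb op(2) Dsub(2) by blast
      fix x z assume "z \<in> D0p"
      then show "lamb (\<Gamma> \<epsilon> (x + 2 * pi)) z = lamb (\<Gamma> \<epsilon> x) z"
        using \<gamma> X unfolding LM0_def LTM0_def smooth_loop_def by (auto simp: \<Gamma>_def)
    qed
    moreover have "smooth_loop circle (\<lambda>x. logwz (\<Gamma> \<epsilon> x))"
      unfolding smooth_loop_def smooth_germ_iff_sm
    proof (intro conjI allI ballI)
      show "\<exists>U. open U \<and> circle \<subseteq> U \<and> sm U (\<lambda>x. logwz (\<Gamma> \<epsilon> x))" using sL open_Ann circ by blast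
      fix x z assume "z \<in> circle"
      then have "z \<in> Ann r0" "z \<in> Ann R" using circle_Ann[OF r(3)] AR by auto
      then show "logwz (\<Gamma> \<epsilon> (x + 2 * pi)) z = logwz (\<Gamma> \<epsilon> x) z"
        using L_per Wper wper by (simp add: \<Gamma>_def q3_def)
    qed
    ultimately show ?thesis using MB su by (simp add: LM0_def)
  qed
  then have "variation \<gamma> X \<delta> \<Gamma>"
    unfolding variation_def using \<delta> G0 uc Lc by (simp add: \<Gamma>_def)
  then show ?thesis by blast
qed

end

section \<open>Uniqueness of the differential\<close>

lemma smooth_loop_circle_obtain:
  assumes "smooth_loop circle f"
  obtains r where "1 < r" "sm (Ann r) f" "\<And>x z. z \<in> circle \<Longrightarrow> f (x + 2 * pi) z = f x z"
proof -
  obtain D where D: "open D" "circle \<subseteq> D" "sm D f" and per: "\<And>x z. z \<in> circle \<Longrightarrow> f (x + 2 * pi) z = f x z"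
    using assms unfolding smooth_loop_def smooth_germ_iff_sm by blast
  obtain r where r: "1 < r" "Ann r \<subseteq> D" using annulus_in_open[OF D(1,2)] by metis
  show thesis by (rule that[OF r(1) sm_subset[OF D(3) r(2)] per])
qed

lemma smooth_loop_fun_sm: "smooth_loop_fun f \<longleftrightarrow> sm UNIV (\<lambda>x z. f x) \<and> (\<forall>x. f (x + 2 * pi) = f x)"
  using smooth_fun_sm[of f UNIV] sm_smooth_fun[of UNIV "\<lambda>x z. f x" 0] by (auto simp: smooth_loop_fun_def)

text \<open>A coefficient is a circle mean against a power of the integration variable, an instance
  of \<open>sm_cint_kernel\<close> with a kernel constant in z.\<close>

lemma smooth_loop_fun_lcoeff:
  assumes "smooth_loop circle f"
  shows "smooth_loop_fun (\<lambda>x. lcoeff (f x) n)"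
proof -
  obtain r where r: "1 < r" "sm (Ann r) f" "\<And>x z. z \<in> circle \<Longrightarrow> f (x + 2 * pi) z = f x z"
    using smooth_loop_circle_obtain[OF assms] by metis
  have "sm UNIV (\<lambda>x z. cint (\<lambda>\<eta>. f x \<eta> * \<eta> powi (- n)))"
  proof (rule sm_cint_kernel[OF r(2), where \<kappa>' = "\<lambda>\<eta> z. 0"])
    show "continuous_on (circle \<times> UNIV) (\<lambda>(\<eta>, z :: complex). \<eta> powi (- n))"
      unfolding case_prod_unfold by (intro continuous_intros) auto
  qed (use circle_Ann[OF r(1)] in \<open>auto intro!: continuous_intros\<close>)
  moreover have "lcoeff (f (x + 2 * pi)) n = lcoeff (f x) n" for x
    by (rule lcoeff_cong) (rule r(3))
  ultimately show ?thesis by (simp add: smooth_loop_fun_sm lcoeff_def)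
qed

lemma smooth_loop_fun_cnj: "smooth_loop_fun f \<Longrightarrow> smooth_loop_fun (\<lambda>x. cnj (f x))"
  unfolding smooth_loop_fun_def smooth_fun_def
  by (elim conjE exE, intro conjI)
    (rule exI[of _ "\<lambda>n x. cnj (_ n x)"], auto intro!: has_vector_derivative_cnj)

lemma smooth_loop_fun_diff: "smooth_loop_fun f \<Longrightarrow> smooth_loop_fun g \<Longrightarrow> smooth_loop_fun (\<lambda>x. f x - g x)"
  and smooth_loop_fun_add: "smooth_loop_fun f \<Longrightarrow> smooth_loop_fun g \<Longrightarrow> smooth_loop_fun (\<lambda>x. f x + g x)"
  and smooth_loop_fun_mult: "smooth_loop_fun f \<Longrightarrow> smooth_loop_fun g \<Longrightarrow> smooth_loop_fun (\<lambda>x. f x * g x)"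
  and smooth_loop_fun_inverse: "smooth_loop_fun f \<Longrightarrow> (\<And>x. f x \<noteq> 0) \<Longrightarrow> smooth_loop_fun (\<lambda>x. inverse (f x))"
  unfolding smooth_loop_fun_sm by (auto intro: sm_diff sm_add sm_mult sm_inverse)

lemma smooth_loop_fun_continuous: "smooth_loop_fun f \<Longrightarrow> continuous_on S f"
  using sm_contx[of UNIV "\<lambda>x z. f x" 0] by (auto simp: smooth_loop_fun_sm)

text \<open>The pairing is bilinear, so positivity requires a conjugate: the test function
  \<open>cnj (f - g)\<close> turns the hypothesis into a vanishing integral of
  \<open>|f - g|^2\<close>. Continuity gives equality on one period, and periodicity
  everywhere.\<close>

lemma smooth_loop_fun_eqI:
  assumes f: "smooth_loop_fun f" "smooth_loop_fun g"
    and i: "\<And>\<phi>. smooth_loop_fun \<phi> \<Longrightarrow> integral {0..2 * pi} (\<lambda>x. \<phi> x * f x) = integral {0..2 * pi} (\<lambda>x. \<phi> x * g x)"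
  shows "f x = g x"
proof -
  define d where "d x = f x - g x" for x
  have d: "smooth_loop_fun d" "smooth_loop_fun (\<lambda>x. cnj (d x))"
    unfolding d_def by (intro smooth_loop_fun_cnj smooth_loop_fun_diff f)+
  have int: "(\<lambda>x. cnj (d x) * h x) integrable_on {0..2 * pi}" if "smooth_loop_fun h" for h
    by (intro integrable_continuous_real smooth_loop_fun_continuous smooth_loop_fun_mult d that)
  have "integral {0..2 * pi} (\<lambda>x. cnj (d x) * d x) = integral {0..2 * pi} (\<lambda>x. cnj (d x) * f x - cnj (d x) * g x)"
    by (simp add: d_def algebra_simps)
  also have "\<dots> = 0" using i[OF d(2)] int[OF f(1)] int[OF f(2)] by (simp add: integral_diff)
  finally have "((\<lambda>x. cnj (d x) * d x) has_integral 0) {0..2 * pi}"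
    using int[OF d(1)] by (metis integrable_integral)
  from has_integral_Re[OF this] have "((\<lambda>x. Re (cnj (d x) * d x)) has_integral 0) {0..2 * pi}" by simp
  moreover have "Re (cnj z * z) = (norm z)\<^sup>2" for z 
    by (simp add: cmod_power2) (simp add: power2_eq_square)
  ultimately have "((\<lambda>x. (norm (d x))\<^sup>2) has_integral 0) {0..2 * pi}" by (simp only:)
  then have "integral {0..2 * pi} (\<lambda>x. (norm (d x))\<^sup>2) = 0" by (rule integral_unique)
  moreover have "continuous_on {0..2 * pi} (\<lambda>x. (norm (d x))\<^sup>2)"
    by (intro continuous_intros smooth_loop_fun_continuous d)
  ultimately have z: "\<forall>y\<in>{0..2 * pi}. (norm (d y))\<^sup>2 = 0"
    by (subst (asm) integral_eq_0_iff) auto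
  have "\<And>x. d (x + 2 * pi) = d x" using d(1) by (simp add: smooth_loop_fun_def)
  from periodic_reduce[of d, OF this, of x] z have "d x = 0" by auto
  then show ?thesis by (simp add: d_def)
qed

lemma lcoeffs_determine:
  assumes "f holomorphic_on Ann R" "g holomorphic_on Ann R" "1 < R" "\<And>n. lcoeff f n = lcoeff g n" "z \<in> circle"
  shows "f z = g z"
proof -
  define r where "r = (1 + R) / 2"
  have r: "1 < r" "r < R" using assms(3) by (auto simp: r_def)
  have split: "h z = plus_part h z + minus_part h z" if h: "h holomorphic_on Ann R" for h
  proof -
    have s: "h z = qpart r h z + ppart r h (1 / z) / z" if "z \<in> circle" for z
      using Laurent_split[OF h r] circle_Ann[OF r(1)] that by blast
    have z: "z \<in> ball 0 r" "1 / z \<in> ball 0 r" "z \<noteq> 0" using assms(5) r by (auto simp: norm_divide)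
    show ?thesis
      using plus_part_Laurent[OF qpart_holomorphic[OF h r] ppart_holomorphic[OF h r] r(1) s z(1)]
        minus_part_Laurent[OF qpart_holomorphic[OF h r] ppart_holomorphic[OF h r] r(1) s z(2,3)] s[OF assms(5)] by simp
  qed
  have "plus_part f z = plus_part g z" "minus_part f z = minus_part g z"
    by (simp_all add: plus_part_def minus_part_def assms(4))
  then show ?thesis using split[OF assms(1)] split[OF assms(2)] by simp
qed

lemma monomial_LTM0:
  assumes "smooth_loop_fun \<phi>"
  shows "(\<lambda>x z. \<phi> x * (1 / z) ^ n, \<lambda>x z. 0) \<in> LTM0" "(\<lambda>x z. 0, \<lambda>x z. \<phi> x * z ^ n / z) \<in> LTM0"
proof -
  have \<phi>: "smooth_fun \<phi>" "\<And>x. \<phi> (x + 2 * pi) = \<phi> x" using assms by (auto simp: smooth_loop_fun_def)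
  have s: "sm (ball 0 2) (\<lambda>x z. \<phi> x * z ^ n)"
    by (intro sm_mult smooth_fun_sm[OF \<phi>(1)] sm_hol holomorphic_intros)
  show "(\<lambda>x z. \<phi> x * (1 / z) ^ n, \<lambda>x z. 0) \<in> LTM0" "(\<lambda>x z. 0, \<lambda>x z. \<phi> x * z ^ n / z) \<in> LTM0"
    using LTM0_I[OF _ s sm_const[of _ 0]] LTM0_I[OF _ sm_const[of _ 0] s] \<phi>(2) by simp_all
qed

lemma pairing_exterior_monomial:
  "pairing \<alpha> (coords \<gamma> (\<lambda>x z. \<phi> x * (1 / z) ^ n, \<lambda>x z. 0) x) = \<phi> x * lcoeff (fst \<alpha>) (int n)"
proof -
  have "cint (\<lambda>z. fst \<alpha> z * (\<phi> x * (1 / z) ^ n)) = cint (\<lambda>z. \<phi> x * (fst \<alpha> z * z powi (- int n)))"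
    by (rule cint_cong) (auto simp: power_int_minus field_simps)
  then show ?thesis
    by (simp add: pairing_def coords_def lcoeff_def cint_mult_left cint_zero)
qed

text \<open>The direction \<open>z^(n-1)\<close> in \<open>lamb\<close> probes the Laurent
  coefficient of index \<open>1 - n\<close>. The v-component is seen only by the constant direction,
  \<open>n = 1\<close>, and the u-component only by the pole, \<open>n = 0\<close>, with the
  division by \<open>exp u\<close> from \<open>coords\<close>.\<close>

lemma pairing_interior_monomial:
  "pairing \<alpha> (coords \<gamma> (\<lambda>x z. 0, \<lambda>x z. \<phi> x * z ^ n / z) x)
    = \<phi> x * (lcoeff (fst \<alpha>) (1 - int n) + (if n = 1 then fst (snd \<alpha>) else 0) + (if n = 0 then snd (snd \<alpha>) / lcoeff (lamb (\<gamma> x)) (-1) else 0))"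
proof -
  have "cint (\<lambda>z. fst \<alpha> z * (\<phi> x * z ^ n / z)) = cint (\<lambda>z. \<phi> x * (fst \<alpha> z * z powi (- (1 - int n))))"
  proof (rule cint_cong)
    fix z :: complex assume "z \<in> circle"
    then have "z \<noteq> 0" by auto
    then have "z powi (- (1 - int n)) = z ^ n / z" by (simp add: power_int_diff)
    then show "fst \<alpha> z * (\<phi> x * z ^ n / z) = \<phi> x * (fst \<alpha> z * z powi (- (1 - int n)))" by simp
  qed
  then have 1: "cint (\<lambda>z. fst \<alpha> z * (\<phi> x * z ^ n / z)) = \<phi> x * lcoeff (fst \<alpha>) (1 - int n)"
    by (simp only: cint_mult_left lcoeff_def)
  have hol: "(\<lambda>z. \<phi> x * z ^ n) holomorphic_on ball 0 2" by (intro holomorphic_intros)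
  have 2: "lcoeff (\<lambda>z. \<phi> x * z ^ n / z) (-1) = \<phi> x * 0 ^ n"
    by (rule lcoeff_simple_pole(1)[OF hol]) auto
  have "((\<lambda>z. \<phi> x * z ^ n) has_field_derivative \<phi> x * (of_nat n * 0 ^ (n - 1))) (at 0)"
    by (auto intro!: derivative_eq_intros)
  then have "deriv (\<lambda>z. \<phi> x * z ^ n) 0 = \<phi> x * (of_nat n * 0 ^ (n - 1))" by (rule DERIV_imp_deriv)
  then have 3: "lcoeff (\<lambda>z. \<phi> x * z ^ n / z) 0 = \<phi> x * (of_nat n * 0 ^ (n - 1))"
    using lcoeff_simple_pole(2)[OF hol, of "\<lambda>z. \<phi> x * z ^ n / z"] by simp
  have "n = 0 \<or> n = 1 \<or> n \<ge> 2" by linarith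
  then show ?thesis
    unfolding pairing_def coords_def fst_conv snd_conv add_0 1 2 3 by (auto simp: algebra_simps zero_power)
qed

text \<open>The equations obtained from monomials are triangular. Directions in \<open>lam\<close>
  determine the Laurent coefficients of index at least 0, and directions in \<open>lamb\<close>
  without pole or constant term those of negative index. The two remaining directions combine the v-
  and u-components with the coefficients of index 0 and 1, which are known by then.\<close>

lemma is_differential_unique:
  assumes \<gamma>: "\<gamma> \<in> LM0" and w: "is_differential F \<gamma> \<omega>" "is_differential F \<gamma> \<omega>'"
  shows "triple_eq (\<omega> x) (\<omega>' x)"
proof -
  obtain R h k Hl Kl where "loop_rep \<gamma> R h k Hl Kl" using LM0_loop_rep[OF \<gamma>] .
  then interpret loop_rep \<gamma> R h k Hl Kl .
  have sk: "smooth_loop_fun (\<lambda>x. inverse (k x 0))"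
    by (rule smooth_loop_fun_inverse) (use sm_smooth_fun[OF k, of 0] R k_per[of 0] k_nz[of 0] in \<open>auto simp: smooth_loop_fun_def\<close>)
  have sf: "smooth_form \<omega>" "smooth_form \<omega>'" using w by (auto simp: is_differential_def)
  have eqI: "integral {0..2 * pi} (\<lambda>x. pairing (\<omega> x) (coords \<gamma> X x)) = integral {0..2 * pi} (\<lambda>x. pairing (\<omega>' x) (coords \<gamma> X x))" if X: "X \<in> LTM0" for X
  proof -
    obtain \<delta> \<Gamma> where v: "variation \<gamma> X \<delta> \<Gamma>" using variation_exists[OF \<gamma> X] by blast
    show ?thesis
      using vector_derivative_unique_at w X v unfolding is_differential_def by blast
  qed
  have sl: "smooth_loop_fun (\<lambda>x. lcoeff (fst (\<alpha> x)) n)" if "smooth_form \<alpha>" for \<alpha> n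
    using smooth_loop_fun_lcoeff that unfolding smooth_form_def by blast
  have A: "lcoeff (fst (\<omega> x)) (int n) = lcoeff (fst (\<omega>' x)) (int n)" for x n
    by (rule smooth_loop_fun_eqI[OF sl[OF sf(1)] sl[OF sf(2)]])
      (use eqI[OF monomial_LTM0(1)] in \<open>simp add: pairing_exterior_monomial\<close>)
  define Bf where "Bf \<alpha> n x = lcoeff (fst (\<alpha> x)) (1 - int n) + (if n = 1 then fst (snd (\<alpha> x)) else 0) + (if n = 0 then snd (snd (\<alpha> x)) / k x 0 else 0)"
    for \<alpha> :: "real \<Rightarrow> triple" and n :: nat and x
  have sz: "smooth_loop_fun (\<lambda>x. 0)" by (simp add: smooth_loop_fun_sm sm_const)
  have sB: "smooth_loop_fun (Bf \<alpha> n)" if "smooth_form \<alpha>" for \<alpha> n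
  proof -
    have "smooth_loop_fun (\<lambda>x. fst (snd (\<alpha> x)))" "smooth_loop_fun (\<lambda>x. snd (snd (\<alpha> x)))"
      using that by (auto simp: smooth_form_def)
    then show ?thesis unfolding Bf_def[abs_def] divide_inverse
      by (cases "n = 0"; cases "n = 1") (auto intro!: smooth_loop_fun_add smooth_loop_fun_mult sl[OF that] sk sz)
  qed
  have B: "Bf \<omega> n x = Bf \<omega>' n x" for n x
    by (rule smooth_loop_fun_eqI[OF sB[OF sf(1)] sB[OF sf(2)]])
      (use eqI[OF monomial_LTM0(2), unfolded pairing_interior_monomial lcoeff_lamb] in \<open>simp only: Bf_def\<close>)
  have lc: "lcoeff (fst (\<omega> x)) n = lcoeff (fst (\<omega>' x)) n" for n x
  proof (cases "n \<ge> 0")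
    case True
    then show ?thesis using A[of x "nat n"] by simp
  next
    case False
    \<comment> \<open>For negative n the exponent \<open>1 - n\<close> is at least 2, where neither
      v nor u contributes.\<close>
    then have "1 - int (nat (1 - n)) = n" "nat (1 - n) \<noteq> 0" "nat (1 - n) \<noteq> 1" by auto
    then show ?thesis using B[of "nat (1 - n)" x] unfolding Bf_def by (simp only: if_False add_0_right)
  qed
  have v: "fst (snd (\<omega> x)) = fst (snd (\<omega>' x))" using B[of 1 x] lc[of x 0] by (simp add: Bf_def)
  have u: "snd (snd (\<omega> x)) = snd (snd (\<omega>' x))" using B[of 0 x] lc[of x 1] k_nz[of 0 x] R by (simp add: Bf_def)
  obtain r1 where r1: "1 < r1" "sm (Ann r1) (\<lambda>x. fst (\<omega> x))"
    using smooth_loop_circle_obtain sf(1)[unfolded smooth_form_def, THEN conjunct1] by blast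
  obtain r2 where r2: "1 < r2" "sm (Ann r2) (\<lambda>x. fst (\<omega>' x))"
    using smooth_loop_circle_obtain sf(2)[unfolded smooth_form_def, THEN conjunct1] by blast
  have r: "1 < min r1 r2" "Ann (min r1 r2) \<subseteq> Ann r1" "Ann (min r1 r2) \<subseteq> Ann r2"
    using r1(1) r2(1) Ann_mono[of "min r1 r2" r1] Ann_mono[of "min r1 r2" r2] by simp_all
  have "fst (\<omega> x) z = fst (\<omega>' x) z" if "z \<in> circle" for z
    by (rule lcoeffs_determine[OF holomorphic_on_subset[OF sm_holo[OF r1(2)] r(2)] holomorphic_on_subset[OF sm_holo[OF r2(2)] r(3)] r(1) lc that])
  then show ?thesis using u v by (simp add: triple_eq_def prod_eq_iff)
qed

text \<open>\<open>triple_eq\<close> compares first components on the circle, whereas the bracket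
  differentiates them in z. Equality has to be extended to an annulus by the identity theorem before
  it passes to the Poisson operator.\<close>

lemma poisson_op_cong:
  assumes sf: "smooth_form \<omega>" "smooth_form \<omega>'" and eq: "\<And>x. triple_eq (\<omega> x) (\<omega>' x)"
  shows "triple_eq (poisson_op \<gamma> \<omega> x) (poisson_op \<gamma> \<omega>' x)"
proof -
  obtain r1 where r1: "1 < r1" "sm (Ann r1) (\<lambda>x. fst (\<omega> x))"
    using smooth_loop_circle_obtain sf(1)[unfolded smooth_form_def, THEN conjunct1] by blast
  obtain r2 where r2: "1 < r2" "sm (Ann r2) (\<lambda>x. fst (\<omega>' x))"
    using smooth_loop_circle_obtain sf(2)[unfolded smooth_form_def, THEN conjunct1] by blast
  define r where "r = min r1 r2"
  have r: "1 < r" "Ann r \<subseteq> Ann r1" "Ann r \<subseteq> Ann r2"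
    using r1(1) r2(1) Ann_mono[of r r1] Ann_mono[of r r2] by (simp_all add: r_def)
  have e: "fst (\<omega> y) z = fst (\<omega>' y) z" if "z \<in> Ann r" for y z
    by (rule holomorphic_eq_on_Ann[OF holomorphic_on_subset[OF sm_holo[OF r1(2)] r(2)] holomorphic_on_subset[OF sm_holo[OF r2(2)] r(3)] r(1) _ that])
      (use eq in \<open>simp add: triple_eq_def\<close>)
  have "bracket (\<lambda>y. wfun (\<gamma> y)) (\<lambda>y. fst (\<omega> y)) x z = bracket (\<lambda>y. wfun (\<gamma> y)) (\<lambda>y. fst (\<omega>' y)) x z" if "z \<in> circle" for z
    by (rule bracket_cong[OF open_Ann[of r]]) (use that circle_Ann[OF r(1)] e in auto)
  moreover have "snd (\<omega> y) = snd (\<omega>' y)" for y using eq[of y] by (simp add: triple_eq_def)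
  ultimately show ?thesis by (simp add: triple_eq_def poisson_op_def)
qed

lemma triple_eq_trans: "triple_eq a b \<Longrightarrow> triple_eq b c \<Longrightarrow> triple_eq a c"
  and triple_eq_sym: "triple_eq a b \<Longrightarrow> triple_eq b a"
  by (auto simp: triple_eq_def)

section \<open>Coincidence of the two flows\<close>

lemma (in flow) principal_flow_iff:
  assumes \<gamma>: "\<gamma> \<in> LM0" and X: "X \<in> LTM0"
  shows "principal_flow a p \<gamma> X \<longleftrightarrow> toda_flow a p \<gamma> X"
proof
  assume "principal_flow a p \<gamma> X"
  then obtain \<omega> where w: "is_differential (Ham a p) \<gamma> \<omega>" "\<And>x. triple_eq (coords \<gamma> X x) (poisson_op \<gamma> \<omega> x)"
    unfolding principal_flow_def by blast
  have "smooth_form \<omega>" using w(1) by (simp add: is_differential_def)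
  from poisson_op_cong[OF this smooth_form_om is_differential_unique[OF \<gamma> w(1) is_differential_om]]
  have "triple_eq (coords \<gamma> X x) (coords \<gamma> X0 x)" for x
    by (rule triple_eq_trans[OF triple_eq_trans[OF w(2)] triple_eq_sym[OF coords_X0]])
  \<comment> \<open>The u-coordinate of a vector is a logarithmic derivative; this division has to
    be undone to recover X from its coordinates.\<close>
  moreover have "lcoeff (lamb (\<gamma> x)) (-1) \<noteq> 0" for x using lcoeff_lamb k_nz R by simp
  ultimately show "toda_flow a p \<gamma> X"
    unfolding toda_flow_iff using coords_inject[OF X X0_LTM0] by blast
next
  assume "toda_flow a p \<gamma> X"
  then have e: "\<And>x z. z \<in> Dinf \<Longrightarrow> fst X x z = fst X0 x z" "\<And>x z. z \<in> D0p \<Longrightarrow> snd X x z = snd X0 x z"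
    unfolding toda_flow_iff by blast+
  have c: "z \<in> Dinf" "z \<in> D0p" if "z \<in> circle" for z using that by auto
  have "lcoeff (snd X x) n = lcoeff (snd X0 x) n" for x n by (rule lcoeff_cong) (rule e(2)[OF c(2)])
  then have "triple_eq (coords \<gamma> X x) (coords \<gamma> X0 x)" for x
    using e c by (simp add: triple_eq_def coords_def)
  then show "principal_flow a p \<gamma> X"
    unfolding principal_flow_def
    by (intro exI[of _ om] conjI is_differential_om allI triple_eq_trans[OF _ coords_X0])
qed

text \<open>The first conjunct ensures that the equivalence concerns an actual vector field. As
  \<open>toda_flow\<close> fixes X on the two domains, both hierarchies then have exactly this field
  as their flow.\<close>

theorem mainTheorem3:
  fixes a :: idx and p :: nat and \<gamma> :: "real \<Rightarrow> point"
  assumes "\<gamma> \<in> LM0" and "flow_defined a \<gamma>"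
  shows "(\<exists>X\<in>LTM0. toda_flow a p \<gamma> X) \<and>
         (\<forall>X\<in>LTM0. principal_flow a p \<gamma> X \<longleftrightarrow> toda_flow a p \<gamma> X)"
proof -
  obtain R h k Hl Kl where "loop_rep \<gamma> R h k Hl Kl" using LM0_loop_rep[OF assms(1)] .
  then interpret flow \<gamma> R h k Hl Kl a p
    using assms(2) by (simp add: flow_def flow_axioms_def)
  show ?thesis using X0_LTM0 toda_X0 principal_flow_iff[OF assms(1)] by blast
qed

end
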